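(* Let $L$ be a transverse link with braid diagram $D$. The inclusion map $\overline{Kh'}(L)\hookrightarrow Kh'(L)$ (the inclusion, via the isomorphism $\Phi: C(D)\to\overline C(D)\oplus\overline C(D)$ described in the context, of the second summand) sends the reduced odd Plamenevskaya invariant $\overline\psi(D)\in\overline{Kh'}_{0,sl(L)+1}(L)$ to the odd Plamenevskaya invariant $\pm\psi(D)\in Kh'_{0,sl(L)}(L)$.
   Context: Odd Khovanov complex. $R$ is the coefficient ring ($\mathbb Z$ or a field). Let $D$ be an oriented link diagram with crossing set $\mathcal X$ and $n_+$, $n_-$ positive and negative crossings. Each crossing has a 0- and a 1-smoothing (standard Khovanov convention: the orientation-respecting smoothing is the 0-smoothing at a positive crossing and the 1-smoothing at a negative crossing). For $\alpha:\mathcal X\to\{0,1\}$, smoothing each $x$ by its $\alpha(x)$-smoothing gives disjoint planar circles $a_1,\dots,a_k$; put $V_\alpha=R\langle v_1,\dots,v_k\rangle$ ($v_i$ corresponds to $a_i$) and $|\alpha|=\sum_x\alpha(x)$. Choose at each crossing an arrow joining the two arcs of its 0-smoothing; rotating it $90^\circ$ clockwise gives an arrow joining the two arcs of the 1-smoothing. For an edge $e:\alpha_0\to\alpha_1$ of the cube (one value changes from 0 to 1) define $F_e:\Lambda^*V_{\alpha_0}\to\Lambda^*V_{\alpha_1}$: if two circles merge, $F_e$ is the algebra map identifying their generators; if a circle $a$ splits into $a_0,a_1$, with the arrow in the 1-smoothing pointing from $a_0$ to $a_1$, then $F_e(\omega)=(v_0-v_1)\wedge\omega$, where in $\omega$ the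 generator of $a$ is replaced by $v_0$ (equivalently $v_1$). A 2-dimensional face of the cube is of type A (resp. C) if, over $\mathbb Z$, its two compositions of maps $F_e$ are nonzero and anticommute (resp. commute). In the remaining faces both compositions vanish; there the initial resolution has one circle carrying one arrow inside and one arrow outside with interleaved endpoints; going counterclockwise from the tail of the inner arrow, the face is of type X if the next endpoint is the tail of the outer arrow and of type Y if it is its head. A sign assignment is $\varepsilon$: edges $\to\{\pm1\}$ such that each face of type A or X has an even number, and each face of type C or Y an odd number, of edges with $\varepsilon=-1$. $C(D)=\bigoplus_\alpha\Lambda^*V_\alpha$ with differential $d=\sum_e\varepsilon(e)F_e$; up to isomorphism it does not depend on the choices. Its homology is $Kh'(L)$, bigraded as $Kh'_{r,Q}(L)$: the summand $\Lambda^kV_\alpha$ has homological grading $r=|\alpha|-n_-$ and quantum grading $Q=\dim V_\alpha-2k+n_+-2n_-+|\alpha|$. Reduced complex. Let $\varphi_\alpha:V_\alpha\to R$, $\sum r^iv_i\mapsto\sum r^i$, and $\Lambda^*_\circ V_\alpha=\Lambda^*(\ker\varphi_\alpha)\subset\Lambda^*V_\alpha$. Then $\overline C(D)=\bigoplus_\alpha\Lambda^*_\circ V_\alpha$ is a subcomplex of $C(D)$; its homology is $\overline{Kh'}(L)$, where $\Lambda^k_\circ V_\alpha$ has homological grading $r=|\alpha|-n_-$ and quantum grading $\dim\ker\varphi_\alpha-2k+n_+-2n_-+|\alpha|$. For a point $p\in D$ away from crossings let $v_p$ be, in each resolution, the generator of the circle through $p$, and $\overline C^{(p)}(D)=v_p\wedge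 C(D)\subset C(D)$. There is an isomorphism $X^p_D:\overline C^{(p)}(D)\to\overline C(D)$ which on each vertex is, up to a sign depending on the vertex, the inverse of $\Lambda^*_\circ V_\alpha\to v_p\wedge\Lambda^*V_\alpha$, $\eta\mapsto v_p\wedge\eta$. The splitting $\Phi$. Let $O$ be a disjoint crossingless circle with generator $v_0$, $p\in O$, $q\in D$. $\Phi$ is the composite $\Phi_4\circ\Phi_3\circ\Phi_2\circ\Phi_1$ of isomorphisms (vertexwise signs being chosen so that they are chain maps): $\Phi_1:C(D)\to\overline C^{(p)}(D\sqcup O)$, $\omega\mapsto v_0\wedge\omega$; $\Phi_2=(X^q_{D\sqcup O})^{-1}\circ X^p_{D\sqcup O}:\overline C^{(p)}(D\sqcup O)\to\overline C^{(q)}(D\sqcup O)$; $\Phi_3:\overline C^{(q)}(D\sqcup O)\to\overline C^{(q)}(D)\oplus\overline C^{(q)}(D)$, given for $\omega\in\overline C^{(q)}(D)$ by $\omega\mapsto(\omega,0)$ and $v_0\wedge\omega\mapsto(0,\omega)$; $\Phi_4=X^q_D\oplus X^q_D$. On homology it gives $Kh'_{m,s}(L)\cong\overline{Kh'}_{m,s-1}(L)\oplus\overline{Kh'}_{m,s+1}(L)$, the second summand here being the one shifted by $+1$. The invariants. A transverse link $L$ is represented by closed braid diagrams; for a braid diagram $D$ on $b$ strands, $sl(L)=-b+n_+-n_-$. Let $\alpha'$ be the resolution with the 0-smoothing at every positive and the 1-smoothing at every negative crossing; it consists of $b$ parallel circles. $\psi(D)=v_1\wedge\cdots\wedge v_b\in\Lambda^bV_{\alpha'}$,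 and $\overline\psi(D)$ is a generator of $\Lambda^{b-1}_\circ V_{\alpha'}\cong R$, namely $\pm(v_1-v_2)\wedge(v_2-v_3)\wedge\cdots\wedge(v_{b-1}-v_b)$. Both are cycles, and the same symbols denote their homology classes (well defined up to sign). *)

theory Defs
  imports Main "HOL-Library.Function_Algebras"
begin

section \<open>Exterior algebras of free modules\<close>

text \<open>
  For a finite set \<open>S\<close> of naturals, the exterior algebra of the free module with basis
  \<open>v\<^sub>i\<close> (\<open>i \<in> S\<close>) has the basis of monomials \<open>v\<^sub>I\<close> (\<open>I \<subseteq> S\<close>), the product of the \<open>v\<^sub>i\<close>, \<open>i \<in> I\<close>,
  in increasing order. An element is represented by its coefficient function; addition,
  negation and zero are pointwise.
\<close>

type_synonym 'r ext = "nat set \<Rightarrow> 'r"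

definition ext_alg :: "nat set \<Rightarrow> 'r::comm_ring_1 ext set" where
  "ext_alg S = {\<omega>. \<forall>I. \<omega> I \<noteq> 0 \<longrightarrow> I \<subseteq> S}"

definition smul :: "'r::comm_ring_1 \<Rightarrow> 'r ext \<Rightarrow> 'r ext" where
  "smul r \<omega> = (\<lambda>I. r * \<omega> I)"

definition ext_one :: "'r::comm_ring_1 ext" where
  "ext_one = (\<lambda>I. if I = {} then 1 else 0)"

definition gen :: "nat \<Rightarrow> 'r::comm_ring_1 ext" where
  "gen i = (\<lambda>I. if I = {i} then 1 else 0)"

definition shuffle_sign :: "nat set \<Rightarrow> nat set \<Rightarrow> 'r::comm_ring_1" where
  "shuffle_sign I J = (- 1) ^ card {(i, j). i \<in> I \<and> j \<in> J \<and> j < i}"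

text \<open>\<open>v\<^sub>I \<and> v\<^sub>J\<close> is \<open>shuffle_sign I J\<close> times \<open>v\<close> indexed by \<open>I \<union> J\<close> if \<open>I\<close>, \<open>J\<close> are disjoint, and 0 otherwise.\<close>

definition wedge :: "'r::comm_ring_1 ext \<Rightarrow> 'r ext \<Rightarrow> 'r ext" where
  "wedge \<omega> \<eta> = (\<lambda>K. \<Sum>I\<in>Pow K. shuffle_sign I (K - I) * \<omega> I * \<eta> (K - I))"

definition wedge_list :: "'r::comm_ring_1 ext list \<Rightarrow> 'r ext" where
  "wedge_list us = foldr wedge us ext_one"

text \<open>The algebra map on the exterior algebra over \<open>S\<close> with \<open>v\<^sub>i \<mapsto> v\<close> indexed by \<open>f i\<close>.\<close>

definition ext_map :: "nat set \<Rightarrow> (nat \<Rightarrow> nat) \<Rightarrow> 'r::comm_ring_1 ext \<Rightarrow> 'r ext" where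
  "ext_map S f \<omega> =
     (\<Sum>I\<in>Pow S. smul (\<omega> I) (wedge_list (map (\<lambda>i. gen (f i)) (sorted_list_of_set I))))"

definition ker_phi :: "nat set \<Rightarrow> 'r::comm_ring_1 ext set" where
  "ker_phi S = {u \<in> ext_alg S. (\<forall>I. u I \<noteq> 0 \<longrightarrow> card I = 1) \<and> (\<Sum>i\<in>S. u {i}) = 0}"

text \<open>The image of \<open>\<Lambda>\<^sup>*(ker \<phi>)\<close> in \<open>\<Lambda>\<^sup>*V\<close>, that is, the subalgebra generated by \<open>ker \<phi>\<close>.\<close>

inductive_set reduced_ext :: "nat set \<Rightarrow> 'r::comm_ring_1 ext set" for S :: "nat set" where
  one: "ext_one \<in> reduced_ext S"
| add: "\<omega> \<in> reduced_ext S \<Longrightarrow> \<eta> \<in> reduced_ext S \<Longrightarrow> \<omega> + \<eta> \<in> reduced_ext S"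
| smul: "\<omega> \<in> reduced_ext S \<Longrightarrow> smul r \<omega> \<in> reduced_ext S"
| wedge: "u \<in> ker_phi S \<Longrightarrow> \<omega> \<in> reduced_ext S \<Longrightarrow> wedge u \<omega> \<in> reduced_ext S"


section \<open>Link diagrams and their resolutions\<close>

text \<open>
  Planar diagram code: \<open>pd D x\<close> lists the edges at the four ends of the crossing \<open>x\<close>,
  counterclockwise and beginning with the incoming end of the understrand (so the overstrand
  runs from end 3 to end 1 if \<open>x\<close> is positive, and from end 1 to end 3 if it is negative).
  An edge not occurring in any \<open>pd D x\<close> is a crossingless circle. Points of the
  diagram away from the crossings are represented by the edges on which they lie.
\<close>

record diagram =
  crossings :: "nat set"
  edges :: "nat set"
  pd :: "nat \<Rightarrow> nat list"
  positive :: "nat \<Rightarrow> bool"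

definition n_plus :: "diagram \<Rightarrow> int" where
  "n_plus D = int (card {x \<in> crossings D. positive D x})"

definition n_minus :: "diagram \<Rightarrow> int" where
  "n_minus D = int (card {x \<in> crossings D. \<not> positive D x})"

definition add_circle :: "nat \<Rightarrow> diagram \<Rightarrow> diagram" where
  "add_circle z D = D\<lparr>edges := insert z (edges D)\<rparr>"

text \<open>
  A vertex of the cube is given by the set \<open>\<alpha>\<close> of crossings with value 1. The 0-smoothing joins
  the ends 0, 1 and the ends 2, 3 of a crossing; the 1-smoothing joins 0, 3 and 1, 2. At a
  positive crossing the outgoing ends are 1 and 2, at a negative one they are 2 and 3, so
  these are the orientation-respecting smoothings of positive and negative crossings, respectively.
\<close>

definition smoothing_arcs :: "diagram \<Rightarrow> nat set \<Rightarrow> (nat \<times> nat) set" where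
  "smoothing_arcs D \<alpha> = (\<Union>x\<in>crossings D.
     if x \<in> \<alpha> then {(pd D x ! 0, pd D x ! 3), (pd D x ! 1, pd D x ! 2)}
     else {(pd D x ! 0, pd D x ! 1), (pd D x ! 2, pd D x ! 3)})"

text \<open>The circle of the resolution \<open>\<alpha>\<close> that contains the edge \<open>a\<close>, named by its least edge.\<close>

definition circle :: "diagram \<Rightarrow> nat set \<Rightarrow> nat \<Rightarrow> nat" where
  "circle D \<alpha> a =
     Min {e \<in> edges D. (a, e) \<in> (smoothing_arcs D \<alpha> \<union> (smoothing_arcs D \<alpha>)\<inverse>)\<^sup>*}"

definition circles :: "diagram \<Rightarrow> nat set \<Rightarrow> nat set" where
  "circles D \<alpha> = circle D \<alpha> ` edges D"

definition vgen :: "diagram \<Rightarrow> nat set \<Rightarrow> nat \<Rightarrow> 'r::comm_ring_1 ext" where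
  "vgen D \<alpha> p = gen (circle D \<alpha> p)"


section \<open>Edge maps\<close>

text \<open>
  A choice of arrows is a predicate \<open>ar\<close> on crossings: in the 0-smoothing the arrow at \<open>x\<close> runs
  from the arc joining the ends 0, 1 to the arc joining 2, 3 if \<open>ar x\<close>, and in the opposite direction
  otherwise. Rotated clockwise by a right angle, it runs in the 1-smoothing from the arc
  joining 0, 3 to the arc joining 1, 2 if \<open>ar x\<close>, and in the opposite direction otherwise.
\<close>

definition edge_map :: "diagram \<Rightarrow> (nat \<Rightarrow> bool) \<Rightarrow> nat set \<Rightarrow> nat \<Rightarrow> 'r::comm_ring_1 ext \<Rightarrow> 'r ext" where
  "edge_map D ar \<alpha> x \<omega> =
    (let \<beta> = insert x \<alpha>; a = circle D \<alpha> (pd D x ! 0) in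
     if a \<noteq> circle D \<alpha> (pd D x ! 2)
     then ext_map (circles D \<alpha>) (circle D \<beta>) \<omega>
     else
       let tail = circle D \<beta> (if ar x then pd D x ! 0 else pd D x ! 1);
           head = circle D \<beta> (if ar x then pd D x ! 1 else pd D x ! 0)
       in wedge (gen tail - gen head)
            (ext_map (circles D \<alpha>) (\<lambda>c. if c = a then tail else circle D \<beta> c) \<omega>))"


section \<open>Types of faces and sign assignments\<close>

text \<open>The types of faces refer to the maps over the integers, whatever the coefficient ring is.\<close>

definition face_map :: "diagram \<Rightarrow> (nat \<Rightarrow> bool) \<Rightarrow> nat set \<Rightarrow> nat \<Rightarrow> nat \<Rightarrow> int ext \<Rightarrow> int ext" where
  "face_map D ar \<alpha> x y \<omega> = edge_map D ar (insert x \<alpha>) y (edge_map D ar \<alpha> x \<omega>)"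

definition face_nonzero :: "diagram \<Rightarrow> (nat \<Rightarrow> bool) \<Rightarrow> nat set \<Rightarrow> nat \<Rightarrow> nat \<Rightarrow> bool" where
  "face_nonzero D ar \<alpha> x y \<longleftrightarrow>
     (\<exists>\<omega>\<in>ext_alg (circles D \<alpha>). face_map D ar \<alpha> x y \<omega> \<noteq> 0) \<and>
     (\<exists>\<omega>\<in>ext_alg (circles D \<alpha>). face_map D ar \<alpha> y x \<omega> \<noteq> 0)"

definition type_A :: "diagram \<Rightarrow> (nat \<Rightarrow> bool) \<Rightarrow> nat set \<Rightarrow> nat \<Rightarrow> nat \<Rightarrow> bool" where
  "type_A D ar \<alpha> x y \<longleftrightarrow> face_nonzero D ar \<alpha> x y \<and>
     (\<forall>\<omega>\<in>ext_alg (circles D \<alpha>). face_map D ar \<alpha> x y \<omega> = - face_map D ar \<alpha> y x \<omega>)"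

definition type_C :: "diagram \<Rightarrow> (nat \<Rightarrow> bool) \<Rightarrow> nat set \<Rightarrow> nat \<Rightarrow> nat \<Rightarrow> bool" where
  "type_C D ar \<alpha> x y \<longleftrightarrow> face_nonzero D ar \<alpha> x y \<and>
     (\<forall>\<omega>\<in>ext_alg (circles D \<alpha>). face_map D ar \<alpha> x y \<omega> = face_map D ar \<alpha> y x \<omega>)"

text \<open>
  Walking along the circles of a resolution. An end of a crossing is a pair \<open>(x, j)\<close> with \<open>j < 4\<close>;
  from the end by which a crossing is left, \<open>walk_step\<close> follows the edge to its other end and
  then the smoothing arc met there, and returns the end by which this next crossing is left.
\<close>

definition other_end :: "diagram \<Rightarrow> nat \<times> nat \<Rightarrow> nat \<times> nat" where
  "other_end D s = (THE s'. s' \<noteq> s \<and> fst s' \<in> crossings D \<and> snd s' < 4 \<and>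
      pd D (fst s') ! snd s' = pd D (fst s) ! snd s)"

definition walk_step :: "diagram \<Rightarrow> nat set \<Rightarrow> nat \<times> nat \<Rightarrow> nat \<times> nat" where
  "walk_step D \<alpha> s =
    (let (y, j) = other_end D s in (y, (if y \<in> \<alpha> then [3, 2, 1, 0] else [1, 0, 3, 2]) ! j))"

text \<open>
  \<open>next_endpoint D ar \<alpha> x y\<close>: start at the tail of the arrow at \<open>x\<close> and walk along the circle in the
  direction having that arrow on the left, until an arc at \<open>x\<close> or \<open>y\<close> is met again. As the ends are
  numbered counterclockwise, this direction leaves the tail arc by end 1 if this arc joins 0, 1, and
  by end 3 if it joins 2, 3. It is the counterclockwise direction when the arrow at \<open>x\<close> is the
  inner one.
\<close>

definition next_endpoint :: "diagram \<Rightarrow> (nat \<Rightarrow> bool) \<Rightarrow> nat set \<Rightarrow> nat \<Rightarrow> nat \<Rightarrow> nat \<times> nat" where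
  "next_endpoint D ar \<alpha> x y =
    (let s = (x, if ar x then 1 else 3);
         n = (LEAST n. 0 < n \<and> fst ((walk_step D \<alpha> ^^ n) s) \<in> {x, y})
     in (walk_step D \<alpha> ^^ n) s)"

text \<open>
  In \<open>type_X\<close> and \<open>type_Y\<close> the arrow at \<open>x\<close> plays the role of the inner arrow and the one at \<open>y\<close>
  that of the outer arrow. A planar diagram code does not tell inside from outside, but
  the roles may be exchanged: the cyclic order of the four endpoints is then read in the clockwise
  direction from the tail of the outer arrow, which gives the same type.
\<close>

definition type_X :: "diagram \<Rightarrow> (nat \<Rightarrow> bool) \<Rightarrow> nat set \<Rightarrow> nat \<Rightarrow> nat \<Rightarrow> bool" where
  "type_X D ar \<alpha> x y \<longleftrightarrow> \<not> type_A D ar \<alpha> x y \<and> \<not> type_C D ar \<alpha> x y \<and>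
    (case next_endpoint D ar \<alpha> x y of (u, j) \<Rightarrow> u = y \<and> (if ar y then j \<in> {0, 1} else j \<in> {2, 3}))"

definition type_Y :: "diagram \<Rightarrow> (nat \<Rightarrow> bool) \<Rightarrow> nat set \<Rightarrow> nat \<Rightarrow> nat \<Rightarrow> bool" where
  "type_Y D ar \<alpha> x y \<longleftrightarrow> \<not> type_A D ar \<alpha> x y \<and> \<not> type_C D ar \<alpha> x y \<and>
    (case next_endpoint D ar \<alpha> x y of (u, j) \<Rightarrow> u = y \<and> (if ar y then j \<in> {2, 3} else j \<in> {0, 1}))"

text \<open>Below, \<open>\<epsilon> \<alpha> x\<close> is the sign of the edge of the cube from \<open>\<alpha>\<close> to \<open>insert x \<alpha>\<close>.\<close>

definition minus_count :: "(nat set \<Rightarrow> nat \<Rightarrow> int) \<Rightarrow> nat set \<Rightarrow> nat \<Rightarrow> nat \<Rightarrow> nat" where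
  "minus_count \<epsilon> \<alpha> x y =
     card {(\<beta>, u) \<in> {(\<alpha>, x), (\<alpha>, y), (insert x \<alpha>, y), (insert y \<alpha>, x)}. \<epsilon> \<beta> u = - 1}"

definition sign_assignment :: "diagram \<Rightarrow> (nat \<Rightarrow> bool) \<Rightarrow> (nat set \<Rightarrow> nat \<Rightarrow> int) \<Rightarrow> bool" where
  "sign_assignment D ar \<epsilon> \<longleftrightarrow>
    (\<forall>\<alpha>\<subseteq>crossings D. \<forall>x\<in>crossings D - \<alpha>. \<epsilon> \<alpha> x \<in> {1, - 1}) \<and>
    (\<forall>\<alpha>\<subseteq>crossings D. \<forall>x\<in>crossings D - \<alpha>. \<forall>y\<in>crossings D - \<alpha>. x \<noteq> y \<longrightarrow>
       (type_A D ar \<alpha> x y \<or> type_X D ar \<alpha> x y \<longrightarrow> even (minus_count \<epsilon> \<alpha> x y)) \<and>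
       (type_C D ar \<alpha> x y \<or> type_Y D ar \<alpha> x y \<longrightarrow> odd (minus_count \<epsilon> \<alpha> x y)))"


section \<open>The odd Khovanov complex and its reduced version\<close>

type_synonym 'r chain = "nat set \<Rightarrow> 'r ext"

definition chains :: "diagram \<Rightarrow> 'r::comm_ring_1 chain set" where
  "chains D = {c. (\<forall>\<alpha>\<subseteq>crossings D. c \<alpha> \<in> ext_alg (circles D \<alpha>)) \<and> (\<forall>\<alpha>. \<not> \<alpha> \<subseteq> crossings D \<longrightarrow> c \<alpha> = 0)}"

definition diff :: "diagram \<Rightarrow> (nat \<Rightarrow> bool) \<Rightarrow> (nat set \<Rightarrow> nat \<Rightarrow> int) \<Rightarrow> 'r::comm_ring_1 chain \<Rightarrow> 'r chain" where
  "diff D ar \<epsilon> c = (\<lambda>\<beta>. if \<beta> \<subseteq> crossings D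
     then \<Sum>x\<in>\<beta>. smul (of_int (\<epsilon> (\<beta> - {x}) x)) (edge_map D ar (\<beta> - {x}) x (c (\<beta> - {x})))
     else 0)"

definition reduced_chains :: "diagram \<Rightarrow> 'r::comm_ring_1 chain set" where
  "reduced_chains D = {c \<in> chains D. \<forall>\<alpha>\<subseteq>crossings D. c \<alpha> \<in> reduced_ext (circles D \<alpha>)}"

definition point_chains :: "diagram \<Rightarrow> nat \<Rightarrow> 'r::comm_ring_1 chain set" where
  "point_chains D p = (\<lambda>c \<alpha>. wedge (vgen D \<alpha> p) (c \<alpha>)) ` chains D"

definition graded_chains :: "diagram \<Rightarrow> int \<Rightarrow> int \<Rightarrow> 'r::comm_ring_1 chain set" where
  "graded_chains D r Q = {c \<in> chains D. \<forall>\<alpha> I. c \<alpha> I \<noteq> 0 \<longrightarrow>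
     r = int (card \<alpha>) - n_minus D \<and>
     Q = int (card (circles D \<alpha>)) - 2 * int (card I) + n_plus D - 2 * n_minus D + int (card \<alpha>)}"

text \<open>Here \<open>ker \<phi>\<close> has rank \<open>card (circles D \<alpha>) - 1\<close>.\<close>

definition graded_reduced_chains :: "diagram \<Rightarrow> int \<Rightarrow> int \<Rightarrow> 'r::comm_ring_1 chain set" where
  "graded_reduced_chains D r Q = {c \<in> reduced_chains D. \<forall>\<alpha> I. c \<alpha> I \<noteq> 0 \<longrightarrow>
     r = int (card \<alpha>) - n_minus D \<and>
     Q = (int (card (circles D \<alpha>)) - 1) - 2 * int (card I) + n_plus D - 2 * n_minus D + int (card \<alpha>)}"

text \<open>
  Homology of a bigraded complex \<open>G\<close> whose differential \<open>d\<close> has bidegree \<open>(1, 0)\<close>; homology classes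
  are cosets of the group of boundaries.
\<close>

definition boundaries :: "(int \<Rightarrow> int \<Rightarrow> 'r::comm_ring_1 chain set) \<Rightarrow> ('r chain \<Rightarrow> 'r chain) \<Rightarrow>
    int \<Rightarrow> int \<Rightarrow> 'r chain set" where
  "boundaries G d r Q = d ` G (r - 1) Q"

definition hclass :: "(int \<Rightarrow> int \<Rightarrow> 'r::comm_ring_1 chain set) \<Rightarrow> ('r chain \<Rightarrow> 'r chain) \<Rightarrow>
    int \<Rightarrow> int \<Rightarrow> 'r chain \<Rightarrow> 'r chain set" where
  "hclass G d r Q c = (\<lambda>b. c + b) ` boundaries G d r Q"

definition homology :: "(int \<Rightarrow> int \<Rightarrow> 'r::comm_ring_1 chain set) \<Rightarrow> ('r chain \<Rightarrow> 'r chain) \<Rightarrow>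
    int \<Rightarrow> int \<Rightarrow> 'r chain set set" where
  "homology G d r Q = hclass G d r Q ` {c \<in> G r Q. d c = 0}"

definition Kh :: "diagram \<Rightarrow> (nat \<Rightarrow> bool) \<Rightarrow> (nat set \<Rightarrow> nat \<Rightarrow> int) \<Rightarrow> int \<Rightarrow> int \<Rightarrow>
    'r::comm_ring_1 chain set set" where
  "Kh D ar \<epsilon> = homology (graded_chains D) (diff D ar \<epsilon>)"

definition Kh_class :: "diagram \<Rightarrow> (nat \<Rightarrow> bool) \<Rightarrow> (nat set \<Rightarrow> nat \<Rightarrow> int) \<Rightarrow> int \<Rightarrow> int \<Rightarrow>
    'r::comm_ring_1 chain \<Rightarrow> 'r chain set" where
  "Kh_class D ar \<epsilon> = hclass (graded_chains D) (diff D ar \<epsilon>)"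

definition reduced_Kh :: "diagram \<Rightarrow> (nat \<Rightarrow> bool) \<Rightarrow> (nat set \<Rightarrow> nat \<Rightarrow> int) \<Rightarrow> int \<Rightarrow> int \<Rightarrow>
    'r::comm_ring_1 chain set set" where
  "reduced_Kh D ar \<epsilon> = homology (graded_reduced_chains D) (diff D ar \<epsilon>)"

definition reduced_Kh_class :: "diagram \<Rightarrow> (nat \<Rightarrow> bool) \<Rightarrow> (nat set \<Rightarrow> nat \<Rightarrow> int) \<Rightarrow> int \<Rightarrow> int \<Rightarrow>
    'r::comm_ring_1 chain \<Rightarrow> 'r chain set" where
  "reduced_Kh_class D ar \<epsilon> = hclass (graded_reduced_chains D) (diff D ar \<epsilon>)"


section \<open>The splitting\<close>

text \<open>
  The crossingless circle \<open>O\<close> is the additional edge \<open>z\<close> of \<open>add_circle z D\<close>, and it carries the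
  point \<open>p\<close>; the point \<open>q\<close> is an edge of \<open>D\<close>. Both diagrams have the same cube, with
  the same arrows and edge signs. The record collects the vertexwise signs.
\<close>

record splitting_signs =
  sgn_Phi1 :: "nat set \<Rightarrow> int"
  sgn_Xp :: "nat set \<Rightarrow> int"
  sgn_Xq :: "nat set \<Rightarrow> int"
  sgn_Phi3_fst :: "nat set \<Rightarrow> int"
  sgn_Phi3_snd :: "nat set \<Rightarrow> int"
  sgn_XqD :: "nat set \<Rightarrow> int"

definition X_map :: "diagram \<Rightarrow> nat \<Rightarrow> (nat set \<Rightarrow> int) \<Rightarrow> 'r::comm_ring_1 chain \<Rightarrow> 'r chain" where
  "X_map D p \<sigma> c = (\<lambda>\<alpha>. if \<alpha> \<subseteq> crossings D
     then smul (of_int (\<sigma> \<alpha>)) (inv_into (reduced_ext (circles D \<alpha>)) (wedge (vgen D \<alpha> p)) (c \<alpha>))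
     else 0)"

definition Phi1 :: "diagram \<Rightarrow> nat \<Rightarrow> splitting_signs \<Rightarrow> 'r::comm_ring_1 chain \<Rightarrow> 'r chain" where
  "Phi1 D z S c = (\<lambda>\<alpha>. smul (of_int (sgn_Phi1 S \<alpha>)) (wedge (vgen (add_circle z D) \<alpha> z) (c \<alpha>)))"

definition Phi2 :: "diagram \<Rightarrow> nat \<Rightarrow> nat \<Rightarrow> splitting_signs \<Rightarrow> 'r::comm_ring_1 chain \<Rightarrow> 'r chain" where
  "Phi2 D z q S c =
     inv_into (point_chains (add_circle z D) q) (X_map (add_circle z D) q (sgn_Xq S))
       (X_map (add_circle z D) z (sgn_Xp S) c)"

text \<open>
  Up to vertexwise signs on both summands, \<open>Phi3\<close> sends \<open>a + v\<^sub>0 \<and> b\<close> to \<open>(a, b)\<close>, for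
  \<open>a\<close> and \<open>b\<close> in \<open>point_chains D q\<close>.
\<close>

definition Phi3 :: "diagram \<Rightarrow> nat \<Rightarrow> nat \<Rightarrow> splitting_signs \<Rightarrow> 'r::comm_ring_1 chain \<Rightarrow> 'r chain \<times> 'r chain" where
  "Phi3 D z q S =
     inv_into (point_chains D q \<times> point_chains D q)
       (\<lambda>(a, b) \<alpha>. smul (of_int (sgn_Phi3_fst S \<alpha>)) (a \<alpha>) +
          smul (of_int (sgn_Phi3_snd S \<alpha>)) (wedge (vgen (add_circle z D) \<alpha> z) (b \<alpha>)))"

definition Phi4 :: "diagram \<Rightarrow> nat \<Rightarrow> splitting_signs \<Rightarrow> 'r::comm_ring_1 chain \<times> 'r chain \<Rightarrow> 'r chain \<times> 'r chain" where
  "Phi4 D q S = map_prod (X_map D q (sgn_XqD S)) (X_map D q (sgn_XqD S))"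

definition Phi :: "diagram \<Rightarrow> nat \<Rightarrow> nat \<Rightarrow> splitting_signs \<Rightarrow> 'r::comm_ring_1 chain \<Rightarrow> 'r chain \<times> 'r chain" where
  "Phi D z q S = Phi4 D q S \<circ> Phi3 D z q S \<circ> Phi2 D z q S \<circ> Phi1 D z S"

definition chain_map :: "'a set \<Rightarrow> ('a \<Rightarrow> 'a) \<Rightarrow> 'b set \<Rightarrow> ('b \<Rightarrow> 'b) \<Rightarrow> ('a \<Rightarrow> 'b) \<Rightarrow> bool" where
  "chain_map M d N d' f \<longleftrightarrow> (\<forall>c\<in>M. f c \<in> N \<and> f (d c) = d' (f c))"

definition vertex_sign :: "(nat set \<Rightarrow> int) \<Rightarrow> bool" where
  "vertex_sign \<sigma> \<longleftrightarrow> (\<forall>\<alpha>. \<sigma> \<alpha> = 1 \<or> \<sigma> \<alpha> = - 1)"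

text \<open>The type argument is the coefficient ring over which the maps are required to be chain maps.\<close>

definition admissible_signs :: "'r::comm_ring_1 itself \<Rightarrow> diagram \<Rightarrow> (nat \<Rightarrow> bool) \<Rightarrow>
    (nat set \<Rightarrow> nat \<Rightarrow> int) \<Rightarrow> nat \<Rightarrow> nat \<Rightarrow> splitting_signs \<Rightarrow> bool" where
  "admissible_signs TYPE('r) D ar \<epsilon> z q S \<longleftrightarrow>
    (let D' = add_circle z D;
         d = (diff D ar \<epsilon> :: 'r chain \<Rightarrow> 'r chain);
         d' = (diff D' ar \<epsilon> :: 'r chain \<Rightarrow> 'r chain)
     in vertex_sign (sgn_Phi1 S) \<and> vertex_sign (sgn_Xp S) \<and> vertex_sign (sgn_Xq S) \<and>
        vertex_sign (sgn_Phi3_fst S) \<and> vertex_sign (sgn_Phi3_snd S) \<and> vertex_sign (sgn_XqD S) \<and>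
        chain_map (chains D) d (point_chains D' z) d' (Phi1 D z S) \<and>
        chain_map (point_chains D' z) d' (reduced_chains D') d' (X_map D' z (sgn_Xp S)) \<and>
        chain_map (point_chains D' q) d' (reduced_chains D') d' (X_map D' q (sgn_Xq S)) \<and>
        chain_map (point_chains D' q) d'
          (point_chains D q \<times> point_chains D q) (map_prod d d) (Phi3 D z q S) \<and>
        chain_map (point_chains D q) d (reduced_chains D) d (X_map D q (sgn_XqD S)))"

text \<open>The classes of the images of the representatives of \<open>h\<close> all agree, so the unions below are single classes.\<close>

definition Phi_hom :: "diagram \<Rightarrow> (nat \<Rightarrow> bool) \<Rightarrow> (nat set \<Rightarrow> nat \<Rightarrow> int) \<Rightarrow> nat \<Rightarrow> nat \<Rightarrow>
    splitting_signs \<Rightarrow> int \<Rightarrow> int \<Rightarrow> 'r::comm_ring_1 chain set \<Rightarrow> 'r chain set \<times> 'r chain set" where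
  "Phi_hom D ar \<epsilon> z q S m s h =
     (\<Union>c\<in>h. reduced_Kh_class D ar \<epsilon> m (s - 1) (fst (Phi D z q S c)),
      \<Union>c\<in>h. reduced_Kh_class D ar \<epsilon> m (s + 1) (snd (Phi D z q S c)))"

text \<open>The inclusion of the second summand, from reduced homology in bidegree \<open>(m, s + 1)\<close> to bidegree \<open>(m, s)\<close>.\<close>

definition inclusion :: "diagram \<Rightarrow> (nat \<Rightarrow> bool) \<Rightarrow> (nat set \<Rightarrow> nat \<Rightarrow> int) \<Rightarrow> nat \<Rightarrow> nat \<Rightarrow>
    splitting_signs \<Rightarrow> int \<Rightarrow> int \<Rightarrow> 'r::comm_ring_1 chain set \<Rightarrow> 'r chain set" where
  "inclusion D ar \<epsilon> z q S m s h =
     inv_into (Kh D ar \<epsilon> m s) (Phi_hom D ar \<epsilon> z q S m s) (reduced_Kh_class D ar \<epsilon> m (s - 1) 0, h)"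


section \<open>Closed braids and the odd Plamenevskaya invariants\<close>

text \<open>
  A braid word on \<open>b\<close> strands: the letter \<open>(i, True)\<close> is a positive and \<open>(i, False)\<close> a negative
  crossing of the strands in positions \<open>i\<close> and \<open>i + 1\<close>; positions \<open>0, \<dots>, b - 1\<close> are counted from
  left to right, and all strands are oriented upwards.
\<close>

definition braid_word :: "nat \<Rightarrow> (nat \<times> bool) list \<Rightarrow> bool" where
  "braid_word b w \<longleftrightarrow> (\<forall>(i, s)\<in>set w. Suc i < b)"

text \<open>
  \<open>strand_edge b w t k\<close> is the edge in position \<open>k\<close> just above the first \<open>t\<close> letters, before closing:
  the edges at the bottom are \<open>0, \<dots>, b - 1\<close>, and the two edges leaving the \<open>t\<close>-th letter are
  \<open>b + 2 * t\<close> (left) and \<open>b + 2 * t + 1\<close> (right). Closing the braid identifies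
  the edge in position \<open>k\<close> at the top with the edge \<open>k\<close> at the bottom.
\<close>

primrec strand_edge :: "nat \<Rightarrow> (nat \<times> bool) list \<Rightarrow> nat \<Rightarrow> nat \<Rightarrow> nat" where
  "strand_edge b w 0 k = k"
| "strand_edge b w (Suc t) k =
     (if k = fst (w ! t) then b + 2 * t
      else if k = Suc (fst (w ! t)) then b + 2 * t + 1
      else strand_edge b w t k)"

definition close_edge :: "nat \<Rightarrow> (nat \<times> bool) list \<Rightarrow> nat \<Rightarrow> nat" where
  "close_edge b w e =
     (if e \<in> strand_edge b w (length w) ` {..<b}
      then inv_into {..<b} (strand_edge b w (length w)) e else e)"

definition braid_closure :: "nat \<Rightarrow> (nat \<times> bool) list \<Rightarrow> diagram" where
  "braid_closure b w =
    \<lparr>crossings = {..<length w},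
     edges = close_edge b w ` {..<b + 2 * length w},
     pd = (\<lambda>t. let i = fst (w ! t);
                   in_left = close_edge b w (strand_edge b w t i);
                   in_right = close_edge b w (strand_edge b w t (Suc i));
                   out_left = close_edge b w (b + 2 * t);
                   out_right = close_edge b w (b + 2 * t + 1)
               in if snd (w ! t) then [in_right, out_right, out_left, in_left]
                  else [in_left, in_right, out_right, out_left]),
     positive = (\<lambda>t. snd (w ! t))\<rparr>"

definition self_linking :: "nat \<Rightarrow> (nat \<times> bool) list \<Rightarrow> int" where
  "self_linking b w = - int b + n_plus (braid_closure b w) - n_minus (braid_closure b w)"

definition braid_resolution :: "diagram \<Rightarrow> nat set" where
  "braid_resolution D = {x \<in> crossings D. \<not> positive D x}"

definition at_vertex :: "nat set \<Rightarrow> 'r::comm_ring_1 ext \<Rightarrow> 'r chain" where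
  "at_vertex \<alpha> \<omega> = (\<lambda>\<beta>. if \<beta> = \<alpha> then \<omega> else 0)"

text \<open>
  The parallel circles of the braid-like resolution are the ones through the bottom edges
  \<open>0, \<dots>, b - 1\<close>. The two cycles are defined up to sign; these are the representatives
  with sign \<open>+\<close> and the circles ordered by position.
\<close>

definition psi :: "nat \<Rightarrow> (nat \<times> bool) list \<Rightarrow> 'r::comm_ring_1 chain" where
  "psi b w =
    (let D = braid_closure b w; \<alpha> = braid_resolution D
     in at_vertex \<alpha> (wedge_list (map (vgen D \<alpha>) [0..<b])))"

definition reduced_psi :: "nat \<Rightarrow> (nat \<times> bool) list \<Rightarrow> 'r::comm_ring_1 chain" where
  "reduced_psi b w =
    (let D = braid_closure b w; \<alpha> = braid_resolution D
     in at_vertex \<alpha> (wedge_list (map (\<lambda>i. vgen D \<alpha> i - vgen D \<alpha> (Suc i)) [0..<b - 1])))"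

end

theory Submission
  imports Defs
begin

text \<open>
  Let \<open>\<partial>\<close> be the contraction with the augmentation \<open>\<phi>\<close>, the odd derivation with \<open>\<partial> v\<^sub>i = 1\<close>. It satisfies
  \<open>\<partial> (v\<^sub>q \<and> \<omega>) = \<omega> - v\<^sub>q \<and> \<partial> \<omega>\<close>, its kernel and its image are both the reduced algebra, and so it inverts
  \<open>v\<^sub>q \<and> _\<close> on that algebra. Hence, up to vertexwise signs, \<open>\<Phi>\<close> is \<open>c \<mapsto> (c - v\<^sub>q \<and> \<partial> c, \<partial> c)\<close>, a bijection
  with inverse \<open>(u, v) \<mapsto> u + v\<^sub>q \<and> v\<close>. On the top form \<open>v\<^sub>1 \<and> \<dots> \<and> v\<^sub>b\<close> the first component vanishes and the
  second is \<open>\<plusminus> (v\<^sub>1 - v\<^sub>2) \<and> \<dots> \<and> (v\<^bsub>b-1\<^esub> - v\<^sub>b)\<close>, so already on chains \<open>\<Phi>\<close> maps \<open>\<plusminus>\<psi>\<close> to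
  \<open>(0, \<psi>_red)\<close>.

  That \<open>\<Phi>\<close> is a chain map follows from the hypotheses on the signs once the differential is known to
  preserve \<open>v\<^sub>q \<and> C\<close>; outside this set the inverses that define \<open>\<Phi>\<close> take arbitrary values. For
  this one has to know that the circle through \<open>q\<close> is mapped to the circle through \<open>q\<close>, which for a
  merge holds since every circle meets the crossings in an even number of ends.
\<close>

text \<open>Following \<open>c\<close> through the composite shows where the formula for \<Phi>
  comes from. The map at \<open>p\<close> undoes the product with the new generator
  \<open>v_0\<close> by contracting over all circles, \<open>O\<close> included, which leaves
  \<open>c - v_0 \<and> \<partial>c\<close>. Inverting the map at \<open>q\<close> multiplies by
  \<open>v_q\<close> and leaves \<open>v_q \<and> c + v_0 \<and> v_q \<and> \<partial>c\<close>.
  Contracting the parts without and with \<open>v_0\<close> separately gives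
  \<open>c - v_q \<and> \<partial>c\<close> and \<open>\<partial>c\<close>. In homology the obstacle
  is that \<open>inclusion\<close> is itself an \<open>inv_into\<close>, so evaluating it requires
  \<open>Phi_hom\<close> to be injective. Here the graded bijection on chains enters: if both
  components of a difference are boundaries, the pair of bounding chains has a preimage, and this
  preimage bounds the original difference. The invariants are cycles because every edge leaving the
  braid-like vertex merges two neighbouring parallel circles, which kills a factor
  \<open>v_i - v_(i+1)\<close>. The sign in the theorem is the vertex sign at this single vertex
  times \<open>(-1)^(b-1)\<close>, one factor \<open>-1\<close> for each difference when
  \<open>v_0 \<and> (v_0 - v_1) \<and> ...\<close> is rewritten as the top form.\<close>

section \<open>The exterior algebra\<close>

text \<open>Higher-order unification leaves function-valued terms in eta-long form; with the pointwise
  rules active, the simplifier would then rewrite below the abstraction and lose \<open>0\<close> and \<open>+\<close>.\<close>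

lemmas fun_apply_rules = plus_fun_apply zero_fun_apply uminus_apply minus_apply

declare fun_apply_rules [simp del]

text \<open>The sign of moving \<open>v_i\<close> from the front to its place among the generators
  of \<open>K\<close>. The comparison is strict, so \<open>K\<close> and \<open>K - {i}\<close> give
  the same sign.\<close>

definition pos_sign :: "nat \<Rightarrow> nat set \<Rightarrow> 'r::comm_ring_1" where
  "pos_sign i K = (- 1) ^ card {j \<in> K. j < i}"

lemma pos_sign_insert:
  assumes "finite K" "k \<notin> K"
  shows "pos_sign i (insert k K) = (if k < i then - pos_sign i K else (pos_sign i K :: 'r::comm_ring_1))"
proof (cases "k < i")
  case True
  then have "{j \<in> insert k K. j < i} = insert k {j \<in> K. j < i}" by auto
  then show ?thesis using assms True by (simp add: pos_sign_def)
next
  case False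
  then have "{j \<in> insert k K. j < i} = {j \<in> K. j < i}" by auto
  then show ?thesis using False by (simp add: pos_sign_def)
qed

lemma pos_sign_square: "pos_sign i K * pos_sign i K = (1 :: 'r::comm_ring_1)"
  by (simp add: pos_sign_def power_add[symmetric] mult_2[symmetric])

lemma pos_sign_self: "finite K \<Longrightarrow> pos_sign i (K - {i}) = pos_sign i K"
  unfolding pos_sign_def by (rule arg_cong[where f = "\<lambda>A. (- 1) ^ card A"]) auto

lemma shuffle_sign_singleton: "i \<notin> J \<Longrightarrow> shuffle_sign {i} J = pos_sign i J"
proof -
  have "{(i', j). i' \<in> {i} \<and> j \<in> J \<and> j < i'} = Pair i ` {j \<in> J. j < i}" by auto
  then show ?thesis
    by (simp add: shuffle_sign_def pos_sign_def card_image inj_on_def)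
qed

text \<open>A sum over the infinite set \<open>Pow K\<close> is 0 by convention, so a product has no
  coefficients at infinite sets, whereas an arbitrary coefficient function may have some. Hence the
  separate infinite case in the proofs below.\<close>

lemma wedge_infinite: "infinite K \<Longrightarrow> wedge \<omega> \<eta> K = 0"
  by (simp add: wedge_def finite_Pow_iff)

lemma wedge_gen:
  assumes "finite K"
  shows "wedge (gen i) \<omega> K = (if i \<in> K then pos_sign i K * \<omega> (K - {i}) else 0)"
proof (cases "i \<in> K")
  case True
  have "wedge (gen i) \<omega> K = (\<Sum>I\<in>Pow K. if I = {i} then shuffle_sign I (K - I) * \<omega> (K - I) else 0)"
    unfolding wedge_def gen_def by (rule sum.cong) auto
  also have "\<dots> = pos_sign i K * \<omega> (K - {i})"
    using True assms by (simp add: shuffle_sign_singleton pos_sign_self)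
  finally show ?thesis using True by simp
next
  case False
  then have "wedge (gen i) \<omega> K = 0"
    unfolding wedge_def gen_def by (intro sum.neutral) auto
  then show ?thesis using False by simp
qed

lemma smul_smul: "smul r (smul s \<omega>) = smul (r * s) \<omega>"
  by (simp add: smul_def mult.assoc)

lemma smul_1 [simp]: "smul 1 \<omega> = \<omega>"
  by (simp add: smul_def)

lemma smul_minus_1: "smul (- 1) \<omega> = - \<omega>"
  by (simp add: smul_def fun_apply_rules fun_eq_iff)

lemma smul_0_right [simp]: "smul r 0 = 0"
  by (simp add: smul_def fun_apply_rules fun_eq_iff)

lemma smul_0_left [simp]: "smul 0 \<omega> = 0"
  by (simp add: smul_def fun_apply_rules fun_eq_iff)

lemma smul_add_right: "smul r (\<omega> + \<eta>) = smul r \<omega> + smul r \<eta>"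
  by (simp add: smul_def fun_apply_rules fun_eq_iff distrib_left)

lemma smul_diff_right: "smul r (\<omega> - \<eta>) = smul r \<omega> - smul r \<eta>"
  by (simp add: smul_def fun_apply_rules fun_eq_iff right_diff_distrib)

lemma smul_add_left: "smul (r + s) \<omega> = smul r \<omega> + smul s \<omega>"
  by (simp add: smul_def fun_apply_rules fun_eq_iff distrib_right)

lemma smul_sum_right: "smul r (sum f A) = (\<Sum>i\<in>A. smul r (f i))"
  by (induction A rule: infinite_finite_induct) (auto simp: smul_add_right)

lemma smul_sum_left: "smul (sum f A) \<omega> = (\<Sum>i\<in>A. smul (f i) \<omega>)"
  by (induction A rule: infinite_finite_induct) (auto simp: smul_add_left)

lemma wedge_add_left: "wedge (\<omega> + \<omega>') \<eta> = wedge \<omega> \<eta> + wedge \<omega>' \<eta>"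
  by (simp add: wedge_def fun_apply_rules fun_eq_iff algebra_simps sum.distrib)

lemma wedge_add_right: "wedge \<omega> (\<eta> + \<eta>') = wedge \<omega> \<eta> + wedge \<omega> \<eta>'"
  by (simp add: wedge_def fun_apply_rules fun_eq_iff algebra_simps sum.distrib)

lemma wedge_smul_left: "wedge (smul r \<omega>) \<eta> = smul r (wedge \<omega> \<eta>)"
  by (simp add: wedge_def smul_def fun_apply_rules fun_eq_iff sum_distrib_left mult_ac)

lemma wedge_smul_right: "wedge \<omega> (smul r \<eta>) = smul r (wedge \<omega> \<eta>)"
  by (simp add: wedge_def smul_def fun_apply_rules fun_eq_iff sum_distrib_left mult_ac)

lemma wedge_0_left [simp]: "wedge 0 \<eta> = 0"
  by (simp add: wedge_def fun_apply_rules fun_eq_iff)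

lemma wedge_0_right [simp]: "wedge \<omega> 0 = 0"
  by (simp add: wedge_def fun_apply_rules fun_eq_iff)

lemma wedge_minus_right: "wedge \<omega> (- \<eta>) = - wedge \<omega> \<eta>"
  by (simp add: smul_minus_1[symmetric] wedge_smul_right)

lemma wedge_minus_left: "wedge (- \<omega>) \<eta> = - wedge \<omega> \<eta>"
  by (simp add: smul_minus_1[symmetric] wedge_smul_left)

lemma wedge_diff_left: "wedge (\<omega> - \<omega>') \<eta> = wedge \<omega> \<eta> - wedge \<omega>' \<eta>"
  using wedge_add_left[of \<omega> "- \<omega>'" \<eta>] by (simp add: wedge_minus_left)

lemma wedge_diff_right: "wedge \<omega> (\<eta> - \<eta>') = wedge \<omega> \<eta> - wedge \<omega> \<eta>'"
  using wedge_add_right[of \<omega> \<eta> "- \<eta>'"] by (simp add: wedge_minus_right)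

lemma wedge_sum_left: "wedge (sum f A) \<eta> = (\<Sum>i\<in>A. wedge (f i) \<eta>)"
  by (induction A rule: infinite_finite_induct) (auto simp: wedge_add_left)

lemma wedge_sum_right: "wedge \<omega> (sum f A) = (\<Sum>i\<in>A. wedge \<omega> (f i))"
  by (induction A rule: infinite_finite_induct) (auto simp: wedge_add_right)

lemma wedge_gen_square: "wedge (gen i) (wedge (gen i) \<omega>) = 0"
proof
  fix K
  show "wedge (gen i) (wedge (gen i) \<omega>) K = 0 K"
    by (cases "finite K") (auto simp: wedge_gen wedge_infinite fun_apply_rules)
qed

text \<open>Exactly one of \<open>i < j\<close>, \<open>j < i\<close> holds, so in exactly one of
  the two orders the generator inserted first counts in the sign of the second. As a relation
  between operators it reorders nested left multiplications directly, without associativity.\<close>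

lemma wedge_gen_anticommute:
  "wedge (gen i) (wedge (gen j) \<omega>) = - wedge (gen j) (wedge (gen i) \<omega>)"
proof (cases "i = j")
  case True
  then show ?thesis by (simp add: wedge_gen_square)
next
  case False
  show ?thesis
  proof
    fix K
    consider "infinite K" | "finite K" "\<not> (i \<in> K \<and> j \<in> K)" | "finite K" "i \<in> K" "j \<in> K" by blast
    then show "wedge (gen i) (wedge (gen j) \<omega>) K = (- wedge (gen j) (wedge (gen i) \<omega>)) K"
    proof cases
      case 3
      define L where "L = K - {i, j}"
      have L: "finite L" "i \<notin> L" "j \<notin> L" and K: "K = insert i (insert j L)"
        using 3 by (auto simp: L_def)
      have "K - {i} = insert j L" "K - {j} = insert i L" using K L False by auto
      then show ?thesis
        using 3 L False by (auto simp: wedge_gen K pos_sign_insert insert_commute fun_apply_rules)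
    qed (auto simp: wedge_infinite wedge_gen fun_apply_rules)
  qed
qed

lemma wedge_gen_diff_commute:
  "wedge (gen i - gen j) (wedge (gen k) \<omega>) = - wedge (gen k) (wedge (gen i - gen j) \<omega>)"
  using wedge_gen_anticommute[of i k \<omega>] wedge_gen_anticommute[of j k \<omega>]
  by (simp add: wedge_diff_left wedge_diff_right)

section \<open>Closure properties of the exterior algebra over a set of generators\<close>

lemma ext_alg_iff: "\<omega> \<in> ext_alg S \<longleftrightarrow> (\<forall>I. \<not> I \<subseteq> S \<longrightarrow> \<omega> I = 0)"
  by (auto simp: ext_alg_def)

lemma ext_alg_0 [simp]: "0 \<in> ext_alg S"
  by (simp add: ext_alg_iff fun_apply_rules)

lemma ext_alg_one [simp]: "ext_one \<in> ext_alg S"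
  by (auto simp: ext_alg_iff ext_one_def)

lemma ext_alg_gen: "i \<in> S \<Longrightarrow> gen i \<in> ext_alg S"
  by (auto simp: ext_alg_iff gen_def)

lemma ext_alg_add: "\<omega> \<in> ext_alg S \<Longrightarrow> \<eta> \<in> ext_alg S \<Longrightarrow> \<omega> + \<eta> \<in> ext_alg S"
  by (simp add: ext_alg_iff fun_apply_rules)

lemma ext_alg_smul: "\<omega> \<in> ext_alg S \<Longrightarrow> smul r \<omega> \<in> ext_alg S"
  by (simp add: ext_alg_iff smul_def)

lemma ext_alg_uminus: "\<omega> \<in> ext_alg S \<Longrightarrow> - \<omega> \<in> ext_alg S"
  by (simp add: ext_alg_iff fun_apply_rules)

lemma ext_alg_diff: "\<omega> \<in> ext_alg S \<Longrightarrow> \<eta> \<in> ext_alg S \<Longrightarrow> \<omega> - \<eta> \<in> ext_alg S"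
  by (simp add: ext_alg_iff fun_apply_rules)

lemma ext_alg_sum: "(\<And>i. i \<in> A \<Longrightarrow> f i \<in> ext_alg S) \<Longrightarrow> sum f A \<in> ext_alg S"
  by (induction A rule: infinite_finite_induct) (auto intro: ext_alg_add)

lemma ext_alg_wedge:
  assumes "\<omega> \<in> ext_alg S" "\<eta> \<in> ext_alg S"
  shows "wedge \<omega> \<eta> \<in> ext_alg S"
  unfolding ext_alg_def
proof safe
  fix K i assume "wedge \<omega> \<eta> K \<noteq> 0" and i: "i \<in> K"
  then obtain I where "I \<subseteq> K" and "shuffle_sign I (K - I) * \<omega> I * \<eta> (K - I) \<noteq> 0"
    unfolding wedge_def by (meson PowD sum.not_neutral_contains_not_neutral)
  then have "\<omega> I \<noteq> 0" "\<eta> (K - I) \<noteq> 0" by auto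
  then have "I \<subseteq> S" "K - I \<subseteq> S" using assms by (auto simp: ext_alg_def)
  then show "i \<in> S" using i by blast
qed

lemma ext_alg_mono: "S \<subseteq> T \<Longrightarrow> ext_alg S \<subseteq> ext_alg T"
  by (auto simp: ext_alg_def)

lemma ext_alg_zero_outside: "\<omega> \<in> ext_alg S \<Longrightarrow> \<not> I \<subseteq> S \<Longrightarrow> \<omega> I = 0"
  by (auto simp: ext_alg_def)

lemma wedge_list_in_ext_alg: "set us \<subseteq> ext_alg S \<Longrightarrow> wedge_list us \<in> ext_alg S"
  by (induction us) (auto simp: wedge_list_def intro: ext_alg_wedge)

section \<open>Ordered products of generators and algebra maps\<close>

lemma wedge_list_Nil [simp]: "wedge_list [] = ext_one"
  by (simp add: wedge_list_def)

lemma wedge_list_Cons [simp]: "wedge_list (u # us) = wedge u (wedge_list us)"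
  by (simp add: wedge_list_def)

definition gen_prod :: "(nat \<Rightarrow> nat) \<Rightarrow> nat set \<Rightarrow> 'r::comm_ring_1 ext" where
  "gen_prod f I = wedge_list (map (\<lambda>i. gen (f i)) (sorted_list_of_set I))"

lemma gen_prod_empty [simp]: "gen_prod f {} = ext_one"
  by (simp add: gen_prod_def)

text \<open>Prepending a new least index costs no sign; this is why the inductions on index sets add
  elements in decreasing order.\<close>

lemma gen_prod_insert_min:
  assumes "finite I" "\<forall>a\<in>I. i < a"
  shows "gen_prod f (insert i I) = wedge (gen (f i)) (gen_prod f I)"
proof -
  have "i \<notin> I" using assms(2) by blast
  then have "sorted_list_of_set (insert i I) = insort i (sorted_list_of_set I)"
    using assms(1) by (simp add: sorted_list_of_set_insert)
  also have "\<dots> = i # sorted_list_of_set I"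
    using assms by (intro insort_is_Cons) (auto simp: less_imp_le)
  finally show ?thesis by (simp add: gen_prod_def)
qed

text \<open>The new factor is moved past those of smaller index, so the sign depends on the indices
  only and \<open>f\<close> may identify some of them. If \<open>i\<close> is already in
  \<open>I\<close>, the factor meets its own copy and the product vanishes.\<close>

lemma wedge_gen_prod:
  assumes "finite I"
  shows "wedge (gen (f i)) (gen_prod f I :: 'r::comm_ring_1 ext) =
    (if i \<in> I then 0 else smul (pos_sign i I) (gen_prod f (insert i I)))"
  using assms
proof (induction I rule: finite_linorder_min_induct)
  case empty
  show ?case by (simp add: pos_sign_def gen_prod_insert_min)
next
  case (insert j I)
  have jI: "j \<notin> I" using insert.hyps by blast
  note min = gen_prod_insert_min[OF insert.hyps(1,2), of f, where ?'a = 'r]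
  consider "i = j" | "i < j" | "j < i" by linarith
  then show ?case
  proof cases
    case 1
    then show ?thesis by (simp add: min wedge_gen_square)
  next
    case 2
    then have "\<forall>a\<in>insert j I. i < a" using insert.hyps(2) by auto
    moreover from this have "{a \<in> insert j I. a < i} = {}" by auto
    then have "pos_sign i (insert j I) = (1 :: 'r)" by (simp only: pos_sign_def) simp
    ultimately show ?thesis
      using insert.hyps(1) 2 by (auto simp: gen_prod_insert_min)
  next
    case 3
    have "wedge (gen (f i)) (gen_prod f (insert j I) :: 'r ext) =
        - wedge (gen (f j)) (wedge (gen (f i)) (gen_prod f I))"
      by (simp add: min wedge_gen_anticommute[of "f i"])
    also have "\<dots> = (if i \<in> I then 0 else smul (- pos_sign i I) (wedge (gen (f j)) (gen_prod f (insert i I))))"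
      by (simp add: insert.IH wedge_smul_right smul_smul smul_minus_1[symmetric])
    also have "wedge (gen (f j)) (gen_prod f (insert i I) :: 'r ext) = gen_prod f (insert j (insert i I))"
      using 3 insert.hyps by (subst gen_prod_insert_min) auto
    finally show ?thesis
      using 3 insert.hyps jI by (auto simp: pos_sign_insert insert_commute)
  qed
qed

lemma gen_prod_in_ext_alg: "finite I \<Longrightarrow> f ` I \<subseteq> S \<Longrightarrow> gen_prod f I \<in> ext_alg S"
  unfolding gen_prod_def by (rule wedge_list_in_ext_alg) (auto intro: ext_alg_gen)

lemma gen_prod_id:
  assumes "finite I"
  shows "gen_prod (\<lambda>i. i) I = (\<lambda>K. if K = I then 1 else (0 :: 'r::comm_ring_1))"
  using assms
proof (induction I rule: finite_linorder_min_induct)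
  case empty
  then show ?case by (simp add: ext_one_def)
next
  case (insert j I)
  have jI: "j \<notin> I" using insert.hyps by blast
  have "{i \<in> insert j I. i < j} = {}" using insert.hyps by auto
  then have sign: "pos_sign j (insert j I) = (1 :: 'r)" by (simp only: pos_sign_def) simp
  show ?case
  proof
    fix K
    show "gen_prod (\<lambda>i. i) (insert j I) K = (if K = insert j I then 1 else (0 :: 'r))"
      using insert.hyps jI sign
      by (cases "finite K")
        (auto simp: gen_prod_insert_min insert.IH wedge_gen wedge_infinite)
  qed
qed

lemma ext_alg_expansion:
  assumes "finite S" "\<omega> \<in> ext_alg S"
  shows "\<omega> = (\<Sum>I\<in>Pow S. smul (\<omega> I) (gen_prod (\<lambda>i. i) I))"
proof
  fix K
  have eval: "(sum f A) K = (\<Sum>I\<in>A. f I K)" for f :: "nat set \<Rightarrow> 'a ext" and A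
    by (induction A rule: infinite_finite_induct) (auto simp: fun_apply_rules)
  have "(\<Sum>I\<in>Pow S. smul (\<omega> I) (gen_prod (\<lambda>i. i) I)) K =
      (\<Sum>I\<in>Pow S. if I = K then \<omega> I else 0)"
    unfolding eval using assms(1)
    by (intro sum.cong) (auto simp: smul_def gen_prod_id finite_subset)
  also have "\<dots> = \<omega> K"
    using assms by (auto simp: ext_alg_def)
  finally show "\<omega> K = (\<Sum>I\<in>Pow S. smul (\<omega> I) (gen_prod (\<lambda>i. i) I)) K" ..
qed

text \<open>Left multiplications by single generators build all monomials, so a property need only
  be checked for these and not for general products.\<close>

lemma ext_alg_induct [consumes 2, case_names one add smul gen]:
  assumes "finite S" "\<omega> \<in> ext_alg S"
    and one: "P ext_one"
    and add: "\<And>\<omega> \<eta>. P \<omega> \<Longrightarrow> P \<eta> \<Longrightarrow> P (\<omega> + \<eta>)"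
    and smul: "\<And>r \<omega>. P \<omega> \<Longrightarrow> P (smul r \<omega>)"
    and gen: "\<And>i \<omega>. i \<in> S \<Longrightarrow> P \<omega> \<Longrightarrow> P (wedge (gen i) \<omega>)"
  shows "P \<omega>"
proof -
  have prod: "P (gen_prod (\<lambda>i. i) I)" if "finite I" "I \<subseteq> S" for I
    using that by (induction I rule: finite_linorder_min_induct) (auto simp: one gen_prod_insert_min gen)
  have zero: "P 0" using smul[OF one, of 0] by simp
  have "P (\<Sum>I\<in>A. smul (\<omega> I) (gen_prod (\<lambda>i. i) I))" if "A \<subseteq> Pow S" for A
    using that
    by (induction A rule: infinite_finite_induct)
      (auto intro!: zero add smul prod finite_subset[OF _ assms(1)])
  then show ?thesis using ext_alg_expansion[OF assms(1,2)] by (metis subset_refl)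
qed

lemma ext_map_gen_prod: "ext_map S f \<omega> = (\<Sum>I\<in>Pow S. smul (\<omega> I) (gen_prod f I))"
  by (simp add: ext_map_def gen_prod_def)

lemma ext_map_add: "ext_map S f (\<omega> + \<eta>) = ext_map S f \<omega> + ext_map S f \<eta>"
  by (simp add: ext_map_def smul_add_left sum.distrib fun_apply_rules)

lemma ext_map_smul: "ext_map S f (smul r \<omega>) = smul r (ext_map S f \<omega>)"
  by (simp add: ext_map_def smul_sum_right smul_smul) (simp add: smul_def)

lemma ext_map_in_ext_alg:
  assumes "finite S" "f ` S \<subseteq> T"
  shows "ext_map S f \<omega> \<in> ext_alg T"
  unfolding ext_map_gen_prod
  using assms by (intro ext_alg_sum ext_alg_smul gen_prod_in_ext_alg) (auto intro: finite_subset)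

text \<open>Multiplicativity for one generator on the left. With linearity this is how the edge maps
  are evaluated later, without expanding into monomials.\<close>

lemma ext_map_wedge_gen:
  assumes "finite S" "i \<in> S"
  shows "ext_map S f (wedge (gen i) \<omega>) = wedge (gen (f i)) (ext_map S f \<omega>)"
proof -
  have fin: "finite I" if "I \<subseteq> S" for I using that assms(1) finite_subset by blast
  have "ext_map S f (wedge (gen i) \<omega>) =
      (\<Sum>I\<in>{I \<in> Pow S. i \<in> I}. smul (pos_sign i I * \<omega> (I - {i})) (gen_prod f I))"
    unfolding ext_map_gen_prod using assms(1)
    by (intro sum.mono_neutral_cong_right) (auto simp: wedge_gen fin)
  \<comment> \<open>Monomials containing \<open>i\<close> correspond to those without it by deleting
    \<open>i\<close>.\<close>
  also have "\<dots> = (\<Sum>J\<in>{J \<in> Pow S. i \<notin> J}. smul (pos_sign i J * \<omega> J) (gen_prod f (insert i J)))"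
    using assms
    by (intro sum.reindex_bij_witness[of _ "insert i" "\<lambda>I. I - {i}"])
      (auto simp: fin pos_sign_self insert_absorb)
  \<comment> \<open>The sum may be extended to all \<open>J\<close> again, because
    \<open>v_(f i)\<close> annihilates the products with \<open>i\<close> in
    \<open>J\<close>.\<close>
  also have "\<dots> = (\<Sum>J\<in>Pow S. smul (\<omega> J) (wedge (gen (f i)) (gen_prod f J)))"
    using assms(1)
    by (intro sum.mono_neutral_cong_left) (auto simp: wedge_gen_prod fin smul_smul mult.commute)
  also have "\<dots> = wedge (gen (f i)) (ext_map S f \<omega>)"
    by (simp add: ext_map_gen_prod wedge_sum_right wedge_smul_right)
  finally show ?thesis .
qed

section \<open>Contraction with the augmentation\<close>

text \<open>Interior product with the functional that is 1 on \<open>v_k\<close> for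
  \<open>k\<close> in \<open>S\<close> and 0 on all other generators: the sign moves
  \<open>v_k\<close> to the front, where it is removed. Besides the augmentation,
  \<open>S = {z}\<close> is used, to extract the part containing \<open>v_z\<close>. Coefficients at
  infinite sets are 0, as for \<open>wedge\<close>.\<close>

definition contract :: "nat set \<Rightarrow> 'r::comm_ring_1 ext \<Rightarrow> 'r ext" where
  "contract S \<omega> = (\<lambda>I. if finite I then \<Sum>k\<in>S - I. pos_sign k I * \<omega> (insert k I) else 0)"

lemma contract_add: "contract S (\<omega> + \<eta>) = contract S \<omega> + contract S \<eta>"
  by (simp add: contract_def fun_apply_rules fun_eq_iff distrib_left sum.distrib)

lemma contract_smul: "contract S (smul r \<omega>) = smul r (contract S \<omega>)"
  by (simp add: contract_def smul_def fun_apply_rules fun_eq_iff sum_distrib_left mult_ac)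

lemma contract_0 [simp]: "contract S 0 = 0"
  by (simp add: contract_def fun_apply_rules fun_eq_iff)

lemma contract_diff: "contract S (\<omega> - \<eta>) = contract S \<omega> - contract S \<eta>"
  by (simp add: contract_def fun_apply_rules fun_eq_iff right_diff_distrib sum_subtractf)

lemma contract_sum: "contract S (sum f A) = (\<Sum>i\<in>A. contract S (f i))"
  by (induction A rule: infinite_finite_induct) (auto simp: contract_add)

lemma contract_support:
  assumes "contract S \<omega> I \<noteq> 0"
  obtains k where "finite I" "k \<in> S" "k \<notin> I" "\<omega> (insert k I) \<noteq> 0"
proof -
  have fin: "finite I" and "(\<Sum>k\<in>S - I. pos_sign k I * \<omega> (insert k I)) \<noteq> 0"
    using assms by (auto simp: contract_def split: if_splits)
  then obtain k where k: "k \<in> S - I" "pos_sign k I * \<omega> (insert k I) \<noteq> 0"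
    by (meson sum.not_neutral_contains_not_neutral)
  from k(2) have "\<omega> (insert k I) \<noteq> 0" by auto
  with fin k(1) show thesis using that by blast
qed

lemma wedge_gen_support:
  assumes "wedge (gen i) \<omega> K \<noteq> 0"
  shows "finite K" "i \<in> K" "\<omega> (K - {i}) \<noteq> 0"
proof -
  show fin: "finite K" using assms by (auto intro: ccontr simp: wedge_infinite)
  show "i \<in> K" "\<omega> (K - {i}) \<noteq> 0" using assms by (auto simp: wedge_gen[OF fin] split: if_splits)
qed

lemma contract_in_ext_alg:
  assumes "\<omega> \<in> ext_alg S"
  shows "contract T \<omega> \<in> ext_alg S"
  unfolding ext_alg_def
proof safe
  fix I i assume "contract T \<omega> I \<noteq> 0" "i \<in> I"
  then show "i \<in> S"
    by (elim contract_support) (use assms in \<open>auto simp: ext_alg_def\<close>)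
qed

lemma contract_one: "contract S ext_one = 0"
  by (auto simp: contract_def ext_one_def fun_apply_rules fun_eq_iff)

text \<open>The derivation rule, compared coefficientwise. If \<open>i\<close> is not in
  \<open>I\<close>, only the term removing \<open>v_i\<close> itself survives on the left. If it is,
  the remaining terms on both sides agree up to one transposition. \<open>S\<close> and
  \<open>T\<close> are separate so that \<open>contract {z}\<close> applies to elements over the
  circles of a diagram.\<close>

lemma contract_wedge_gen:
  assumes S: "finite S" "i \<in> S" and T: "finite T" and \<omega>: "\<omega> \<in> ext_alg T"
  shows "contract S (wedge (gen i) \<omega>) = \<omega> - wedge (gen i) (contract S \<omega>)"
proof
  fix I
  consider "infinite I" | "finite I" "i \<notin> I" | "finite I" "i \<in> I" by blast
  then show "contract S (wedge (gen i) \<omega>) I = (\<omega> - wedge (gen i) (contract S \<omega>)) I"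
  proof cases
    case 1
    then have "\<not> I \<subseteq> T" using T finite_subset by blast
    then show ?thesis using 1 \<omega> by (simp add: contract_def wedge_infinite ext_alg_zero_outside fun_apply_rules)
  next
    case 2
    have "contract S (wedge (gen i) \<omega>) I =
        (\<Sum>k\<in>S - I. if k = i then pos_sign i I * (pos_sign i (insert i I) * \<omega> I) else 0)"
      unfolding contract_def using 2
      by (auto simp: wedge_gen intro!: sum.cong)
    also have "\<dots> = \<omega> I"
      using 2 S by (simp add: pos_sign_insert mult.assoc[symmetric] pos_sign_square)
    finally show ?thesis using 2 by (simp add: wedge_gen fun_apply_rules)
  next
    case 3
    define J where "J = I - {i}"
    have I: "I = insert i J" and J: "finite J" "i \<notin> J" using 3 by (auto simp: J_def)
    \<comment> \<open>Exactly one of \<open>i < k\<close>, \<open>k < i\<close> holds, so passing to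
      the right-hand side changes the sign of exactly one factor.\<close>
    have sign: "pos_sign k I * (pos_sign i (insert k I) * x) = - (pos_sign i I * (pos_sign k J * x))"
      if "k \<in> S - I" for k and x :: 'a
      using that J by (auto simp: I pos_sign_insert mult_ac)
    have "contract S (wedge (gen i) \<omega>) I =
        (\<Sum>k\<in>S - I. pos_sign k I * (pos_sign i (insert k I) * \<omega> (insert k J)))"
      unfolding contract_def using 3
      by (auto simp: wedge_gen J_def insert_Diff_if intro!: sum.cong)
    also have "\<dots> = - (pos_sign i I * (\<Sum>k\<in>S - I. pos_sign k J * \<omega> (insert k J)))"
      unfolding sum_distrib_left sum_negf[symmetric] by (rule sum.cong) (auto simp: sign)
    finally have 1: "contract S (wedge (gen i) \<omega>) I = \<dots>" .
    \<comment> \<open>\<open>J\<close> lacks \<open>i\<close>, so contracting at \<open>J\<close>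
      has one more term than contracting at \<open>I\<close>; after multiplication by
      \<open>v_i\<close> this term is \<open>\<omega> I\<close>.\<close>
    have SJ: "S - J = insert i (S - I)" using S I J by auto
    have "contract S \<omega> J = (\<Sum>k\<in>insert i (S - I). pos_sign k J * \<omega> (insert k J))"
      unfolding contract_def SJ using J by simp
    also have "\<dots> = pos_sign i J * \<omega> I + (\<Sum>k\<in>S - I. pos_sign k J * \<omega> (insert k J))"
      using S 3 by (subst sum.insert) (auto simp: I)
    finally have "contract S \<omega> J = \<dots>" .
    moreover have "pos_sign i J = (pos_sign i I :: 'a)" using J by (simp add: I pos_sign_insert)
    ultimately have "wedge (gen i) (contract S \<omega>) I =
        \<omega> I + pos_sign i I * (\<Sum>k\<in>S - I. pos_sign k J * \<omega> (insert k J))"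
      using 3 by (simp add: wedge_gen J_def[symmetric] distrib_left fun_apply_rules mult.assoc[symmetric] pos_sign_square)
    then show ?thesis by (simp add: 1 fun_apply_rules)
  qed
qed

lemma contract_disjoint:
  assumes "\<omega> \<in> ext_alg S" "S \<inter> T = {}"
  shows "contract T \<omega> = 0"
proof
  fix I
  show "contract T \<omega> I = 0 I"
    by (rule ccontr) (use assms in \<open>auto elim!: contract_support simp: ext_alg_def fun_apply_rules\<close>)
qed

lemma contract_insert:
  assumes "\<omega> \<in> ext_alg S" "finite S" "z \<notin> S"
  shows "contract (insert z S) \<omega> = contract S \<omega>"
proof
  fix I
  have "\<omega> (insert z I) = 0" using assms by (intro ext_alg_zero_outside[of _ S]) auto
  then show "contract (insert z S) \<omega> I = contract S \<omega> I"
    using assms by (cases "z \<in> I") (auto simp: contract_def insert_Diff_if)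
qed

section \<open>The reduced algebra as kernel and image of the contraction\<close>

lemma ker_phi_expansion:
  assumes "finite S" "u \<in> ker_phi S"
  shows "u = (\<Sum>i\<in>S. smul (u {i}) (gen i))"
proof
  fix K
  have eval: "(sum f A) K = (\<Sum>I\<in>A. f I K)" for f :: "nat \<Rightarrow> 'a ext" and A
    by (induction A rule: infinite_finite_induct) (auto simp: fun_apply_rules)
  have "(\<Sum>i\<in>S. smul (u {i}) (gen i)) K = (\<Sum>i\<in>S. if K = {i} then u {i} else 0)"
    by (auto simp: eval smul_def gen_def intro!: sum.cong)
  also have "\<dots> = u K"
  proof (cases "\<exists>i\<in>S. K = {i}")
    case True
    then obtain i where "i \<in> S" "K = {i}" by blast
    then show ?thesis using assms(1) by (simp add: eq_commute)
  next
    case False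
    have "u K = 0"
    proof (rule ccontr)
      assume "u K \<noteq> 0"
      then have "K \<subseteq> S" "card K = 1" using assms(2) by (auto simp: ker_phi_def ext_alg_def)
      then show False using False by (auto simp: card_1_singleton_iff)
    qed
    then show ?thesis using False by (auto intro!: sum.neutral)
  qed
  finally show "u K = (\<Sum>i\<in>S. smul (u {i}) (gen i)) K" ..
qed

lemma gen_diff_in_ker_phi:
  assumes "finite S" "i \<in> S" "j \<in> S"
  shows "(gen i - gen j :: 'r::comm_ring_1 ext) \<in> ker_phi S"
proof -
  have "(\<Sum>k\<in>S. (gen i - gen j :: 'r ext) {k}) = 0"
    using assms by (simp add: gen_def sum_subtractf fun_apply_rules)
  moreover have "gen i - gen j \<in> ext_alg S"
    using assms by (intro ext_alg_diff ext_alg_gen)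
  ultimately show ?thesis by (auto simp: ker_phi_def gen_def fun_apply_rules split: if_splits)
qed

lemma reduced_ext_in_ext_alg: "\<omega> \<in> reduced_ext S \<Longrightarrow> \<omega> \<in> ext_alg S"
  by (induction rule: reduced_ext.induct) (auto intro: ext_alg_add ext_alg_smul ext_alg_wedge simp: ker_phi_def)

lemma reduced_ext_0: "0 \<in> reduced_ext S"
  using reduced_ext.smul[OF reduced_ext.one, of 0] by simp

lemma reduced_ext_uminus: "\<omega> \<in> reduced_ext S \<Longrightarrow> - \<omega> \<in> reduced_ext S"
  using reduced_ext.smul[of \<omega> S "- 1"] by (simp add: smul_minus_1)

lemma reduced_ext_diff: "\<omega> \<in> reduced_ext S \<Longrightarrow> \<eta> \<in> reduced_ext S \<Longrightarrow> \<omega> - \<eta> \<in> reduced_ext S"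
  using reduced_ext.add[OF _ reduced_ext_uminus, of \<omega> S \<eta>] by simp

text \<open>If \<open>\<partial>\<omega> = 0\<close>, then
  \<open>\<partial>(v_i \<and> \<omega>) = \<omega>\<close> for every \<open>i\<close>, so
  \<open>\<partial>(u \<and> \<omega>)\<close> is \<open>\<phi>(u)\<close> times
  \<open>\<omega>\<close>, which is 0 for \<open>u\<close> in the kernel of \<phi>.\<close>

lemma contract_reduced_ext:
  assumes "finite S" "\<omega> \<in> reduced_ext S"
  shows "contract S \<omega> = 0"
  using assms(2)
proof (induction rule: reduced_ext.induct)
  case (wedge u \<omega>)
  have \<omega>: "\<omega> \<in> ext_alg S" using wedge.hyps(2) by (rule reduced_ext_in_ext_alg)
  have \<omega>: "\<omega> \<in> ext_alg S" using wedge.hyps(2) by (rule reduced_ext_in_ext_alg)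
  have gen: "contract S (wedge (gen i) \<omega>) = \<omega>" if "i \<in> S" for i
    unfolding contract_wedge_gen[OF assms(1) that assms(1) \<omega>] wedge.IH by simp
  have "wedge u \<omega> = (\<Sum>i\<in>S. smul (u {i}) (wedge (gen i) \<omega>))"
    by (subst ker_phi_expansion[OF assms(1) wedge.hyps(1)]) (simp only: wedge_smul_left wedge_sum_left)
  then have "contract S (wedge u \<omega>) = (\<Sum>i\<in>S. smul (u {i}) \<omega>)"
    by (simp add: contract_sum contract_smul gen)
  also have "\<dots> = smul (\<Sum>i\<in>S. u {i}) \<omega>"
    by (rule smul_sum_left[symmetric])
  also have "(\<Sum>i\<in>S. u {i}) = 0" using wedge.hyps(1) by (simp add: ker_phi_def)
  finally show ?case by simp
qed (simp_all add: contract_one contract_add contract_smul)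

text \<open>The reduced algebra is defined by generation from inside, so membership of a contraction
  in it needs such a normal form. It is preserved by left multiplication with \<open>v_i\<close>, as
  \<open>v_i = (v_i - v_q) + v_q\<close>.\<close>

lemma ext_alg_reduced_decomposition:
  assumes "finite S" "q \<in> S" "\<omega> \<in> ext_alg S"
  shows "\<exists>\<eta>\<in>reduced_ext S. \<exists>\<theta>\<in>reduced_ext S. \<omega> = \<eta> + wedge (gen q) \<theta>"
proof -
  define P where "P \<omega> \<longleftrightarrow> (\<exists>\<eta>\<in>reduced_ext S. \<exists>\<theta>\<in>reduced_ext S. \<omega> = \<eta> + wedge (gen q) \<theta>)"
    for \<omega> :: "'a ext"
  have P_I: "P \<omega>" if "\<eta> \<in> reduced_ext S" "\<theta> \<in> reduced_ext S" "\<omega> = \<eta> + wedge (gen q) \<theta>" for \<omega> \<eta> \<theta>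
    using that by (auto simp only: P_def)
  have P_E: thesis
    if "P \<omega>" "\<And>\<eta> \<theta>. \<eta> \<in> reduced_ext S \<Longrightarrow> \<theta> \<in> reduced_ext S \<Longrightarrow> \<omega> = \<eta> + wedge (gen q) \<theta> \<Longrightarrow> thesis"
    for \<omega> thesis
    using that by (auto simp only: P_def)
  have "P \<omega>"
    using assms(1,3)
  proof (rule ext_alg_induct)
    show "P ext_one"
      by (rule P_I[OF reduced_ext.one reduced_ext_0]) simp
  next
    fix \<omega> \<omega>' assume "P \<omega>" "P \<omega>'"
    obtain \<eta> \<theta> where 1: "\<eta> \<in> reduced_ext S" "\<theta> \<in> reduced_ext S" "\<omega> = \<eta> + wedge (gen q) \<theta>"
      using \<open>P \<omega>\<close> by (rule P_E)
    obtain \<eta>' \<theta>' where 2: "\<eta>' \<in> reduced_ext S" "\<theta>' \<in> reduced_ext S" "\<omega>' = \<eta>' + wedge (gen q) \<theta>'"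
      using \<open>P \<omega>'\<close> by (rule P_E)
    have "\<omega> + \<omega>' = (\<eta> + \<eta>') + wedge (gen q) (\<theta> + \<theta>')"
      unfolding 1(3) 2(3) wedge_add_right by (simp only: add_ac)
    with reduced_ext.add[OF 1(1) 2(1)] reduced_ext.add[OF 1(2) 2(2)]
    show "P (\<omega> + \<omega>')" by (rule P_I)
  next
    fix r \<omega> assume "P \<omega>"
    then obtain \<eta> \<theta> where 1: "\<eta> \<in> reduced_ext S" "\<theta> \<in> reduced_ext S" "\<omega> = \<eta> + wedge (gen q) \<theta>"
      by (rule P_E)
    have "smul r \<omega> = smul r \<eta> + wedge (gen q) (smul r \<theta>)"
      unfolding 1(3) wedge_smul_right smul_add_right ..
    with reduced_ext.smul[OF 1(1)] reduced_ext.smul[OF 1(2)]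
    show "P (smul r \<omega>)" by (rule P_I)
  next
    fix i \<omega> assume i: "i \<in> S" and "P \<omega>"
    obtain \<eta> \<theta> where 1: "\<eta> \<in> reduced_ext S" "\<theta> \<in> reduced_ext S" "\<omega> = \<eta> + wedge (gen q) \<theta>"
      using \<open>P \<omega>\<close> by (rule P_E)
    define u where "u = (gen i - gen q :: 'a ext)"
    have u: "u \<in> ker_phi S" unfolding u_def using assms i by (intro gen_diff_in_ker_phi)
    have "wedge (gen i) \<omega> = wedge (gen i) \<eta> - wedge (gen q) (wedge (gen i) \<theta>)"
      by (simp add: 1(3) wedge_add_right wedge_gen_anticommute[of i q])
    \<comment> \<open>Under \<open>v_q\<close> the factor \<open>v_i\<close> may be replaced by
      \<open>u\<close>, since \<open>v_q\<close> squares to 0.\<close>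
    also have "\<dots> = wedge u \<eta> + wedge (gen q) (\<eta> - wedge u \<theta>)"
      by (simp add: u_def wedge_diff_left wedge_diff_right wedge_gen_square)
    finally have "wedge (gen i) \<omega> = \<dots>" .
    with reduced_ext.wedge[OF u 1(1)] reduced_ext_diff[OF 1(1) reduced_ext.wedge[OF u 1(2)]]
    show "P (wedge (gen i) \<omega>)" by (rule P_I)
  qed
  then show ?thesis by (simp only: P_def)
qed

text \<open>Contracting the normal form \<open>\<eta> + v_q \<and> \<theta>\<close> returns
  \<open>\<theta>\<close>.\<close>

lemma contract_in_reduced_ext:
  assumes "finite S" "\<omega> \<in> ext_alg S"
  shows "contract S \<omega> \<in> reduced_ext S"
proof (cases "S = {}")
  case True
  then have "contract S \<omega> = 0" by (simp add: contract_def fun_apply_rules fun_eq_iff)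
  then show ?thesis by (simp add: reduced_ext_0)
next
  case False
  then obtain q where q: "q \<in> S" by blast
  obtain \<eta> \<theta> where red: "\<eta> \<in> reduced_ext S" "\<theta> \<in> reduced_ext S"
    and \<omega>: "\<omega> = \<eta> + wedge (gen q) \<theta>"
    using ext_alg_reduced_decomposition[OF assms(1) q assms(2)] by blast
  have "contract S \<omega> = \<theta>"
    unfolding \<omega> contract_add contract_reduced_ext[OF assms(1) red(1)]
      contract_wedge_gen[OF assms(1) q assms(1) reduced_ext_in_ext_alg[OF red(2)]]
      contract_reduced_ext[OF assms(1) red(2)]
    by simp
  with red show ?thesis by simp
qed

lemma contract_contract:
  assumes "finite S" "\<omega> \<in> ext_alg S"
  shows "contract S (contract S \<omega>) = 0"
  using assms by (simp add: contract_reduced_ext contract_in_reduced_ext)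

text \<open>If \<open>v_p \<and> \<omega> = 0\<close>, the derivation rule reads
  \<open>0 = \<omega> - v_p \<and> \<partial>\<omega>\<close>. Multiples of \<open>v_p\<close> can
  thus be recognised by an equation, and the quotient is the contraction.\<close>

lemma wedge_gen_contract:
  assumes "finite S" "p \<in> S" "\<omega> \<in> ext_alg S" "wedge (gen p) \<omega> = 0"
  shows "wedge (gen p) (contract S \<omega>) = \<omega>"
  using contract_wedge_gen[OF assms(1,2,1,3)] assms(4) by simp

lemma inv_into_reduced_ext:
  assumes "finite S" "p \<in> S" "\<omega> \<in> ext_alg S" "wedge (gen p) \<omega> = 0"
  shows "inv_into (reduced_ext S) (wedge (gen p)) \<omega> = contract S \<omega>"
proof (rule inv_into_f_eq)
  have "contract S (wedge (gen p) \<eta>) = \<eta>" if "\<eta> \<in> reduced_ext S" for \<eta> :: "'a ext"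
    using that assms contract_wedge_gen[of S p S \<eta>]
    by (simp add: contract_reduced_ext reduced_ext_in_ext_alg)
  then show "inj_on (wedge (gen p) :: 'a ext \<Rightarrow> _) (reduced_ext S)" by (metis inj_onI)
qed (use assms in \<open>auto simp: contract_in_reduced_ext wedge_gen_contract\<close>)

section \<open>Circles of resolutions\<close>

definition crossing_arcs :: "diagram \<Rightarrow> nat set \<Rightarrow> nat \<Rightarrow> (nat \<times> nat) set" where
  "crossing_arcs D \<alpha> x =
     (if x \<in> \<alpha> then {(pd D x ! 0, pd D x ! 3), (pd D x ! 1, pd D x ! 2)}
      else {(pd D x ! 0, pd D x ! 1), (pd D x ! 2, pd D x ! 3)})"

definition sym_closure :: "('a \<times> 'a) set \<Rightarrow> ('a \<times> 'a) set" where
  "sym_closure A = (A \<union> A\<inverse>)\<^sup>*"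

abbreviation connected_in :: "diagram \<Rightarrow> nat set \<Rightarrow> (nat \<times> nat) set" where
  "connected_in D \<alpha> \<equiv> sym_closure (smoothing_arcs D \<alpha>)"

lemma sym_closure_refl [simp]: "(a, a) \<in> sym_closure A"
  by (simp add: sym_closure_def)

lemma sym_closure_sym: "(a, b) \<in> sym_closure A \<Longrightarrow> (b, a) \<in> sym_closure A"
  unfolding sym_closure_def
  by (metis converse_Un converse_converse converse_iff rtrancl_converse sup_commute)

lemma sym_closure_trans: "(a, b) \<in> sym_closure A \<Longrightarrow> (b, c) \<in> sym_closure A \<Longrightarrow> (a, c) \<in> sym_closure A"
  unfolding sym_closure_def by (rule rtrancl_trans)

lemma sym_closure_arc: "(a, b) \<in> A \<Longrightarrow> (a, b) \<in> sym_closure A"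
  by (auto simp: sym_closure_def)

text \<open>The form in which connectivity is used below: choose a set \<open>K\<close> that no arc
  leaves or enters.\<close>

lemma sym_closure_invariant:
  assumes "(a, b) \<in> sym_closure A" "a \<in> K" "\<And>c d. (c, d) \<in> A \<Longrightarrow> c \<in> K \<longleftrightarrow> d \<in> K"
  shows "b \<in> K"
  using assms(1,2) unfolding sym_closure_def by (induction rule: rtrancl_induct) (use assms(3) in blast)+

lemma sym_closure_subset:
  assumes "A \<subseteq> sym_closure B"
  shows "sym_closure A \<subseteq> sym_closure B"
proof clarify
  fix a b assume "(a, b) \<in> sym_closure A"
  then have "b \<in> {c. (a, c) \<in> sym_closure B}"
    by (rule sym_closure_invariant) (use assms in \<open>auto intro: sym_closure_trans sym_closure_sym\<close>)
  then show "(a, b) \<in> sym_closure B" by simp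
qed

lemma smoothing_arcs_alt: "smoothing_arcs D \<alpha> = (\<Union>x\<in>crossings D. crossing_arcs D \<alpha> x)"
  by (simp add: smoothing_arcs_def crossing_arcs_def)

lemma circle_alt: "circle D \<alpha> a = Min {e \<in> edges D. (a, e) \<in> connected_in D \<alpha>}"
  by (simp add: circle_def sym_closure_def)

lemma card_less_four:
  "card {j \<in> {..<4::nat}. P j} = of_bool (P 0) + of_bool (P 1) + of_bool (P 2) + of_bool (P 3)"
proof -
  have "{..<4::nat} = {0, 1, 2, 3}" by auto
  then have "(\<Sum>j<4. of_bool (P j) :: nat) = of_bool (P 0) + of_bool (P 1) + of_bool (P 2) + of_bool (P 3)"
    by simp
  then show ?thesis by (simp add: sum_of_bool_eq Int_def)
qed

text \<open>What is retained of a link diagram. Applied to singletons, \<open>even_ends\<close> says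
  that each edge occurs an even number of times among the ends of crossings; the version for
  arbitrary \<open>K\<close> is the one applied to unions of arcs. A crossingless circle may be
  added freely.\<close>

locale link_code =
  fixes D :: diagram
  assumes finite_crossings: "finite (crossings D)"
    and finite_edges: "finite (edges D)"
    and ends_in_edges: "x \<in> crossings D \<Longrightarrow> j < 4 \<Longrightarrow> pd D x ! j \<in> edges D"
    and even_ends: "even (\<Sum>x\<in>crossings D. card {j \<in> {..<4}. pd D x ! j \<in> K})"
begin

lemma connected_in_edges: "(a, b) \<in> connected_in D \<alpha> \<Longrightarrow> a \<in> edges D \<Longrightarrow> b \<in> edges D"
  by (erule sym_closure_invariant)
    (auto simp: smoothing_arcs_alt crossing_arcs_def ends_in_edges split: if_splits)

lemma circle_in_class:
  assumes "a \<in> edges D"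
  shows "circle D \<alpha> a \<in> edges D" "(a, circle D \<alpha> a) \<in> connected_in D \<alpha>"
proof -
  have "a \<in> {e \<in> edges D. (a, e) \<in> connected_in D \<alpha>}" using assms by simp
  then have "circle D \<alpha> a \<in> {e \<in> edges D. (a, e) \<in> connected_in D \<alpha>}"
    unfolding circle_alt using finite_edges by (intro Min_in) auto
  then show "circle D \<alpha> a \<in> edges D" "(a, circle D \<alpha> a) \<in> connected_in D \<alpha>" by auto
qed

lemma circle_eqI: "(a, b) \<in> connected_in D \<alpha> \<Longrightarrow> circle D \<alpha> a = circle D \<alpha> b"
  unfolding circle_alt
  by (rule arg_cong[where f = Min]) (auto intro: sym_closure_trans sym_closure_sym)

lemma circle_eq_iff:
  assumes "a \<in> edges D" "b \<in> edges D"
  shows "circle D \<alpha> a = circle D \<alpha> b \<longleftrightarrow> (a, b) \<in> connected_in D \<alpha>"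
proof
  assume "circle D \<alpha> a = circle D \<alpha> b"
  then show "(a, b) \<in> connected_in D \<alpha>"
    using circle_in_class[OF assms(1)] circle_in_class[OF assms(2)]
    by (metis sym_closure_sym sym_closure_trans)
qed (rule circle_eqI)

lemma finite_circles: "finite (circles D \<alpha>)"
  by (simp add: circles_def finite_edges)

lemma circle_in_circles: "a \<in> edges D \<Longrightarrow> circle D \<alpha> a \<in> circles D \<alpha>"
  by (simp add: circles_def)

lemma circles_subset_edges: "circles D \<alpha> \<subseteq> edges D"
  by (auto simp: circles_def circle_in_class)

text \<open>Each crossing other than \<open>x\<close> has an even number of ends in \<open>K\<close>, as its smoothing arcs
  pair them up; hence so does \<open>x\<close>.\<close>

lemma even_ends_at_crossing:
  assumes x: "x \<in> crossings D"
    and K: "\<And>y c d. y \<in> crossings D - {x} \<Longrightarrow> (c, d) \<in> crossing_arcs D \<alpha> y \<Longrightarrow> c \<in> K \<longleftrightarrow> d \<in> K"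
  shows "even (card {j \<in> {..<4}. pd D x ! j \<in> K})"
proof -
  have "even (card {j \<in> {..<4}. pd D y ! j \<in> K})" if y: "y \<in> crossings D - {x}" for y
  proof (cases "y \<in> \<alpha>")
    case True
    then have "pd D y ! 0 \<in> K \<longleftrightarrow> pd D y ! 3 \<in> K" "pd D y ! 1 \<in> K \<longleftrightarrow> pd D y ! 2 \<in> K"
      using K[OF y] by (simp_all add: crossing_arcs_def)
    then show ?thesis unfolding card_less_four by simp
  next
    case False
    then have "pd D y ! 0 \<in> K \<longleftrightarrow> pd D y ! 1 \<in> K" "pd D y ! 2 \<in> K \<longleftrightarrow> pd D y ! 3 \<in> K"
      using K[OF y] by (simp_all add: crossing_arcs_def)
    then show ?thesis unfolding card_less_four by simp
  qed
  then have "even (\<Sum>y\<in>crossings D - {x}. card {j \<in> {..<4}. pd D y ! j \<in> K})"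
    by (intro dvd_sum) auto
  then show ?thesis
    using even_ends[of K] by (simp add: sum.remove[OF finite_crossings x])
qed

text \<open>With \<open>x\<close> removed, the component of end 0 contains an even number of ends of
  \<open>x\<close>, and neither 2 nor 3 because these lie on another circle; hence it contains 1. So
  ends 0 and 1, and likewise 2 and 3, stay connected without the arcs that the new smoothing
  deletes.\<close>

lemma merge_connected:
  assumes x: "x \<in> crossings D" "x \<notin> \<alpha>"
    and merge: "(pd D x ! 0, pd D x ! 2) \<notin> connected_in D \<alpha>"
  shows "connected_in D \<alpha> \<subseteq> connected_in D (insert x \<alpha>)"
proof -
  \<comment> \<open>The arcs away from \<open>x\<close>, common to both smoothings.\<close>
  define R where "R = (\<Union>y\<in>crossings D - {x}. crossing_arcs D \<alpha> y)"
  have arcs: "smoothing_arcs D \<alpha> = R \<union> {(pd D x ! 0, pd D x ! 1), (pd D x ! 2, pd D x ! 3)}"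
    "R \<subseteq> smoothing_arcs D (insert x \<alpha>)"
    using x by (auto simp: smoothing_arcs_alt crossing_arcs_def R_def)
  have R\<alpha>: "sym_closure R \<subseteq> connected_in D \<alpha>" and R\<beta>: "sym_closure R \<subseteq> connected_in D (insert x \<alpha>)"
    using arcs by (auto intro!: sym_closure_subset sym_closure_arc)
  have \<alpha>01: "(pd D x ! 0, pd D x ! 1) \<in> connected_in D \<alpha>" and \<alpha>23: "(pd D x ! 2, pd D x ! 3) \<in> connected_in D \<alpha>"
    by (auto simp: arcs intro: sym_closure_arc)
  have parity: "even (card {j \<in> {..<4}. (a, pd D x ! j) \<in> sym_closure R})" for a
  proof -
    have "(a, c) \<in> sym_closure R \<longleftrightarrow> (a, d) \<in> sym_closure R"
      if "y \<in> crossings D - {x}" "(c, d) \<in> crossing_arcs D \<alpha> y" for y c d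
    proof -
      have "(c, d) \<in> sym_closure R" using that by (auto simp: R_def intro: sym_closure_arc)
      then show ?thesis by (blast intro: sym_closure_trans sym_closure_sym)
    qed
    then show ?thesis
      using even_ends_at_crossing[OF x(1), of \<alpha> "{e. (a, e) \<in> sym_closure R}"] by simp
  qed
  have "(pd D x ! 0, pd D x ! 1) \<in> sym_closure R"
  proof (rule ccontr)
    assume "(pd D x ! 0, pd D x ! 1) \<notin> sym_closure R"
    moreover have "(pd D x ! 0, pd D x ! 2) \<notin> sym_closure R" "(pd D x ! 0, pd D x ! 3) \<notin> sym_closure R"
      using merge R\<alpha> \<alpha>23 by (auto dest: sym_closure_trans sym_closure_sym)
    ultimately show False using parity[of "pd D x ! 0"] unfolding card_less_four by simp
  qed
  moreover have "(pd D x ! 2, pd D x ! 3) \<in> sym_closure R"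
  proof (rule ccontr)
    assume "(pd D x ! 2, pd D x ! 3) \<notin> sym_closure R"
    moreover have "(pd D x ! 2, pd D x ! 0) \<notin> sym_closure R" "(pd D x ! 2, pd D x ! 1) \<notin> sym_closure R"
      using merge R\<alpha> \<alpha>01 by (auto dest: sym_closure_trans sym_closure_sym)
    ultimately show False using parity[of "pd D x ! 2"] unfolding card_less_four by simp
  qed
  ultimately show ?thesis
    unfolding arcs(1) using R\<beta> by (intro sym_closure_subset) (auto intro: sym_closure_arc)
qed

text \<open>All ends of \<open>x\<close> lie on the circle that splits, so a path from
  \<open>p\<close> on another circle uses no arc at \<open>x\<close>, and all other arcs
  persist.\<close>

lemma split_connected_away:
  assumes x: "x \<in> crossings D" "x \<notin> \<alpha>"
    and split: "(pd D x ! 0, pd D x ! 2) \<in> connected_in D \<alpha>"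
    and p: "(p, q) \<in> connected_in D \<alpha>" "(pd D x ! 0, p) \<notin> connected_in D \<alpha>"
  shows "(p, q) \<in> connected_in D (insert x \<alpha>)"
proof -
  define K where "K = {e. (p, e) \<in> connected_in D \<alpha> \<and> (p, e) \<in> connected_in D (insert x \<alpha>)}"
  have 01: "(pd D x ! 0, pd D x ! 1) \<in> connected_in D \<alpha>" and 23: "(pd D x ! 2, pd D x ! 3) \<in> connected_in D \<alpha>"
    using x by (auto simp: smoothing_arcs_alt crossing_arcs_def intro!: sym_closure_arc)
  have "q \<in> K"
    using p(1)
  proof (rule sym_closure_invariant)
    show "p \<in> K" by (simp add: K_def)
    fix c d assume cd: "(c, d) \<in> smoothing_arcs D \<alpha>"
    have cd\<alpha>: "(c, d) \<in> connected_in D \<alpha>" using cd by (rule sym_closure_arc)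
    show "c \<in> K \<longleftrightarrow> d \<in> K"
    proof (cases "(c, d) \<in> crossing_arcs D \<alpha> x")
      case True
      then have "(pd D x ! 0, c) \<in> connected_in D \<alpha>" "(pd D x ! 0, d) \<in> connected_in D \<alpha>"
        using x split 01 23 by (auto simp: crossing_arcs_def intro: sym_closure_trans)
      then show ?thesis
        using p(2) unfolding K_def by (blast intro: sym_closure_trans sym_closure_sym)
    next
      case False
      then have "(c, d) \<in> connected_in D (insert x \<alpha>)"
        using cd by (intro sym_closure_arc) (auto simp: smoothing_arcs_alt crossing_arcs_def split: if_splits)
      then show ?thesis
        using cd\<alpha> unfolding K_def by (blast intro: sym_closure_trans sym_closure_sym)
    qed
  qed
  then show ?thesis by (simp add: K_def)
qed

text \<open>The new arcs join 0 to 3 and 1 to 2, so the edges reachable from 0 or 1 include all four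
  ends; the old arcs at \<open>x\<close> cannot lead out of this set.\<close>

lemma split_connected:
  assumes x: "x \<in> crossings D" "x \<notin> \<alpha>"
    and p: "(pd D x ! 0, p) \<in> connected_in D \<alpha>"
  shows "(pd D x ! 0, p) \<in> connected_in D (insert x \<alpha>) \<or> (pd D x ! 1, p) \<in> connected_in D (insert x \<alpha>)"
proof -
  define K where "K = {e. (pd D x ! 0, e) \<in> connected_in D (insert x \<alpha>) \<or>
    (pd D x ! 1, e) \<in> connected_in D (insert x \<alpha>)}"
  have 03: "(pd D x ! 0, pd D x ! 3) \<in> connected_in D (insert x \<alpha>)"
    and 12: "(pd D x ! 1, pd D x ! 2) \<in> connected_in D (insert x \<alpha>)"
    using x by (auto simp: smoothing_arcs_alt crossing_arcs_def intro!: sym_closure_arc)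
  have "p \<in> K"
    using p
  proof (rule sym_closure_invariant)
    show "pd D x ! 0 \<in> K" by (simp add: K_def)
    fix c d assume cd: "(c, d) \<in> smoothing_arcs D \<alpha>"
    show "c \<in> K \<longleftrightarrow> d \<in> K"
    proof (cases "(c, d) \<in> crossing_arcs D \<alpha> x")
      case True
      then show ?thesis using x 03 12 by (auto simp: crossing_arcs_def K_def)
    next
      case False
      then have "(c, d) \<in> connected_in D (insert x \<alpha>)"
        using cd by (intro sym_closure_arc) (auto simp: smoothing_arcs_alt crossing_arcs_def split: if_splits)
      then show ?thesis
        unfolding K_def by (blast intro: sym_closure_trans sym_closure_sym)
    qed
  qed
  then show ?thesis by (simp add: K_def)
qed


section \<open>The differential\<close>

lemma edge_map_in_ext_alg:
  assumes "x \<in> crossings D"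
  shows "edge_map D ar \<alpha> x \<omega> \<in> ext_alg (circles D (insert x \<alpha>))"
proof -
  have "circle D \<beta> c \<in> circles D \<beta>" if "c \<in> circles D \<alpha>" for \<beta> c
    using that circles_subset_edges by (auto intro: circle_in_circles)
  moreover have "circle D \<beta> (pd D x ! 0) \<in> circles D \<beta>" "circle D \<beta> (pd D x ! 1) \<in> circles D \<beta>" for \<beta>
    using ends_in_edges[OF assms] by (auto intro: circle_in_circles)
  ultimately show ?thesis
    unfolding edge_map_def Let_def
    by (auto intro!: ext_map_in_ext_alg ext_alg_wedge ext_alg_diff ext_alg_gen finite_circles)
qed

text \<open>The reason why multiples of \<open>v_q\<close> form a subcomplex. A merge maps the
  generator of the circle through \<open>q\<close> to the new one. In a split of another circle,
  \<open>v_q\<close> is moved past the difference factor. In a split of the circle through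
  \<open>q\<close>, the image is a multiple of both new generators.\<close>

lemma edge_map_point:
  assumes x: "x \<in> crossings D" "x \<notin> \<alpha>" and q: "q \<in> edges D"
  shows "wedge (vgen D (insert x \<alpha>) q) (edge_map D ar \<alpha> x (wedge (vgen D \<alpha> q) \<omega>)) = 0"
proof -
  define c where "c = circle D \<alpha> q"
  have c: "c \<in> circles D \<alpha>" "c \<in> edges D" "(c, q) \<in> connected_in D \<alpha>"
    using q circle_in_class[OF q] by (auto simp: c_def circle_in_circles intro: sym_closure_sym)
  have e: "pd D x ! 0 \<in> edges D" "pd D x ! 2 \<in> edges D" using ends_in_edges[OF x(1)] by auto
  show ?thesis
  proof (cases "circle D \<alpha> (pd D x ! 0) = circle D \<alpha> (pd D x ! 2)")
    case False
    then have "(c, q) \<in> connected_in D (insert x \<alpha>)"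
      using merge_connected[OF x] c(3) circle_eqI by blast
    then have "circle D (insert x \<alpha>) c = circle D (insert x \<alpha>) q" by (rule circle_eqI)
    then show ?thesis
      using False
      by (simp add: edge_map_def Let_def vgen_def c_def[symmetric] ext_map_wedge_gen finite_circles c wedge_gen_square)
  next
    case True
    define t where "t = circle D (insert x \<alpha>) (if ar x then pd D x ! 0 else pd D x ! 1)"
    define h where "h = circle D (insert x \<alpha>) (if ar x then pd D x ! 1 else pd D x ! 0)"
    define g where "g = circle D (insert x \<alpha>) q"
    define f where "f = (\<lambda>c. if c = circle D \<alpha> (pd D x ! 0) then t else circle D (insert x \<alpha>) c)"
    define X where "X = ext_map (circles D \<alpha>) f \<omega>"
    have map: "edge_map D ar \<alpha> x (wedge (vgen D \<alpha> q) \<omega>) = wedge (gen t - gen h) (wedge (gen (f c)) X)"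
    proof -
      have "edge_map D ar \<alpha> x \<eta> = wedge (gen t - gen h) (ext_map (circles D \<alpha>) f \<eta>)" for \<eta> :: "'a ext"
        unfolding edge_map_def Let_def t_def h_def f_def by (simp only: True simp_thms if_False)
      then show ?thesis
        by (simp add: vgen_def c_def[symmetric] ext_map_wedge_gen finite_circles c X_def)
    qed
    have split: "(pd D x ! 0, pd D x ! 2) \<in> connected_in D \<alpha>"
      using True e circle_eq_iff by blast
    show ?thesis
    proof (cases "c = circle D \<alpha> (pd D x ! 0)")
      case away: False
      then have "(pd D x ! 0, c) \<notin> connected_in D \<alpha>"
        using circle_eqI[of "pd D x ! 0" q \<alpha>] c(3) by (auto simp: c_def intro: sym_closure_trans)
      then have "(c, q) \<in> connected_in D (insert x \<alpha>)"
        by (rule split_connected_away[OF x split c(3)])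
      then have "f c = g"
        using away by (auto simp: f_def g_def intro: circle_eqI)
      then show ?thesis
        unfolding map
        by (simp add: vgen_def g_def[symmetric] wedge_gen_diff_commute wedge_minus_right wedge_gen_square)
    next
      case on: True
      then have "(pd D x ! 0, q) \<in> connected_in D \<alpha>" unfolding circle_eq_iff[OF e(1) q, symmetric] by (simp add: c_def)
      from split_connected[OF x this] have g: "g = t \<or> g = h"
        by (auto simp: g_def t_def h_def dest: circle_eqI)
      have "f c = t" using on by (simp add: f_def)
      \<comment> \<open>Of the difference only the head survives next to \<open>v_t\<close>, so it
        does not matter which half contains \<open>q\<close>.\<close>
      then have "edge_map D ar \<alpha> x (wedge (vgen D \<alpha> q) \<omega>) = - wedge (gen h) (wedge (gen t) X)"
        unfolding map by (simp add: wedge_diff_left wedge_gen_square)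
      then show ?thesis
        using g by (auto simp: vgen_def[of _ "insert x \<alpha>"] g_def[symmetric] wedge_minus_right wedge_gen_square wedge_gen_anticommute[of t h])
    qed
  qed
qed

end

lemma edge_map_add: "edge_map D ar \<alpha> x (\<omega> + \<eta>) = edge_map D ar \<alpha> x \<omega> + edge_map D ar \<alpha> x \<eta>"
  by (simp add: edge_map_def Let_def ext_map_add wedge_add_right)

lemma edge_map_smul: "edge_map D ar \<alpha> x (smul r \<omega>) = smul r (edge_map D ar \<alpha> x \<omega>)"
  by (simp add: edge_map_def Let_def ext_map_smul wedge_smul_right)

lemma edge_map_0 [simp]: "edge_map D ar \<alpha> x 0 = 0"
  using edge_map_smul[of D ar \<alpha> x 0 0] by simp

text \<open>Evaluation at a vertex only: the general pointwise rules would continue down to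
  coefficients.\<close>

lemma chain_apply:
  fixes c c' :: "'r::comm_ring_1 chain"
  shows "(c + c') \<alpha> = c \<alpha> + c' \<alpha>" "(c - c') \<alpha> = c \<alpha> - c' \<alpha>" "(- c) \<alpha> = - c \<alpha>"
    "(0 :: 'r chain) \<alpha> = 0"
  by (simp_all add: fun_apply_rules fun_eq_iff)

lemma diff_apply:
  "diff D ar \<epsilon> c \<beta> = (if \<beta> \<subseteq> crossings D
     then \<Sum>x\<in>\<beta>. smul (of_int (\<epsilon> (\<beta> - {x}) x)) (edge_map D ar (\<beta> - {x}) x (c (\<beta> - {x})))
     else 0)"
  by (simp add: diff_def)

lemma diff_add: "diff D ar \<epsilon> (c + c') = diff D ar \<epsilon> c + diff D ar \<epsilon> c'"
  by (rule ext) (simp add: chain_apply diff_apply edge_map_add smul_add_right sum.distrib)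

lemma smul_uminus: "smul r (- \<omega>) = - smul r \<omega>"
  by (simp add: smul_minus_1[symmetric] smul_smul)

lemma diff_uminus: "diff D ar \<epsilon> (- c) = - diff D ar \<epsilon> c"
proof
  fix \<beta>
  have neg: "edge_map D ar \<alpha> x (- \<omega>) = - edge_map D ar \<alpha> x \<omega>" for \<alpha> x and \<omega> :: "'a ext"
    using edge_map_smul[of D ar \<alpha> x "- 1" \<omega>] by (simp add: smul_minus_1)
  show "diff D ar \<epsilon> (- c) \<beta> = (- diff D ar \<epsilon> c) \<beta>"
    by (simp add: chain_apply diff_apply neg smul_uminus sum_negf)
qed

lemma diff_0 [simp]: "diff D ar \<epsilon> 0 = 0"
  using diff_add[of D ar \<epsilon> 0 0] by simp

lemma diff_diff: "diff D ar \<epsilon> (c - c') = diff D ar \<epsilon> c - diff D ar \<epsilon> c'"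
  using diff_add[of D ar \<epsilon> c "- c'"] by (simp add: diff_uminus)

text \<open>Off the cube a chain is 0, which lies in every exterior algebra, so membership can be
  demanded at all vertices. This frees later arguments from the side condition on \<alpha>.\<close>

lemma chains_iff:
  "c \<in> chains D \<longleftrightarrow> (\<forall>\<alpha>. c \<alpha> \<in> ext_alg (circles D \<alpha>)) \<and> (\<forall>\<alpha>. \<not> \<alpha> \<subseteq> crossings D \<longrightarrow> c \<alpha> = 0)"
  unfolding chains_def mem_Collect_eq using ext_alg_0 by metis

lemma chains_add: "c \<in> chains D \<Longrightarrow> c' \<in> chains D \<Longrightarrow> c + c' \<in> chains D"
  by (simp add: chains_iff chain_apply ext_alg_add)

lemma chains_uminus: "c \<in> chains D \<Longrightarrow> - c \<in> chains D"
  by (simp add: chains_iff chain_apply ext_alg_uminus)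

lemma chains_diff: "c \<in> chains D \<Longrightarrow> c' \<in> chains D \<Longrightarrow> c - c' \<in> chains D"
  using chains_add[OF _ chains_uminus, of c D c'] by simp

lemma reduced_chains_iff:
  "c \<in> reduced_chains D \<longleftrightarrow>
    (\<forall>\<alpha>. c \<alpha> \<in> reduced_ext (circles D \<alpha>)) \<and> (\<forall>\<alpha>. \<not> \<alpha> \<subseteq> crossings D \<longrightarrow> c \<alpha> = 0)"
  unfolding reduced_chains_def mem_Collect_eq chains_iff
  using reduced_ext_0 reduced_ext_in_ext_alg by metis

context link_code
begin

lemma diff_in_chains: "c \<in> chains D \<Longrightarrow> diff D ar \<epsilon> c \<in> chains D"
proof -
  have "edge_map D ar (\<beta> - {x}) x (c (\<beta> - {x})) \<in> ext_alg (circles D \<beta>)" if "x \<in> \<beta>" "\<beta> \<subseteq> crossings D" for x \<beta>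
    using edge_map_in_ext_alg[of x ar "\<beta> - {x}"] that by (auto simp: insert_absorb)
  then show ?thesis
    by (auto simp: chains_iff diff_apply intro!: ext_alg_sum ext_alg_smul)
qed

lemma point_chains_iff:
  assumes q: "q \<in> edges D"
  shows "c \<in> point_chains D q \<longleftrightarrow> c \<in> chains D \<and> (\<forall>\<alpha>. wedge (vgen D \<alpha> q) (c \<alpha>) = 0)"
proof
  assume "c \<in> point_chains D q"
  then obtain c' where c': "c' \<in> chains D" and c: "c = (\<lambda>\<alpha>. wedge (vgen D \<alpha> q) (c' \<alpha>))"
    by (auto simp: point_chains_def)
  have "vgen D \<alpha> q \<in> ext_alg (circles D \<alpha>)" for \<alpha>
    using q by (simp add: vgen_def ext_alg_gen circle_in_circles)
  then show "c \<in> chains D \<and> (\<forall>\<alpha>. wedge (vgen D \<alpha> q) (c \<alpha>) = 0)"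
    using c' by (auto simp: c chains_iff wedge_gen_square vgen_def intro!: ext_alg_wedge)
next
  assume c: "c \<in> chains D \<and> (\<forall>\<alpha>. wedge (vgen D \<alpha> q) (c \<alpha>) = 0)"
  \<comment> \<open>The contraction is the quotient by \<open>v_q\<close>.\<close>
  define c' where "c' = (\<lambda>\<alpha>. contract (circles D \<alpha>) (c \<alpha>))"
  have "c' \<in> chains D"
    using c by (simp add: c'_def chains_iff contract_in_ext_alg)
  moreover have "c = (\<lambda>\<alpha>. wedge (vgen D \<alpha> q) (c' \<alpha>))"
  proof
    fix \<alpha>
    show "c \<alpha> = wedge (vgen D \<alpha> q) (c' \<alpha>)"
      using c q wedge_gen_contract[OF finite_circles circle_in_circles[OF q], of "c \<alpha>" \<alpha>]
      by (simp add: c'_def vgen_def chains_iff)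
  qed
  ultimately show "c \<in> point_chains D q" by (auto simp: point_chains_def)
qed

text \<open>Needed to invert the map at \<open>q\<close> on a differential: the inverse is
  determined only through elements of this domain.\<close>

lemma diff_in_point_chains:
  assumes q: "q \<in> edges D" and c: "c \<in> point_chains D q"
  shows "diff D ar \<epsilon> c \<in> point_chains D q"
  unfolding point_chains_iff[OF q]
proof (intro conjI allI)
  show "diff D ar \<epsilon> c \<in> chains D"
    using c diff_in_chains point_chains_iff[OF q] by blast
  fix \<beta>
  obtain c' where c': "c' \<in> chains D" "c = (\<lambda>\<alpha>. wedge (vgen D \<alpha> q) (c' \<alpha>))"
    using c by (auto simp: point_chains_def)
  have zero: "wedge (vgen D \<beta> q) (edge_map D ar (\<beta> - {x}) x (c (\<beta> - {x}))) = 0"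
    if "x \<in> \<beta>" "\<beta> \<subseteq> crossings D" for x
    using edge_map_point[of x "\<beta> - {x}" q ar "c' (\<beta> - {x})"] that q
    by (simp add: c' insert_absorb subset_iff)
  show "wedge (vgen D \<beta> q) (diff D ar \<epsilon> c \<beta>) = 0"
    by (simp add: diff_apply wedge_sum_right wedge_smul_right zero)
qed

end

section \<open>The splitting\<close>

lemma of_int_sign_cancel:
  assumes "vertex_sign \<sigma>"
  shows "smul (of_int (\<sigma> \<alpha>)) (smul (of_int (\<sigma> \<alpha>)) \<omega>) = (\<omega> :: 'r::comm_ring_1 ext)"
proof -
  have "\<sigma> \<alpha> * \<sigma> \<alpha> = 1" using assms by (auto simp: vertex_sign_def dest: spec[of _ \<alpha>])
  then have "of_int (\<sigma> \<alpha>) * of_int (\<sigma> \<alpha>) = (1 :: 'r)" by (metis of_int_1 of_int_mult)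
  then show ?thesis by (simp add: smul_smul)
qed

lemma of_int_sign_inj:
  assumes "vertex_sign \<sigma>" "smul (of_int (\<sigma> \<alpha>)) \<omega> = smul (of_int (\<sigma> \<alpha>)) \<eta>"
  shows "\<omega> = (\<eta> :: 'r::comm_ring_1 ext)"
  using arg_cong[OF assms(2), of "smul (of_int (\<sigma> \<alpha>))"] by (simp only: of_int_sign_cancel[OF assms(1)])

lemma vertex_sign_mult: "vertex_sign \<sigma> \<Longrightarrow> vertex_sign \<tau> \<Longrightarrow> vertex_sign (\<lambda>\<alpha>. \<sigma> \<alpha> * \<tau> \<alpha>)"
  unfolding vertex_sign_def by (metis mult.right_neutral mult_minus1 mult_minus1_right minus_minus)

context link_code
begin

lemma vgen_in_ext_alg: "p \<in> edges D \<Longrightarrow> vgen D \<alpha> p \<in> ext_alg (circles D \<alpha>)"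
  by (simp add: vgen_def ext_alg_gen circle_in_circles)

lemma contract_wedge_vgen:
  assumes "p \<in> edges D" "\<omega> \<in> ext_alg (circles D \<alpha>)"
  shows "contract (circles D \<alpha>) (wedge (vgen D \<alpha> p) \<omega>) =
    \<omega> - wedge (vgen D \<alpha> p) (contract (circles D \<alpha>) \<omega>)"
  unfolding vgen_def
  by (rule contract_wedge_gen[OF finite_circles circle_in_circles[OF assms(1)] finite_circles assms(2)])

lemma X_map_point_chain:
  assumes "p \<in> edges D" "c \<in> point_chains D p"
  shows "X_map D p \<sigma> c = (\<lambda>\<alpha>. smul (of_int (\<sigma> \<alpha>)) (contract (circles D \<alpha>) (c \<alpha>)))"
proof
  fix \<alpha>
  have c: "c \<in> chains D" "wedge (gen (circle D \<alpha> p)) (c \<alpha>) = 0"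
    using assms(2) by (auto simp: point_chains_iff[OF assms(1)] vgen_def)
  then show "X_map D p \<sigma> c \<alpha> = smul (of_int (\<sigma> \<alpha>)) (contract (circles D \<alpha>) (c \<alpha>))"
    using assms(1)
    by (simp add: X_map_def vgen_def inv_into_reduced_ext finite_circles circle_in_circles chains_iff)
qed

lemma inj_on_X_map:
  assumes p: "p \<in> edges D" and \<sigma>: "vertex_sign \<sigma>"
  shows "inj_on (X_map D p \<sigma> :: 'r::comm_ring_1 chain \<Rightarrow> _) (point_chains D p)"
proof (rule inj_onI, rule ext)
  fix c c' :: "'r chain" and \<alpha>
  assume c: "c \<in> point_chains D p" and c': "c' \<in> point_chains D p"
    and eq: "X_map D p \<sigma> c = X_map D p \<sigma> c'"
  have "contract (circles D \<alpha>) (c \<alpha>) = contract (circles D \<alpha>) (c' \<alpha>)"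
    using fun_cong[OF eq, of \<alpha>] unfolding X_map_point_chain[OF p c] X_map_point_chain[OF p c']
    by (rule of_int_sign_inj[OF \<sigma>])
  moreover have "wedge (vgen D \<alpha> p) (contract (circles D \<alpha>) (y \<alpha>)) = y \<alpha>" if "y \<in> point_chains D p" for y :: "'r chain"
    using that wedge_gen_contract[OF finite_circles circle_in_circles[OF p], of "y \<alpha>" \<alpha>]
    by (simp add: point_chains_iff[OF p] vgen_def chains_iff)
  ultimately show "c \<alpha> = c' \<alpha>" using c c' by metis
qed

definition X_inverse :: "nat \<Rightarrow> (nat set \<Rightarrow> int) \<Rightarrow> 'r::comm_ring_1 chain \<Rightarrow> 'r chain" where
  "X_inverse p \<sigma> r = (\<lambda>\<alpha>. smul (of_int (\<sigma> \<alpha>)) (wedge (vgen D \<alpha> p) (r \<alpha>)))"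

lemma inv_into_X_map:
  assumes p: "p \<in> edges D" and \<sigma>: "vertex_sign \<sigma>" and r: "r \<in> reduced_chains D"
  shows "X_inverse p \<sigma> r \<in> point_chains D p"
    and "X_map D p \<sigma> (X_inverse p \<sigma> r) = r"
    and "inv_into (point_chains D p) (X_map D p \<sigma>) r = X_inverse p \<sigma> r"
proof -
  have r': "r \<alpha> \<in> ext_alg (circles D \<alpha>)" "contract (circles D \<alpha>) (r \<alpha>) = 0" for \<alpha>
    using r by (auto simp: reduced_chains_iff reduced_ext_in_ext_alg contract_reduced_ext finite_circles)
  show e: "X_inverse p \<sigma> r \<in> point_chains D p"
    using p r r' unfolding point_chains_iff[OF p] chains_iff X_inverse_def
    by (auto simp: reduced_chains_iff wedge_smul_right vgen_def wedge_gen_square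
        intro!: ext_alg_smul ext_alg_wedge ext_alg_gen circle_in_circles)
  show "X_map D p \<sigma> (X_inverse p \<sigma> r) = r"
    unfolding X_map_point_chain[OF p e]
    by (simp add: X_inverse_def contract_smul contract_wedge_vgen[OF p r'(1)] r'(2) of_int_sign_cancel[OF \<sigma>])
  then show "inv_into (point_chains D p) (X_map D p \<sigma>) r = X_inverse p \<sigma> r"
    by (intro inv_into_f_eq inj_on_X_map p \<sigma> e)
qed

lemma link_code_add_circle: "link_code (add_circle z D)"
  by unfold_locales
    (use even_ends in \<open>auto simp: add_circle_def finite_crossings finite_edges ends_in_edges\<close>)

end

text \<open>Only the values of the vertexwise signs are fixed here. The formula for \<Phi>, its
  bijectivity and its degrees do not involve the differential; compatibility with it enters through
  \<open>admissible_signs\<close>.\<close>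

locale splitting = link_code +
  fixes z q :: nat and S :: splitting_signs
  assumes z: "z \<notin> edges D" and q: "q \<in> edges D"
    and signs: "vertex_sign (sgn_Phi1 S)" "vertex_sign (sgn_Xp S)" "vertex_sign (sgn_Xq S)"
      "vertex_sign (sgn_Phi3_fst S)" "vertex_sign (sgn_Phi3_snd S)" "vertex_sign (sgn_XqD S)"
begin

abbreviation "D' \<equiv> add_circle z D"

sublocale D': link_code D'
  by (rule link_code_add_circle)

lemma D'_simps [simp]:
  "crossings D' = crossings D" "edges D' = insert z (edges D)" "smoothing_arcs D' = smoothing_arcs D"
  by (simp_all add: add_circle_def smoothing_arcs_def fun_eq_iff)

lemma circle_D': "a \<in> edges D \<Longrightarrow> circle D' \<alpha> a = circle D \<alpha> a"
  unfolding circle_alt using z connected_in_edges[of a z \<alpha>]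
  by (intro arg_cong[where f = Min]) auto

lemma circle_D'_z: "circle D' \<alpha> z = z"
proof -
  have "e = z" if "(z, e) \<in> connected_in D \<alpha>" for e
  proof -
    have "e \<in> {z}"
      using that
      by (rule sym_closure_invariant)
        (use z ends_in_edges in \<open>auto simp: smoothing_arcs_alt crossing_arcs_def split: if_splits\<close>)
    then show ?thesis by simp
  qed
  then have "{e \<in> edges D'. (z, e) \<in> connected_in D' \<alpha>} = {z}" by auto
  then show ?thesis unfolding circle_alt by simp
qed

lemma circles_D': "circles D' \<alpha> = insert z (circles D \<alpha>)"
  by (simp add: circles_def circle_D'_z circle_D')

lemma z_notin_circles: "z \<notin> circles D \<alpha>"
  using z circles_subset_edges by blast

lemma vgen_D': "vgen D' \<alpha> q = vgen D \<alpha> q" "vgen D' \<alpha> z = gen z"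
  using q by (simp_all add: vgen_def circle_D' circle_D'_z)

lemma contract_D': "\<omega> \<in> ext_alg (circles D \<alpha>) \<Longrightarrow> contract (circles D' \<alpha>) \<omega> = contract (circles D \<alpha>) \<omega>"
  unfolding circles_D' by (rule contract_insert) (auto simp: finite_circles z_notin_circles)

lemma ext_alg_D': "\<omega> \<in> ext_alg (circles D \<alpha>) \<Longrightarrow> \<omega> \<in> ext_alg (circles D' \<alpha>)"
  using ext_alg_mono[of "circles D \<alpha>" "circles D' \<alpha>"] by (auto simp: circles_D')

lemma Phi1_in_point_chains:
  assumes c: "c \<in> chains D"
  shows "Phi1 D z S c \<in> point_chains D' z"
proof -
  have "wedge (gen z) (c \<alpha>) \<in> ext_alg (circles D' \<alpha>)" for \<alpha>
    using c by (intro ext_alg_wedge[OF ext_alg_gen ext_alg_D']) (simp_all add: circles_D' chains_iff)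
  then show ?thesis
    using c unfolding D'.point_chains_iff[OF insertI1[of z "edges D", folded D'_simps(2)]]
    by (auto simp: Phi1_def chains_iff vgen_D' wedge_smul_right wedge_gen_square intro: ext_alg_smul)
qed

lemma X_map_Phi1:
  assumes c: "c \<in> chains D"
  shows "X_map D' z (sgn_Xp S) (Phi1 D z S c) =
    (\<lambda>\<alpha>. smul (of_int (sgn_Xp S \<alpha> * sgn_Phi1 S \<alpha>))
      (c \<alpha> - wedge (gen z) (contract (circles D \<alpha>) (c \<alpha>))))"
    and "X_map D' z (sgn_Xp S) (Phi1 D z S c) \<in> reduced_chains D'"
proof -
  have c\<alpha>: "c \<alpha> \<in> ext_alg (circles D \<alpha>)" "c \<alpha> \<in> ext_alg (circles D' \<alpha>)" for \<alpha>
    using c ext_alg_D' by (auto simp: chains_iff)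
  have zD': "z \<in> edges D'" by simp
  have X: "X_map D' z (sgn_Xp S) (Phi1 D z S c) =
      (\<lambda>\<alpha>. smul (of_int (sgn_Xp S \<alpha>)) (contract (circles D' \<alpha>) (Phi1 D z S c \<alpha>)))"
    by (rule D'.X_map_point_chain[OF zD' Phi1_in_point_chains[OF c]])
  then show eq: "X_map D' z (sgn_Xp S) (Phi1 D z S c) =
    (\<lambda>\<alpha>. smul (of_int (sgn_Xp S \<alpha> * sgn_Phi1 S \<alpha>))
      (c \<alpha> - wedge (gen z) (contract (circles D \<alpha>) (c \<alpha>))))"
    by (simp add: Phi1_def contract_smul vgen_D' smul_smul
        D'.contract_wedge_vgen[OF zD' c\<alpha>(2), unfolded vgen_D' contract_D'[OF c\<alpha>(1)]])
  have "Phi1 D z S c \<in> chains D'"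
    using Phi1_in_point_chains[OF c] by (simp add: D'.point_chains_iff[OF zD'])
  then have "contract (circles D' \<alpha>) (Phi1 D z S c \<alpha>) \<in> reduced_ext (circles D' \<alpha>)" for \<alpha>
    by (intro contract_in_reduced_ext D'.finite_circles) (simp add: chains_iff)
  moreover have "Phi1 D z S c \<alpha> = 0" if "\<not> \<alpha> \<subseteq> crossings D" for \<alpha>
    using c that by (simp add: Phi1_def chains_iff)
  ultimately show "X_map D' z (sgn_Xp S) (Phi1 D z S c) \<in> reduced_chains D'"
    unfolding X reduced_chains_iff by (auto intro: reduced_ext.smul)
qed

text \<open>Multiplying \<open>c - v_0 \<and> \<partial>c\<close> by \<open>v_q\<close> and moving
  \<open>v_0\<close> to the front turns minus into plus. The result has the form that
  \<open>Phi3\<close> takes apart.\<close>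

lemma Phi2_Phi1:
  assumes c: "c \<in> chains D"
  shows "Phi2 D z q S (Phi1 D z S c) =
    (\<lambda>\<alpha>. smul (of_int (sgn_Xq S \<alpha> * sgn_Xp S \<alpha> * sgn_Phi1 S \<alpha>))
      (wedge (vgen D \<alpha> q) (c \<alpha>) +
       wedge (gen z) (wedge (vgen D \<alpha> q) (contract (circles D \<alpha>) (c \<alpha>)))))"
    and "Phi2 D z q S (Phi1 D z S c) \<in> point_chains D' q"
proof -
  have q': "q \<in> edges D'" using q by simp
  note inv = D'.inv_into_X_map[OF q' signs(3) X_map_Phi1(2)[OF c]]
  show "Phi2 D z q S (Phi1 D z S c) \<in> point_chains D' q"
    unfolding Phi2_def inv(3) by (rule inv(1))
  show "Phi2 D z q S (Phi1 D z S c) =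
    (\<lambda>\<alpha>. smul (of_int (sgn_Xq S \<alpha> * sgn_Xp S \<alpha> * sgn_Phi1 S \<alpha>))
      (wedge (vgen D \<alpha> q) (c \<alpha>) +
       wedge (gen z) (wedge (vgen D \<alpha> q) (contract (circles D \<alpha>) (c \<alpha>)))))"
    unfolding Phi2_def inv(3) D'.X_inverse_def vgen_D' unfolding X_map_Phi1(1)[OF c]
    by (simp add: wedge_smul_right smul_smul mult.assoc wedge_diff_right vgen_def
        wedge_gen_anticommute[of "circle D \<alpha> q" z for \<alpha>])
qed

definition join :: "'r::comm_ring_1 chain \<times> 'r chain \<Rightarrow> 'r chain" where
  "join = (\<lambda>(a, b) \<alpha>. smul (of_int (sgn_Phi3_fst S \<alpha>)) (a \<alpha>) +
     smul (of_int (sgn_Phi3_snd S \<alpha>)) (wedge (vgen D' \<alpha> z) (b \<alpha>)))"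

lemma Phi3_eq: "Phi3 D z q S = inv_into (point_chains D q \<times> point_chains D q) join"
  by (simp add: Phi3_def join_def)

text \<open>Contraction with respect to \<open>v_z\<close> alone kills \<open>a\<close> and returns
  \<open>b\<close> up to sign; then \<open>a\<close> is what remains.\<close>

lemma inj_on_join: "inj_on (join :: 'r::comm_ring_1 chain \<times> 'r chain \<Rightarrow> _) (point_chains D q \<times> point_chains D q)"
proof (rule inj_onI, clarify, rule conjI)
  fix a b a' b' :: "'r chain"
  assume in_P: "a \<in> point_chains D q" "b \<in> point_chains D q" "a' \<in> point_chains D q" "b' \<in> point_chains D q"
    and eq: "join (a, b) = join (a', b')"
  have zero: "contract {z} (y \<alpha>) = 0" "y \<alpha> \<in> ext_alg (circles D \<alpha>)" if "y \<in> point_chains D q" for y :: "'r chain" and \<alpha>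
  proof -
    show *: "y \<alpha> \<in> ext_alg (circles D \<alpha>)" using that by (simp add: point_chains_iff[OF q] chains_iff)
    show "contract {z} (y \<alpha>) = 0" using z_notin_circles[of \<alpha>] by (intro contract_disjoint[OF *]) auto
  qed
  have join: "contract {z} (join (x, y) \<alpha>) = smul (of_int (sgn_Phi3_snd S \<alpha>)) (y \<alpha>)"
    if xy: "x \<in> point_chains D q" "y \<in> point_chains D q" for x y :: "'r chain" and \<alpha>
    by (simp add: join_def contract_add contract_smul zero(1)[OF xy(1)] zero(1)[OF xy(2)] vgen_D'
        contract_wedge_gen[OF _ _ finite_circles zero(2)[OF xy(2)]])
  show b: "b = b'"
  proof
    fix \<alpha>
    have "smul (of_int (sgn_Phi3_snd S \<alpha>)) (b \<alpha>) = smul (of_int (sgn_Phi3_snd S \<alpha>)) (b' \<alpha>)"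
      by (simp only: join[OF in_P(1,2), symmetric] join[OF in_P(3,4), symmetric] eq)
    then show "b \<alpha> = b' \<alpha>" by (rule of_int_sign_inj[OF signs(5)])
  qed
  show "a = a'"
  proof
    fix \<alpha>
    have "smul (of_int (sgn_Phi3_fst S \<alpha>)) (a \<alpha>) = smul (of_int (sgn_Phi3_fst S \<alpha>)) (a' \<alpha>)"
      using fun_cong[OF eq, of \<alpha>] unfolding join_def b prod.case by (rule add_right_imp_eq)
    then show "a \<alpha> = a' \<alpha>" by (rule of_int_sign_inj[OF signs(4)])
  qed
qed

definition sign_fst :: "nat set \<Rightarrow> int" where
  "sign_fst \<alpha> = sgn_XqD S \<alpha> * sgn_Phi3_fst S \<alpha> * sgn_Xq S \<alpha> * sgn_Xp S \<alpha> * sgn_Phi1 S \<alpha>"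

definition sign_snd :: "nat set \<Rightarrow> int" where
  "sign_snd \<alpha> = sgn_XqD S \<alpha> * sgn_Phi3_snd S \<alpha> * sgn_Xq S \<alpha> * sgn_Xp S \<alpha> * sgn_Phi1 S \<alpha>"

lemma vertex_sign_fst: "vertex_sign sign_fst" and vertex_sign_snd: "vertex_sign sign_snd"
  using vertex_sign_mult[OF vertex_sign_mult[OF vertex_sign_mult[OF vertex_sign_mult]]] signs
  by (simp_all add: sign_fst_def[abs_def] sign_snd_def[abs_def])

lemma vgen_chain_in_point_chains:
  assumes c: "c \<in> chains D"
  shows "(\<lambda>\<alpha>. smul (of_int (\<sigma> \<alpha>)) (wedge (vgen D \<alpha> q) (c \<alpha>))) \<in> point_chains D q"
  using c q unfolding point_chains_iff[OF q]
  by (auto simp: chains_iff wedge_smul_right vgen_def wedge_gen_square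
      intro!: ext_alg_smul ext_alg_wedge ext_alg_gen circle_in_circles)

lemma Phi_eq:
  assumes c: "c \<in> chains D"
  shows "Phi D z q S c =
    (\<lambda>\<alpha>. smul (of_int (sign_fst \<alpha>)) (c \<alpha> - wedge (vgen D \<alpha> q) (contract (circles D \<alpha>) (c \<alpha>))),
     \<lambda>\<alpha>. smul (of_int (sign_snd \<alpha>)) (contract (circles D \<alpha>) (c \<alpha>)))"
proof -
  define \<tau> where "\<tau> \<alpha> = sgn_Xq S \<alpha> * sgn_Xp S \<alpha> * sgn_Phi1 S \<alpha>" for \<alpha>
  define k where "k = (\<lambda>\<alpha>. contract (circles D \<alpha>) (c \<alpha>))"
  \<comment> \<open>\<open>Phi3\<close> inverts \<open>join\<close>, and signs are their own
    inverses, so the signs of \<open>join\<close> reappear in the candidates \<open>a\<close> and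
    \<open>b\<close>.\<close>
  define a where "a = (\<lambda>\<alpha>. smul (of_int (sgn_Phi3_fst S \<alpha> * \<tau> \<alpha>)) (wedge (vgen D \<alpha> q) (c \<alpha>)))"
  define b where "b = (\<lambda>\<alpha>. smul (of_int (sgn_Phi3_snd S \<alpha> * \<tau> \<alpha>)) (wedge (vgen D \<alpha> q) (k \<alpha>)))"
  have c\<alpha>: "c \<alpha> \<in> ext_alg (circles D \<alpha>)" for \<alpha> using c by (simp add: chains_iff)
  have k: "k \<in> chains D" using c by (simp add: k_def chains_iff contract_in_ext_alg)
  have ab: "a \<in> point_chains D q" "b \<in> point_chains D q"
    unfolding a_def b_def by (intro vgen_chain_in_point_chains c k)+
  have "join (a, b) = Phi2 D z q S (Phi1 D z S c)"
    unfolding Phi2_Phi1(1)[OF c]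
    by (simp add: join_def a_def b_def k_def \<tau>_def[symmetric] wedge_smul_right vgen_D' smul_add_right
        smul_smul[symmetric] of_int_sign_cancel signs)
  then have Phi3: "Phi3 D z q S (Phi2 D z q S (Phi1 D z S c)) = (a, b)"
    unfolding Phi3_eq by (intro inv_into_f_eq inj_on_join) (use ab in auto)
  have "contract (circles D \<alpha>) (contract (circles D \<alpha>) (c \<alpha>)) = 0" for \<alpha>
    by (rule contract_contract[OF finite_circles c\<alpha>])
  then show ?thesis
    by (simp add: Phi_def Phi4_def Phi3 X_map_point_chain[OF q ab(1)] X_map_point_chain[OF q ab(2)])
      (simp add: a_def b_def k_def contract_smul contract_wedge_vgen[OF q] c\<alpha> contract_in_ext_alg
        smul_smul \<tau>_def sign_fst_def sign_snd_def mult.assoc)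
qed

text \<open>Admissibility speaks of the map at \<open>q\<close>, but \<open>Phi2\<close> uses its
  inverse. The inverse commutes with the differential because the differential keeps
  \<open>e\<close> in the domain on which the map at \<open>q\<close> is injective.\<close>

lemma Phi_diff:
  fixes c :: "'r::comm_ring_1 chain"
  assumes adm: "admissible_signs TYPE('r) D ar \<epsilon> z q S" and c: "c \<in> chains D"
  shows "Phi D z q S (diff D ar \<epsilon> c) = map_prod (diff D ar \<epsilon>) (diff D ar \<epsilon>) (Phi D z q S c)"
proof -
  let ?d = "diff D ar \<epsilon> :: 'r chain \<Rightarrow> _" and ?d' = "diff D' ar \<epsilon> :: 'r chain \<Rightarrow> _"
  have maps:
    "chain_map (chains D) ?d (point_chains D' z) ?d' (Phi1 D z S)"
    "chain_map (point_chains D' z) ?d' (reduced_chains D') ?d' (X_map D' z (sgn_Xp S))"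
    "chain_map (point_chains D' q) ?d' (reduced_chains D') ?d' (X_map D' q (sgn_Xq S))"
    "chain_map (point_chains D' q) ?d' (point_chains D q \<times> point_chains D q) (map_prod ?d ?d) (Phi3 D z q S)"
    "chain_map (point_chains D q) ?d (reduced_chains D) ?d (X_map D q (sgn_XqD S))"
    using adm unfolding admissible_signs_def Let_def by blast+
  define y where "y = Phi1 D z S c"
  define r where "r = X_map D' z (sgn_Xp S) y"
  define e where "e = Phi2 D z q S y"
  have y: "y \<in> point_chains D' z" "Phi1 D z S (?d c) = ?d' y"
    using maps(1) c by (auto simp: chain_map_def y_def)
  have r: "r \<in> reduced_chains D'" "X_map D' z (sgn_Xp S) (?d' y) = ?d' r"
    using maps(2) y by (auto simp: chain_map_def r_def)
  have q': "q \<in> edges D'" using q by simp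
  note inv = D'.inv_into_X_map[OF q' signs(3) r(1)]
  have e: "e \<in> point_chains D' q" "X_map D' q (sgn_Xq S) e = r"
    unfolding e_def Phi2_def r_def[symmetric] inv(3) by (fact inv(1), fact inv(2))
  have "?d' e \<in> point_chains D' q" by (rule D'.diff_in_point_chains[OF q' e(1)])
  moreover have "X_map D' q (sgn_Xq S) (?d' e) = ?d' r"
    using maps(3) e by (auto simp: chain_map_def)
  ultimately have "Phi2 D z q S (?d' y) = ?d' e"
    unfolding Phi2_def r(2) by (intro inv_into_f_eq D'.inj_on_X_map q' signs(3))
  moreover obtain a b where ab: "Phi3 D z q S e = (a, b)" "a \<in> point_chains D q" "b \<in> point_chains D q"
    "Phi3 D z q S (?d' e) = (?d a, ?d b)"
  proof -
    have "Phi3 D z q S e \<in> point_chains D q \<times> point_chains D q"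
      and "Phi3 D z q S (?d' e) = map_prod ?d ?d (Phi3 D z q S e)"
      using maps(4) e(1) unfolding chain_map_def by blast+
    then show ?thesis using that by (cases "Phi3 D z q S e") auto
  qed
  moreover have "X_map D q (sgn_XqD S) (?d x) = ?d (X_map D q (sgn_XqD S) x)" if "x \<in> point_chains D q" for x
    using maps(5) that unfolding chain_map_def by blast
  ultimately show ?thesis
    unfolding Phi_def Phi4_def comp_apply y(2) y_def[symmetric] e_def[symmetric]
    by (simp only: map_prod_simp)
qed

lemma Phi_add:
  assumes "c \<in> chains D" "c' \<in> chains D"
  shows "fst (Phi D z q S (c + c')) = fst (Phi D z q S c) + fst (Phi D z q S c')"
    and "snd (Phi D z q S (c + c')) = snd (Phi D z q S c) + snd (Phi D z q S c')"
  unfolding Phi_eq[OF assms(1)] Phi_eq[OF assms(2)] Phi_eq[OF chains_add[OF assms]]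
  by (rule ext, simp add: chain_apply contract_add wedge_add_right smul_add_right smul_diff_right)+

text \<open>The second component determines \<open>\<partial>c\<close>, after which the first
  determines \<open>c\<close>.\<close>

lemma inj_on_Phi: "inj_on (Phi D z q S :: 'r::comm_ring_1 chain \<Rightarrow> _) (chains D)"
proof (rule inj_onI, rule ext)
  fix c c' :: "'r chain" and \<alpha>
  assume c: "c \<in> chains D" and c': "c' \<in> chains D" and eq: "Phi D z q S c = Phi D z q S c'"
  note eq = eq[unfolded Phi_eq[OF c] Phi_eq[OF c'] prod.inject]
  have "contract (circles D \<alpha>) (c \<alpha>) = contract (circles D \<alpha>) (c' \<alpha>)"
    using fun_cong[OF conjunct2[OF eq], of \<alpha>] by (rule of_int_sign_inj[OF vertex_sign_snd])
  moreover have "c \<alpha> - wedge (vgen D \<alpha> q) (contract (circles D \<alpha>) (c \<alpha>)) =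
      c' \<alpha> - wedge (vgen D \<alpha> q) (contract (circles D \<alpha>) (c' \<alpha>))"
    using fun_cong[OF conjunct1[OF eq], of \<alpha>] by (rule of_int_sign_inj[OF vertex_sign_fst])
  ultimately show "c \<alpha> = c' \<alpha>" by simp
qed

text \<open>The kernel of \<phi> has rank one less. The first component keeps the exterior degree,
  so its quantum degree drops by 1; the second loses one exterior degree, which adds 2 and gives a
  net gain of 1.\<close>

lemma Phi_graded:
  assumes c: "c \<in> graded_chains D m s"
  shows "fst (Phi D z q S c) \<in> graded_reduced_chains D m (s - 1)"
    and "snd (Phi D z q S c) \<in> graded_reduced_chains D m (s + 1)"
proof -
  have c': "c \<in> chains D"
    and deg: "m = int (card \<alpha>) - n_minus D \<and>
      s = int (card (circles D \<alpha>)) - 2 * int (card I) + n_plus D - 2 * n_minus D + int (card \<alpha>)"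
    if "c \<alpha> I \<noteq> 0" for \<alpha> I
    using c that by (auto simp: graded_chains_def)
  have c': "c \<in> chains D" using c by (simp add: graded_chains_def)
  have c\<alpha>: "c \<alpha> \<in> ext_alg (circles D \<alpha>)" for \<alpha> using c' by (simp add: chains_iff)
  have "contract (circles D \<alpha>) (wedge (vgen D \<alpha> q) (c \<alpha>)) \<in> reduced_ext (circles D \<alpha>)" for \<alpha>
    by (intro contract_in_reduced_ext finite_circles ext_alg_wedge vgen_in_ext_alg q c\<alpha>)
  then have red1: "c \<alpha> - wedge (vgen D \<alpha> q) (contract (circles D \<alpha>) (c \<alpha>)) \<in> reduced_ext (circles D \<alpha>)" for \<alpha>
    by (simp add: contract_wedge_vgen[OF q c\<alpha>])
  have red2: "contract (circles D \<alpha>) (c \<alpha>) \<in> reduced_ext (circles D \<alpha>)" for \<alpha>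
    by (intro contract_in_reduced_ext finite_circles c\<alpha>)
  have out: "c \<alpha> = 0" if "\<not> \<alpha> \<subseteq> crossings D" for \<alpha> using c' that by (simp add: chains_iff)
  have "fst (Phi D z q S c) \<in> reduced_chains D" "snd (Phi D z q S c) \<in> reduced_chains D"
    using red1 red2 out by (auto simp: Phi_eq[OF c'] reduced_chains_iff intro: reduced_ext.smul)
  moreover have "m = int (card \<alpha>) - n_minus D \<and>
      s - 1 = int (card (circles D \<alpha>)) - 1 - 2 * int (card I) + n_plus D - 2 * n_minus D + int (card \<alpha>)"
    if "fst (Phi D z q S c) \<alpha> I \<noteq> 0" for \<alpha> I
  \<comment> \<open>If \<open>c\<close> has no term at \<open>I\<close>, the coefficient comes from
    \<open>v_q \<and> \<partial>c\<close>, hence from a monomial of \<open>c\<close> with one index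
    exchanged and so of the same size.\<close>
  proof (cases "c \<alpha> I = 0")
    case False
    then show ?thesis using deg[of \<alpha> I] by auto
  next
    case True
    define g where "g = circle D \<alpha> q"
    have "(c \<alpha> - wedge (gen g) (contract (circles D \<alpha>) (c \<alpha>))) I \<noteq> 0"
      using that by (auto simp: Phi_eq[OF c'] smul_def vgen_def g_def)
    then have "wedge (gen g) (contract (circles D \<alpha>) (c \<alpha>)) I \<noteq> 0" using True by (simp add: fun_apply_rules)
    note g = wedge_gen_support[OF this]
    obtain k where k: "k \<notin> I - {g}" "c \<alpha> (insert k (I - {g})) \<noteq> 0"
      using contract_support[OF g(3)] by blast
    have "card (insert k (I - {g})) = card I"
      using g(1,2) k(1) by (metis card_Suc_Diff1 card_insert_disjoint finite_Diff)
    then show ?thesis using deg[OF k(2)] by auto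
  qed
  moreover have "m = int (card \<alpha>) - n_minus D \<and>
      s + 1 = int (card (circles D \<alpha>)) - 1 - 2 * int (card I) + n_plus D - 2 * n_minus D + int (card \<alpha>)"
    if "snd (Phi D z q S c) \<alpha> I \<noteq> 0" for \<alpha> I
  proof -
    have "contract (circles D \<alpha>) (c \<alpha>) I \<noteq> 0"
      using that by (auto simp: Phi_eq[OF c'] smul_def)
    then obtain k where k: "finite I" "k \<notin> I" "c \<alpha> (insert k I) \<noteq> 0"
      by (rule contract_support)
    then show ?thesis using deg[OF k(3)] by auto
  qed
  ultimately show "fst (Phi D z q S c) \<in> graded_reduced_chains D m (s - 1)"
    "snd (Phi D z q S c) \<in> graded_reduced_chains D m (s + 1)"
    by (auto simp: graded_reduced_chains_def)
qed

text \<open>Both \<open>u\<close> and \<open>v\<close> are killed by \<partial>, so contracting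
  \<open>u + v_q \<and> v\<close> returns \<open>v\<close>. Surjectivity is needed in each bidegree,
  as boundaries are taken from a single one.\<close>

lemma Phi_surj:
  assumes u: "u \<in> graded_reduced_chains D m (s - 1)" and v: "v \<in> graded_reduced_chains D m (s + 1)"
  obtains c where "c \<in> graded_chains D m s" "Phi D z q S c = (u, v)"
proof
  define c where "c = (\<lambda>\<alpha>. smul (of_int (sign_fst \<alpha>)) (u \<alpha>) +
    smul (of_int (sign_snd \<alpha>)) (wedge (vgen D \<alpha> q) (v \<alpha>)))"
  have uv: "u \<in> reduced_chains D" "v \<in> reduced_chains D"
    using u v by (auto simp: graded_reduced_chains_def)
  have ext: "u \<alpha> \<in> ext_alg (circles D \<alpha>)" "v \<alpha> \<in> ext_alg (circles D \<alpha>)" for \<alpha>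
    using uv by (auto simp: reduced_chains_iff reduced_ext_in_ext_alg)
  have closed: "contract (circles D \<alpha>) (u \<alpha>) = 0" "contract (circles D \<alpha>) (v \<alpha>) = 0" for \<alpha>
    using uv by (auto simp: reduced_chains_iff contract_reduced_ext finite_circles)
  have c: "c \<in> chains D"
    using uv ext unfolding chains_iff c_def
    by (auto simp: reduced_chains_iff intro!: ext_alg_add ext_alg_smul ext_alg_wedge vgen_in_ext_alg q)
  have "contract (circles D \<alpha>) (c \<alpha>) = smul (of_int (sign_snd \<alpha>)) (v \<alpha>)" for \<alpha>
    by (simp add: c_def contract_add contract_smul contract_wedge_vgen[OF q] ext closed)
  then show "Phi D z q S c = (u, v)"
    by (simp add: Phi_eq[OF c] of_int_sign_cancel vertex_sign_fst vertex_sign_snd wedge_smul_right)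
      (simp add: c_def of_int_sign_cancel vertex_sign_fst)
  have "m = int (card \<alpha>) - n_minus D \<and>
      s = int (card (circles D \<alpha>)) - 2 * int (card I) + n_plus D - 2 * n_minus D + int (card \<alpha>)"
    if I: "c \<alpha> I \<noteq> 0" for \<alpha> I
  proof (cases "u \<alpha> I = 0")
    case False
    then show ?thesis using u by (auto simp: graded_reduced_chains_def)
  next
    case True
    then have "wedge (gen (circle D \<alpha> q)) (v \<alpha>) I \<noteq> 0"
      using I by (auto simp: c_def smul_def vgen_def fun_apply_rules)
    note g = wedge_gen_support[OF this]
    have "card I = Suc (card (I - {circle D \<alpha> q}))" using g by (metis card_Suc_Diff1)
    moreover have "m = int (card \<alpha>) - n_minus D \<and>
      s + 1 = int (card (circles D \<alpha>)) - 1 - 2 * int (card (I - {circle D \<alpha> q})) +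
        n_plus D - 2 * n_minus D + int (card \<alpha>)"
      using v g(3) by (auto simp: graded_reduced_chains_def)
    ultimately show ?thesis by auto
  qed
  then show "c \<in> graded_chains D m s" using c by (simp add: graded_chains_def)
qed

end

section \<open>Homology classes in bigraded complexes\<close>

lemma hclass_eq_iff:
  assumes G: "\<And>r Q c c'. c \<in> G r Q \<Longrightarrow> c' \<in> G r Q \<Longrightarrow> c - c' \<in> G r Q" "\<And>r Q. 0 \<in> G r Q"
    and d: "\<And>c c'. d (c - c') = d c - d c'"
  shows "hclass G d r Q x = hclass G d r Q y \<longleftrightarrow> x - y \<in> boundaries G d r Q"
proof -
  let ?B = "boundaries G d r Q"
  have d0: "d 0 = 0" using d[of 0 0] by simp
  have B0: "0 \<in> ?B" unfolding boundaries_def by (rule image_eqI[OF _ G(2)]) (simp add: d0)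
  have B_diff: "b - b' \<in> ?B" if "b \<in> ?B" "b' \<in> ?B" for b b'
    using that G(1) d[symmetric] by (auto simp: boundaries_def)
  have B_add: "b + b' \<in> ?B" if "b \<in> ?B" "b' \<in> ?B" for b b'
    using B_diff[OF that(1) B_diff[OF B0 that(2)]] by simp
  show ?thesis
  proof
    assume "hclass G d r Q x = hclass G d r Q y"
    moreover have "x \<in> hclass G d r Q x" unfolding hclass_def by (rule image_eqI[OF _ B0]) simp
    ultimately show "x - y \<in> ?B" by (auto simp: hclass_def)
  next
    assume xy: "x - y \<in> ?B"
    have "hclass G d r Q u \<subseteq> hclass G d r Q v" if "u - v \<in> ?B" for u v
    proof
      fix c assume "c \<in> hclass G d r Q u"
      then obtain b where "b \<in> ?B" "c = u + b" by (auto simp: hclass_def)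
      with B_add[OF that this(1)] show "c \<in> hclass G d r Q v"
        unfolding hclass_def by (intro image_eqI[of _ _ "u - v + b"]) simp_all
    qed
    moreover have "y - x \<in> ?B" using B_diff[OF B0 xy] by simp
    ultimately show "hclass G d r Q x = hclass G d r Q y" using xy by blast
  qed
qed

lemma graded_chains_diff:
  assumes "c \<in> graded_chains D r Q" "c' \<in> graded_chains D r Q"
  shows "c - c' \<in> graded_chains D r Q"
proof -
  have "c \<alpha> I \<noteq> 0 \<or> c' \<alpha> I \<noteq> 0" if "(c - c') \<alpha> I \<noteq> 0" for \<alpha> I
    using that by (auto simp: chain_apply fun_apply_rules)
  then show ?thesis
    using assms unfolding graded_chains_def by (blast intro: chains_diff)
qed

lemma graded_chains_0: "0 \<in> graded_chains D r Q"
  by (simp add: graded_chains_def chains_iff chain_apply fun_apply_rules)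

lemma graded_reduced_chains_diff:
  assumes "c \<in> graded_reduced_chains D r Q" "c' \<in> graded_reduced_chains D r Q"
  shows "c - c' \<in> graded_reduced_chains D r Q"
proof -
  have "c \<alpha> I \<noteq> 0 \<or> c' \<alpha> I \<noteq> 0" if "(c - c') \<alpha> I \<noteq> 0" for \<alpha> I
    using that by (auto simp: chain_apply fun_apply_rules)
  moreover have "c - c' \<in> reduced_chains D"
    using assms by (auto simp: graded_reduced_chains_def reduced_chains_iff chain_apply intro: reduced_ext_diff)
  ultimately show ?thesis
    using assms unfolding graded_reduced_chains_def by blast
qed

lemma graded_reduced_chains_0: "0 \<in> graded_reduced_chains D r Q"
  by (simp add: graded_reduced_chains_def reduced_chains_iff chain_apply fun_apply_rules reduced_ext_0)

lemma Kh_class_eq_iff: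
  "Kh_class D ar \<epsilon> r Q c = Kh_class D ar \<epsilon> r Q c' \<longleftrightarrow>
    (\<exists>e\<in>graded_chains D (r - 1) Q. c - c' = diff D ar \<epsilon> e)"
  unfolding Kh_class_def
  by (subst hclass_eq_iff) (auto simp: graded_chains_diff graded_chains_0 diff_diff boundaries_def)

lemma reduced_Kh_class_eq_iff:
  "reduced_Kh_class D ar \<epsilon> r Q c = reduced_Kh_class D ar \<epsilon> r Q c' \<longleftrightarrow>
    (\<exists>e\<in>graded_reduced_chains D (r - 1) Q. c - c' = diff D ar \<epsilon> e)"
  unfolding reduced_Kh_class_def
  by (subst hclass_eq_iff)
    (auto simp: graded_reduced_chains_diff graded_reduced_chains_0 diff_diff boundaries_def)

lemma Kh_class_memE:
  assumes "c' \<in> Kh_class D ar \<epsilon> r Q c"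
  obtains e where "e \<in> graded_chains D (r - 1) Q" "c' = c + diff D ar \<epsilon> e"
  using assms by (auto simp: Kh_class_def hclass_def boundaries_def)

lemma Kh_class_self: "c \<in> Kh_class D ar \<epsilon> r Q c"
  unfolding Kh_class_def hclass_def boundaries_def
  by (rule image_eqI[of _ _ 0], simp, rule image_eqI[of _ _ 0]) (simp_all add: graded_chains_0)

lemma Kh_memI: "c \<in> graded_chains D r Q \<Longrightarrow> diff D ar \<epsilon> c = 0 \<Longrightarrow> Kh_class D ar \<epsilon> r Q c \<in> Kh D ar \<epsilon> r Q"
  by (auto simp: Kh_def Kh_class_def homology_def)

lemma Kh_memE:
  assumes "h \<in> Kh D ar \<epsilon> r Q"
  obtains c where "c \<in> graded_chains D r Q" "diff D ar \<epsilon> c = 0" "h = Kh_class D ar \<epsilon> r Q c"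
  using assms by (auto simp: Kh_def Kh_class_def homology_def)

lemma reduced_Kh_memI:
  "c \<in> graded_reduced_chains D r Q \<Longrightarrow> diff D ar \<epsilon> c = 0 \<Longrightarrow>
    reduced_Kh_class D ar \<epsilon> r Q c \<in> reduced_Kh D ar \<epsilon> r Q"
  by (auto simp: reduced_Kh_def reduced_Kh_class_def homology_def)

lemma reduced_Kh_memE:
  assumes "h \<in> reduced_Kh D ar \<epsilon> r Q"
  obtains c where "c \<in> graded_reduced_chains D r Q" "diff D ar \<epsilon> c = 0" "h = reduced_Kh_class D ar \<epsilon> r Q c"
  using assms by (auto simp: reduced_Kh_def reduced_Kh_class_def homology_def)

section \<open>The splitting in homology and the inclusion of the second summand\<close>

context splitting
begin

context
  fixes ar :: "nat \<Rightarrow> bool" and \<epsilon> :: "nat set \<Rightarrow> nat \<Rightarrow> int" and ring :: "'r::comm_ring_1 itself"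
  assumes adm: "admissible_signs TYPE('r) D ar \<epsilon> z q S"
begin

text \<open>Changing the representative by a boundary \<open>d e\<close> changes the two components
  by the boundaries of those of the image of \<open>e\<close>, so the unions run over constant
  families.\<close>

lemma Phi_hom_Kh_class:
  fixes c :: "'r chain"
  assumes c: "c \<in> graded_chains D m s"
  shows "Phi_hom D ar \<epsilon> z q S m s (Kh_class D ar \<epsilon> m s c) =
    (reduced_Kh_class D ar \<epsilon> m (s - 1) (fst (Phi D z q S c)),
     reduced_Kh_class D ar \<epsilon> m (s + 1) (snd (Phi D z q S c)))"
proof -
  have c': "c \<in> chains D" using c by (simp add: graded_chains_def)
  have eq: "reduced_Kh_class D ar \<epsilon> m (s - 1) (fst (Phi D z q S y)) = reduced_Kh_class D ar \<epsilon> m (s - 1) (fst (Phi D z q S c))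
      \<and> reduced_Kh_class D ar \<epsilon> m (s + 1) (snd (Phi D z q S y)) = reduced_Kh_class D ar \<epsilon> m (s + 1) (snd (Phi D z q S c))"
    if "y \<in> Kh_class D ar \<epsilon> m s c" for y
    using that
  proof (rule Kh_class_memE)
    fix e assume e: "e \<in> graded_chains D (m - 1) s" and y: "y = c + diff D ar \<epsilon> e"
    have e': "e \<in> chains D" using e by (simp add: graded_chains_def)
    have "fst (Phi D z q S y) - fst (Phi D z q S c) = diff D ar \<epsilon> (fst (Phi D z q S e))"
      "snd (Phi D z q S y) - snd (Phi D z q S c) = diff D ar \<epsilon> (snd (Phi D z q S e))"
      unfolding y Phi_add[OF c' diff_in_chains[OF e']] Phi_diff[OF adm e'] by simp_all
    then show ?thesis
      unfolding reduced_Kh_class_eq_iff using Phi_graded[OF e] by blast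
  qed
  have const: "(\<Union>y\<in>Kh_class D ar \<epsilon> m s c. F y) = F c"
    if "\<And>y. y \<in> Kh_class D ar \<epsilon> m s c \<Longrightarrow> F y = F c" for F :: "'r chain \<Rightarrow> 'r chain set"
    using that Kh_class_self[of c D ar \<epsilon> m s] by blast
  show ?thesis unfolding Phi_hom_def prod.inject by (intro conjI const) (use eq in blast)+
qed

lemma inj_on_Phi_hom: "inj_on (Phi_hom D ar \<epsilon> z q S m s) (Kh D ar \<epsilon> m s :: 'r chain set set)"
proof (rule inj_onI)
  fix h h' :: "'r chain set"
  assume "h \<in> Kh D ar \<epsilon> m s" "h' \<in> Kh D ar \<epsilon> m s"
    and eq: "Phi_hom D ar \<epsilon> z q S m s h = Phi_hom D ar \<epsilon> z q S m s h'"
  then obtain c c' where c: "c \<in> graded_chains D m s" "h = Kh_class D ar \<epsilon> m s c"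
    and c': "c' \<in> graded_chains D m s" "h' = Kh_class D ar \<epsilon> m s c'"
    by (elim Kh_memE)
  have in_chains: "c \<in> chains D" "c' \<in> chains D" using c c' by (simp_all add: graded_chains_def)
  obtain u v where u: "u \<in> graded_reduced_chains D (m - 1) (s - 1)"
    "fst (Phi D z q S c) - fst (Phi D z q S c') = diff D ar \<epsilon> u"
    and v: "v \<in> graded_reduced_chains D (m - 1) (s + 1)"
    "snd (Phi D z q S c) - snd (Phi D z q S c') = diff D ar \<epsilon> v"
    using eq unfolding c(2) c'(2) Phi_hom_Kh_class[OF c(1)] Phi_hom_Kh_class[OF c'(1)]
      prod.inject reduced_Kh_class_eq_iff by blast
  obtain e where e: "e \<in> graded_chains D (m - 1) s" "Phi D z q S e = (u, v)"
    using Phi_surj[OF u(1) v(1)] .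
  have e': "e \<in> chains D" using e(1) by (simp add: graded_chains_def)
  have "Phi D z q S (c' + diff D ar \<epsilon> e) = Phi D z q S c"
  proof (rule prod_eqI)
    show "fst (Phi D z q S (c' + diff D ar \<epsilon> e)) = fst (Phi D z q S c)"
      unfolding Phi_add(1)[OF in_chains(2) diff_in_chains[OF e']] Phi_diff[OF adm e'] e(2) map_prod_simp fst_conv
        u(2)[symmetric] by simp
    show "snd (Phi D z q S (c' + diff D ar \<epsilon> e)) = snd (Phi D z q S c)"
      unfolding Phi_add(2)[OF in_chains(2) diff_in_chains[OF e']] Phi_diff[OF adm e'] e(2) map_prod_simp snd_conv
        v(2)[symmetric] by simp
  qed
  then have "c' + diff D ar \<epsilon> e = c"
    by (rule inj_onD[OF inj_on_Phi _ chains_add[OF in_chains(2) diff_in_chains[OF e']] in_chains(1)])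
  then have "c - c' = diff D ar \<epsilon> e" by (simp add: algebra_simps)
  then show "h = h'" unfolding c(2) c'(2) Kh_class_eq_iff using e(1) by blast
qed

text \<open>Reduces the theorem to chains: it suffices to find a cycle that \<Phi> maps exactly to
  \<open>(0, v)\<close>.\<close>

lemma inclusion_eqI:
  fixes c :: "'r chain"
  assumes c: "c \<in> graded_chains D m s" "diff D ar \<epsilon> c = 0" and Phi: "Phi D z q S c = (0, v)"
  shows "inclusion D ar \<epsilon> z q S m s (reduced_Kh_class D ar \<epsilon> m (s + 1) v) = Kh_class D ar \<epsilon> m s c"
  unfolding inclusion_def
  by (rule inv_into_f_eq[OF inj_on_Phi_hom Kh_memI[OF c]]) (simp add: Phi_hom_Kh_class[OF c(1)] Phi)

text \<open>A preimage of \<open>(0, v)\<close> is a cycle, because \<Phi> maps its differential to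
  \<open>(0, 0)\<close> and is injective on chains.\<close>

lemma inclusion_lift:
  fixes h :: "'r chain set"
  assumes h: "h \<in> reduced_Kh D ar \<epsilon> m (s + 1)"
  shows "inclusion D ar \<epsilon> z q S m s h \<in> Kh D ar \<epsilon> m s"
    and "Phi_hom D ar \<epsilon> z q S m s (inclusion D ar \<epsilon> z q S m s h) = (reduced_Kh_class D ar \<epsilon> m (s - 1) 0, h)"
proof -
  obtain v where v: "v \<in> graded_reduced_chains D m (s + 1)" "diff D ar \<epsilon> v = 0"
    and h': "h = reduced_Kh_class D ar \<epsilon> m (s + 1) v"
    using h by (rule reduced_Kh_memE)
  obtain c where c: "c \<in> graded_chains D m s" "Phi D z q S c = (0, v)"
    using Phi_surj[OF graded_reduced_chains_0 v(1)] .
  have in_chains: "c \<in> chains D" using c(1) by (simp add: graded_chains_def)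
  have "Phi D z q S (diff D ar \<epsilon> c) = (diff D ar \<epsilon> 0, 0)"
    unfolding Phi_diff[OF adm in_chains] c(2) by (simp add: v(2))
  also have "\<dots> = Phi D z q S (diff D ar \<epsilon> 0)"
  proof -
    have "(0 :: 'r chain) \<in> chains D" using graded_chains_0 by (auto simp: graded_chains_def)
    then have "Phi D z q S (0 :: 'r chain) = (0, 0)"
      by (simp add: Phi_eq chain_apply) (simp add: zero_fun_def)
    then show ?thesis by simp
  qed
  finally have "diff D ar \<epsilon> c = diff D ar \<epsilon> 0"
    using diff_in_chains[OF in_chains] diff_in_chains[of 0] graded_chains_0[of D]
    by (intro inj_onD[OF inj_on_Phi]) (auto simp: graded_chains_def)
  then have cycle: "diff D ar \<epsilon> c = 0" by simp
  have incl: "inclusion D ar \<epsilon> z q S m s h = Kh_class D ar \<epsilon> m s c"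
    unfolding h' by (rule inclusion_eqI[OF c(1) cycle c(2)])
  show "inclusion D ar \<epsilon> z q S m s h \<in> Kh D ar \<epsilon> m s"
    unfolding incl by (rule Kh_memI[OF c(1) cycle])
  show "Phi_hom D ar \<epsilon> z q S m s (inclusion D ar \<epsilon> z q S m s h) = (reduced_Kh_class D ar \<epsilon> m (s - 1) 0, h)"
    unfolding incl Phi_hom_Kh_class[OF c(1)] c(2) by (simp add: h')
qed

lemma inj_on_inclusion: "inj_on (inclusion D ar \<epsilon> z q S m s) (reduced_Kh D ar \<epsilon> m (s + 1) :: 'r chain set set)"
  by (rule inj_onI) (metis inclusion_lift(2) prod.inject)

end

end

section \<open>Closed braids\<close>

locale braid =
  fixes b :: nat and w :: "(nat \<times> bool) list"
  assumes word: "braid_word b w"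
begin

abbreviation "D \<equiv> braid_closure b w"
abbreviation "n \<equiv> length w"
abbreviation "left t \<equiv> fst (w ! t)"
abbreviation "strand \<equiv> strand_edge b w"

text \<open>The column of an edge, recovered from the numbering of the edges that leave each letter.
  The braid-like smoothing joins only ends in the same column, so this labels its parallel
  circles.\<close>

definition position :: "nat \<Rightarrow> nat" where
  "position e = (if e < b then e else left ((e - b) div 2) + (e - b) mod 2)"

lemma left_less: "t < n \<Longrightarrow> Suc (left t) < b"
  using word nth_mem[of t w] unfolding braid_word_def by (cases "w ! t") fastforce

lemma position_bottom: "k < b \<Longrightarrow> position k = k"
  by (simp add: position_def)

lemma position_out: "position (b + 2 * t) = left t" "position (Suc (b + 2 * t)) = Suc (left t)"
proof -
  show "position (b + 2 * t) = left t" by (simp add: position_def)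
  have "Suc (b + 2 * t) - b = Suc (2 * t)" by simp
  then show "position (Suc (b + 2 * t)) = Suc (left t)" by (simp add: position_def)
qed

lemma position_less: "e < b + 2 * n \<Longrightarrow> position e < b"
proof (cases "e < b")
  case False
  assume "e < b + 2 * n"
  then have "(e - b) div 2 < n" using False by auto
  moreover have "(e - b) mod 2 < 2" by simp
  ultimately show ?thesis
    using left_less[of "(e - b) div 2"] False unfolding position_def by auto
qed (simp add: position_def)

lemma strand_less: "k < b \<Longrightarrow> strand t k < b + 2 * t"
  by (induction t) auto

lemma position_strand: "k < b \<Longrightarrow> position (strand t k) = k"
proof (induction t)
  case 0
  then show ?case by (simp add: position_bottom)
next
  case (Suc t)
  then show ?case using position_out[of t] by simp
qed

lemma inj_on_strand: "inj_on (strand t) {..<b}"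
  by (rule inj_on_inverseI[where g = position]) (simp add: position_strand)

lemma close_edge_top: "k < b \<Longrightarrow> close_edge b w (strand n k) = k"
  by (simp add: close_edge_def inv_into_f_f[OF inj_on_strand])

lemma close_edge_not_top: "e \<notin> strand n ` {..<b} \<Longrightarrow> close_edge b w e = e"
  by (simp add: close_edge_def)

lemma position_close_edge: "position (close_edge b w e) = position e"
  by (cases "e \<in> strand n ` {..<b}") (auto simp: close_edge_top close_edge_not_top position_bottom position_strand)

text \<open>A bottom edge that is also a top edge runs along a column without crossings, so it
  closes up to itself.\<close>

lemma close_edge_bottom: "k < b \<Longrightarrow> close_edge b w k = k"
proof (cases "k \<in> strand n ` {..<b}")
  case True
  assume "k < b"
  obtain k' where k': "k' < b" "k = strand n k'" using True by auto
  then have "k' = k" using position_strand[OF k'(1), of n] \<open>k < b\<close> by (simp add: position_bottom)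
  then show ?thesis using close_edge_top[OF k'(1)] k'(2) by metis
qed (simp add: close_edge_not_top)

lemma edges_D: "edges D = close_edge b w ` {..<b + 2 * n}"
  and crossings_D: "crossings D = {..<n}"
  and positive_D: "positive D t = snd (w ! t)"
  by (simp_all add: braid_closure_def)

lemma pd_D: "pd D t =
    (if snd (w ! t)
     then [close_edge b w (strand t (Suc (left t))), close_edge b w (Suc (b + 2 * t)),
       close_edge b w (b + 2 * t), close_edge b w (strand t (left t))]
     else [close_edge b w (strand t (left t)), close_edge b w (strand t (Suc (left t))),
       close_edge b w (Suc (b + 2 * t)), close_edge b w (b + 2 * t)])"
  by (simp add: braid_closure_def Let_def)

lemma close_edge_in_edges: "e < b + 2 * n \<Longrightarrow> close_edge b w e \<in> edges D"
  by (simp add: edges_D)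

lemma ends_in_D:
  assumes t: "t < n"
  shows "close_edge b w (strand t (left t)) \<in> edges D"
    "close_edge b w (strand t (Suc (left t))) \<in> edges D"
    "close_edge b w (b + 2 * t) \<in> edges D" "close_edge b w (Suc (b + 2 * t)) \<in> edges D"
  using t left_less[OF t] strand_less[of "left t" t] strand_less[of "Suc (left t)" t]
  by (auto intro!: close_edge_in_edges)

text \<open>Passing a crossing replaces its two incoming edges by its two outgoing ones among the
  \<open>b\<close> edges at a given height, and the closure identifies top and bottom; so \<open>K\<close> contains as many
  incoming as outgoing ends.\<close>

lemma even_ends_braid: "even (\<Sum>x\<in>crossings D. card {j \<in> {..<4}. pd D x ! j \<in> K})"
proof -
  define inK :: "nat \<Rightarrow> int" where "inK e = of_bool (close_edge b w e \<in> K)" for e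
  define N where "N t = (\<Sum>k<b. inK (strand t k))" for t
  define ins where "ins t = inK (strand t (left t)) + inK (strand t (Suc (left t)))" for t
  define outs where "outs t = inK (b + 2 * t) + inK (Suc (b + 2 * t))" for t
  have step: "N (Suc t) - N t = outs t - ins t" if t: "t < n" for t
  proof -
    let ?A = "{..<b} - {left t} - {Suc (left t)}"
    have split: "(\<Sum>k<b. f k) = f (left t) + (f (Suc (left t)) + (\<Sum>k\<in>?A. f k))" for f :: "nat \<Rightarrow> int"
      using left_less[OF t]
      by (simp add: sum.remove[of "{..<b}" "left t"] sum.remove[of "{..<b} - {left t}" "Suc (left t)"])
    have "(\<Sum>k\<in>?A. inK (strand (Suc t) k)) = (\<Sum>k\<in>?A. inK (strand t k))"
      by (rule sum.cong) auto
    then show ?thesis unfolding N_def split outs_def ins_def by simp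
  qed
  have "N n = N 0" unfolding N_def inK_def
    by (rule sum.cong) (simp_all add: close_edge_top close_edge_bottom)
  moreover have "(\<Sum>t<n. outs t - ins t) = (\<Sum>t<n. N (Suc t) - N t)"
    by (rule sum.cong) (simp_all add: step)
  ultimately have "(\<Sum>t<n. outs t - ins t) = 0"
    by (simp only: sum_lessThan_telescope diff_self)
  then have eq: "(\<Sum>t<n. outs t) = (\<Sum>t<n. ins t)" by (simp add: sum_subtractf)
  have "int (\<Sum>x\<in>crossings D. card {j \<in> {..<4}. pd D x ! j \<in> K}) = (\<Sum>t<n. outs t + ins t)"
    unfolding card_less_four crossings_D of_nat_sum
    by (rule sum.cong) (auto simp: pd_D outs_def ins_def inK_def)
  also have "\<dots> = 2 * (\<Sum>t<n. ins t)" by (simp add: sum.distrib eq)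
  finally have "even (int (\<Sum>x\<in>crossings D. card {j \<in> {..<4}. pd D x ! j \<in> K}))" by simp
  then show ?thesis by (simp only: even_of_nat_iff)
qed

sublocale link_code D
proof
  fix x j :: nat
  assume "x \<in> crossings D" "j < 4"
  then have x: "x < n" and j: "j \<in> {0, 1, 2, 3}" by (auto simp: crossings_D)
  show "pd D x ! j \<in> edges D"
    using j ends_in_D[OF x] by (auto simp: pd_D)
next
  show "even (\<Sum>x\<in>crossings D. card {j \<in> {..<4}. pd D x ! j \<in> K})" for K
    by (rule even_ends_braid)
qed (simp_all add: crossings_D edges_D)

abbreviation "A \<equiv> braid_resolution D"

lemma braid_resolution_iff: "t \<in> A \<longleftrightarrow> t < n \<and> \<not> snd (w ! t)"
  by (auto simp: braid_resolution_def crossings_D positive_D)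

lemma position_connected:
  assumes "(a, e) \<in> connected_in D A"
  shows "position e = position a"
proof -
  have "e \<in> {e. position e = position a}"
    using assms
  proof (rule sym_closure_invariant)
    fix c d assume "(c, d) \<in> smoothing_arcs D A"
    then obtain t where t: "t < n" and cd: "(c, d) \<in> crossing_arcs D A t"
      by (auto simp: smoothing_arcs_alt crossings_D)
    then have "position c = position d"
      using left_less[OF t]
      by (auto simp: crossing_arcs_def braid_resolution_iff pd_D position_close_edge position_strand
          position_out split: if_splits)
    then show "c \<in> {e. position e = position a} \<longleftrightarrow> d \<in> {e. position e = position a}" by simp
  qed simp
  then show ?thesis by simp
qed

text \<open>Going down one letter, the braid-like smoothing joins each outgoing edge to the incoming
  edge of the same column.\<close>

lemma strand_connected:
  assumes "t \<le> n" "k < b"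
  shows "(close_edge b w (strand t k), k) \<in> connected_in D A"
  using assms(1)
proof (induction t)
  case 0
  then show ?case by (simp add: close_edge_bottom assms(2))
next
  case (Suc t)
  then have t: "t < n" and IH: "(close_edge b w (strand t k), k) \<in> connected_in D A" by auto
  have arcs: "crossing_arcs D A t \<subseteq> smoothing_arcs D A"
    using t by (auto simp: smoothing_arcs_alt crossings_D)
  have "(close_edge b w (b + 2 * t), close_edge b w (strand t (left t))) \<in> connected_in D A"
    "(close_edge b w (Suc (b + 2 * t)), close_edge b w (strand t (Suc (left t)))) \<in> connected_in D A"
  proof -
    have "(close_edge b w (b + 2 * t), close_edge b w (strand t (left t))) \<in> crossing_arcs D A t \<or>
        (close_edge b w (strand t (left t)), close_edge b w (b + 2 * t)) \<in> crossing_arcs D A t"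
      "(close_edge b w (strand t (Suc (left t))), close_edge b w (Suc (b + 2 * t))) \<in> crossing_arcs D A t"
      using t by (auto simp: crossing_arcs_def braid_resolution_iff pd_D)
    then show "(close_edge b w (b + 2 * t), close_edge b w (strand t (left t))) \<in> connected_in D A"
      "(close_edge b w (Suc (b + 2 * t)), close_edge b w (strand t (Suc (left t)))) \<in> connected_in D A"
      using arcs by (blast intro: sym_closure_arc sym_closure_sym)+
  qed
  then show ?case using IH by (auto intro: sym_closure_trans)
qed

lemma edge_connected_position:
  assumes "a \<in> edges D"
  shows "(a, position a) \<in> connected_in D A" "position a < b"
proof -
  obtain e where e: "e < b + 2 * n" "a = close_edge b w e" using assms by (auto simp: edges_D)
  have pos: "position a = position e" by (simp add: e position_close_edge)
  show less: "position a < b" using position_less[OF e(1)] pos by simp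
  \<comment> \<open>Bottom edges occur at height 0, the edges leaving letter \<open>t\<close> at
    height \<open>t + 1\<close>.\<close>
  have "\<exists>t\<le>n. e = strand t (position e)"
  proof (cases "e < b")
    case True
    then show ?thesis by (intro exI[of _ 0]) (simp add: position_bottom)
  next
    case False
    define t where "t = (e - b) div 2"
    have t: "t < n" using e(1) False by (auto simp: t_def)
    have "(e - b) mod 2 = 0 \<or> (e - b) mod 2 = 1" by auto
    then have "e = b + 2 * t \<or> e = Suc (b + 2 * t)"
      using False div_mult_mod_eq[of "e - b" 2] by (auto simp: t_def)
    then show ?thesis
      using t position_out[of t] by (intro exI[of _ "Suc t"]) auto
  qed
  then obtain t where "t \<le> n" "e = strand t (position a)" by (auto simp: pos)
  then show "(a, position a) \<in> connected_in D A"
    using strand_connected[of t "position a"] less e(2) by simp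
qed

lemma bottom_in_edges: "k < b \<Longrightarrow> k \<in> edges D"
  using close_edge_in_edges[of k] by (simp add: close_edge_bottom)

text \<open>Edges below \<open>b\<close> equal their position, which is constant along a circle, and
  all other edges are at least \<open>b\<close>. So the least edge, which names the circle, is its
  bottom edge.\<close>

lemma circle_braid:
  assumes "a \<in> edges D"
  shows "circle D A a = position a"
proof -
  have "position a \<le> e" if e: "e \<in> edges D" "(a, e) \<in> connected_in D A" for e
  proof (cases "e < b")
    case True
    then show ?thesis using position_connected[OF e(2)] position_bottom by simp
  next
    case False
    then show ?thesis using edge_connected_position(2)[OF assms] by simp
  qed
  then show ?thesis
    unfolding circle_alt using edge_connected_position[OF assms] bottom_in_edges
    by (intro Min_eqI) (auto simp: finite_edges)
qed

lemma circles_braid: "circles D A = {..<b}"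
proof
  show "circles D A \<subseteq> {..<b}"
    using edge_connected_position(2) by (auto simp: circles_def circle_braid)
  show "{..<b} \<subseteq> circles D A"
  proof
    fix k assume "k \<in> {..<b}"
    then show "k \<in> circles D A"
      using circle_in_circles[OF bottom_in_edges, of k A] by (simp add: circle_braid bottom_in_edges position_bottom)
  qed
qed

lemma vgen_braid: "k < b \<Longrightarrow> vgen D A k = gen k"
  by (simp add: vgen_def circle_braid bottom_in_edges position_bottom)

end


section \<open>The odd Plamenevskaya invariants\<close>

definition top_form :: "nat \<Rightarrow> 'r::comm_ring_1 ext" where
  "top_form b = wedge_list (map gen [0..<b])"

definition reduced_top_form :: "nat \<Rightarrow> 'r::comm_ring_1 ext" where
  "reduced_top_form b = wedge_list (map (\<lambda>i. gen i - gen (Suc i)) [0..<b - 1])"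

lemma top_form_gen_prod: "top_form b = gen_prod (\<lambda>i. i) {..<b}"
proof -
  have "sorted_list_of_set {..<b} = [0..<b]"
    by (simp add: lessThan_atLeast0)
  then show ?thesis by (simp add: top_form_def gen_prod_def)
qed

lemma wedge_gen_top_form: "i < b \<Longrightarrow> wedge (gen i) (top_form b) = 0"
  using wedge_gen_prod[of "{..<b}" "\<lambda>i. i" i] by (simp add: top_form_gen_prod)

lemma top_form_in_ext_alg: "top_form b \<in> ext_alg {..<b}"
  by (simp add: top_form_gen_prod gen_prod_in_ext_alg)

lemma top_form_degree: "top_form b I \<noteq> 0 \<Longrightarrow> card I = b"
  by (auto simp: top_form_gen_prod gen_prod_id split: if_splits)

lemma reduced_top_form_in_reduced_ext: "(reduced_top_form b :: 'r::comm_ring_1 ext) \<in> reduced_ext {..<b}"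
proof -
  have list: "(wedge_list (map (\<lambda>i. gen i - gen (Suc i)) is) :: 'r ext) \<in> reduced_ext {..<b}"
    if "set is \<subseteq> {..<b - 1}" for "is"
    using that
  proof (induction "is")
    case Nil
    then show ?case by (simp add: reduced_ext.one)
  next
    case (Cons i "is")
    have "(gen i - gen (Suc i) :: 'r ext) \<in> ker_phi {..<b}"
      using Cons.prems by (intro gen_diff_in_ker_phi) auto
    then show ?case using Cons by (auto intro: reduced_ext.wedge)
  qed
  show ?thesis unfolding reduced_top_form_def by (rule list) auto
qed

text \<open>\<open>v_k \<and> (v_k - v_(k+1)) = - v_k \<and> v_(k+1)\<close>, so each difference
  contributes one factor \<open>-1\<close> and hands \<open>v_(k+1)\<close> on to the next; hence
  the induction with varying \<open>k\<close>.\<close>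

lemma wedge_gen_reduced_prod:
  assumes "k + m < b"
  shows "wedge (gen k) (wedge_list (map (\<lambda>i. gen i - gen (Suc i)) [k..<k + m])) =
    smul ((- 1) ^ m) (wedge_list (map gen [k..<Suc (k + m)]) :: 'r::comm_ring_1 ext)"
  using assms
proof (induction m arbitrary: k)
  case 0
  then show ?case by simp
next
  case (Suc m)
  define R where "R = (wedge_list (map (\<lambda>i. gen i - gen (Suc i)) [Suc k..<Suc k + m]) :: 'r ext)"
  have upt: "[k..<k + Suc m] = k # [Suc k..<Suc k + m]" "[k..<Suc (k + Suc m)] = k # [Suc k..<Suc (Suc k + m)]"
    by (simp_all add: upt_conv_Cons)
  have IH: "wedge (gen (Suc k)) R = smul ((- 1) ^ m) (wedge_list (map gen [Suc k..<Suc (Suc k + m)]))"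
    unfolding R_def using Suc.prems by (intro Suc.IH) simp
  have "wedge (gen k) (wedge (gen k - gen (Suc k)) R) = - wedge (gen k) (wedge (gen (Suc k)) R)"
    by (simp add: wedge_diff_left wedge_diff_right wedge_gen_square)
  also have "\<dots> = smul ((- 1) ^ Suc m) (wedge (gen k) (wedge_list (map gen [Suc k..<Suc (Suc k + m)])))"
    unfolding IH by (simp add: wedge_smul_right smul_minus_1[symmetric] smul_smul)
  finally show ?case by (simp only: upt list.map wedge_list_Cons R_def[symmetric])
qed

lemma wedge_gen_reduced_top_form:
  "0 < b \<Longrightarrow> wedge (gen 0) (reduced_top_form b) = smul ((- 1) ^ (b - 1)) (top_form b :: 'r::comm_ring_1 ext)"
  using wedge_gen_reduced_prod[of 0 "b - 1" b] by (simp add: top_form_def reduced_top_form_def)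

text \<open>The top form is, up to sign, \<open>v_0\<close> times the reduced one, and \<partial>
  kills the latter; the derivation rule then returns it.\<close>

lemma contract_top_form:
  assumes "0 < b"
  shows "contract {..<b} (top_form b) = smul ((- 1) ^ (b - 1)) (reduced_top_form b :: 'r::comm_ring_1 ext)"
proof -
  have sign: "smul ((- 1) ^ (b - 1)) (smul ((- 1) ^ (b - 1)) \<omega>) = \<omega>" for \<omega> :: "'r ext"
    by (simp add: smul_smul power_add[symmetric] mult_2[symmetric])
  have R: "contract {..<b} (reduced_top_form b :: 'r ext) = 0"
    by (simp add: contract_reduced_ext reduced_top_form_in_reduced_ext)
  have "reduced_top_form b = contract {..<b} (wedge (gen 0) (reduced_top_form b) :: 'r ext)"
    using assms
    by (simp add: contract_wedge_gen[of _ _ "{..<b}"] reduced_ext_in_ext_alg reduced_top_form_in_reduced_ext R)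
  also have "\<dots> = smul ((- 1) ^ (b - 1)) (contract {..<b} (top_form b))"
    by (simp add: wedge_gen_reduced_top_form[OF assms] contract_smul)
  finally have "reduced_top_form b = smul ((- 1) ^ (b - 1)) (contract {..<b} (top_form b) :: 'r ext)" .
  then show ?thesis by (simp only: sign)
qed

text \<open>Read off from the contraction of the single monomial of degree \<open>b\<close>, which
  avoids expanding the differences.\<close>

lemma reduced_top_form_degree:
  assumes "0 < b" "(reduced_top_form b :: 'r::comm_ring_1 ext) I \<noteq> 0"
  shows "card I = b - 1"
proof -
  have "contract {..<b} (top_form b :: 'r ext) I \<noteq> 0"
    using assms(2) unfolding contract_top_form[OF assms(1)] by (auto simp: smul_def uminus_power_if)
  then obtain k where "finite I" "k \<notin> I" "(top_form b :: 'r ext) (insert k I) \<noteq> 0"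
    by (rule contract_support)
  then show ?thesis using top_form_degree by fastforce
qed

section \<open>The invariants as cycles, and their image under the splitting\<close>

lemma at_vertex_apply: "at_vertex \<alpha> \<omega> \<beta> = (if \<beta> = \<alpha> then \<omega> else 0)"
  by (simp add: at_vertex_def)

lemma ext_map_gen_diff:
  assumes "finite C" "i \<in> C" "j \<in> C"
  shows "ext_map C f (wedge (gen i - gen j) \<omega>) = wedge (gen (f i) - gen (f j)) (ext_map C f \<omega>)"
proof -
  have "ext_map C f (- \<omega>') = - ext_map C f \<omega>'" for \<omega>' :: "'a ext"
    using ext_map_smul[of C f "- 1" \<omega>'] by (simp add: smul_minus_1)
  then have "ext_map C f (\<omega>' - \<eta>) = ext_map C f \<omega>' - ext_map C f \<eta>" for \<omega>' \<eta> :: "'a ext"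
    using ext_map_add[of C f \<omega>' "- \<eta>"] by simp
  then show ?thesis by (simp add: wedge_diff_left ext_map_wedge_gen assms)
qed

text \<open>The factor \<open>v_i - v_(i+1)\<close> is mapped to 0, and with it the whole
  product.\<close>

lemma ext_map_reduced_top_form:
  assumes "Suc i < b" "f i = f (Suc i)"
  shows "ext_map {..<b} f (reduced_top_form b :: 'r::comm_ring_1 ext) = 0"
proof -
  have zero: "ext_map {..<b} f (0 :: 'r ext) = 0"
    using ext_map_smul[of "{..<b}" f 0 "0 :: 'r ext"] by simp
  have list: "ext_map {..<b} f (wedge_list (map (\<lambda>i. gen i - gen (Suc i)) is) :: 'r ext) = 0"
    if "set is \<subseteq> {..<b - 1}" "i \<in> set is" for "is"
    using that
  proof (induction "is")
    case (Cons j "is")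
    have "j \<in> {..<b}" "Suc j \<in> {..<b}" using Cons.prems by auto
    note eq = ext_map_gen_diff[OF finite_lessThan this]
    show ?case
    proof (cases "i = j")
      case True
      then show ?thesis using assms(2) by (simp add: eq)
    next
      case False
      then show ?thesis using Cons by (simp add: eq)
    qed
  qed simp
  show ?thesis unfolding reduced_top_form_def by (rule list) (use assms(1) in auto)
qed

context braid
begin

lemma psi_eq: "psi b w = at_vertex A (top_form b :: 'r::comm_ring_1 ext)"
proof -
  have "map (vgen D A) [0..<b] = (map gen [0..<b] :: 'r ext list)" by (simp add: vgen_braid)
  then show ?thesis unfolding psi_def Let_def top_form_def by (simp only:)
qed

lemma reduced_psi_eq: "reduced_psi b w = at_vertex A (reduced_top_form b :: 'r::comm_ring_1 ext)"
proof -
  have "map (\<lambda>i. vgen D A i - vgen D A (Suc i)) [0..<b - 1] =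
      (map (\<lambda>i. gen i - gen (Suc i)) [0..<b - 1] :: 'r ext list)"
    by (simp add: vgen_braid)
  then show ?thesis unfolding reduced_psi_def Let_def reduced_top_form_def by (simp only:)
qed

text \<open>A crossing outside the braid-like vertex is positive, and its 0-smoothing has one arc on
  each of two neighbouring parallel circles. So the edge is a merge, and \<open>f\<close> identifies
  their generators.\<close>

lemma edge_map_braid:
  assumes t: "t < n" "t \<notin> A"
  obtains f where "Suc (left t) < b" "f (left t) = f (Suc (left t))"
    "\<And>\<omega>. edge_map D ar A t \<omega> = ext_map {..<b} f (\<omega> :: 'r::comm_ring_1 ext)"
proof
  let ?\<beta> = "insert t A"
  have pos: "snd (w ! t)" using t by (simp add: braid_resolution_iff)
  show less: "Suc (left t) < b" by (rule left_less[OF t(1)])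
  have tD: "t \<in> crossings D" using t(1) by (simp add: crossings_D)
  have ends: "pd D t ! 0 = close_edge b w (strand t (Suc (left t)))" "pd D t ! 2 = close_edge b w (b + 2 * t)"
    "pd D t ! 3 = close_edge b w (strand t (left t))"
    using pos by (simp_all add: pd_D)
  have circ: "circle D A (pd D t ! 0) = Suc (left t)" "circle D A (pd D t ! 2) = left t"
    "circle D A (pd D t ! 3) = left t"
    unfolding ends using less
    by (simp_all add: circle_braid ends_in_D[OF t(1)] position_close_edge position_strand position_out)
  show "edge_map D ar A t \<omega> = ext_map {..<b} (circle D ?\<beta>) \<omega>" for \<omega> :: "'r ext"
    by (simp add: edge_map_def Let_def circ circles_braid)
  \<comment> \<open>The new arc joins ends 0 and 3, whereas the old circles are named by bottom
    edges; \<open>merge_connected\<close> transfers the identification from the ends to these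
    names.\<close>
  have "(pd D t ! 0, pd D t ! 2) \<notin> connected_in D A"
    using circle_eqI[of "pd D t ! 0" "pd D t ! 2" A] circ by auto
  note sub = merge_connected[OF tD t(2) this]
  have "circle D ?\<beta> (circle D A e) = circle D ?\<beta> e" if "e \<in> edges D" for e
    using sub circle_in_class(2)[OF that, of A] circle_eqI by (metis subsetD)
  from this[of "pd D t ! 0"] this[of "pd D t ! 3"]
  have "circle D ?\<beta> (Suc (left t)) = circle D ?\<beta> (pd D t ! 0)" "circle D ?\<beta> (left t) = circle D ?\<beta> (pd D t ! 3)"
    using ends_in_edges[OF tD] by (simp_all add: circ)
  moreover have "(pd D t ! 0, pd D t ! 3) \<in> connected_in D ?\<beta>"
    using tD by (auto simp: smoothing_arcs_alt crossing_arcs_def intro!: sym_closure_arc)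
  ultimately show "circle D ?\<beta> (left t) = circle D ?\<beta> (Suc (left t))"
    using circle_eqI by simp
qed

lemma edge_map_reduced_top_form:
  assumes "t < n" "t \<notin> A"
  shows "edge_map D ar A t (reduced_top_form b :: 'r::comm_ring_1 ext) = 0"
  using edge_map_braid[OF assms, where 'r = 'r] ext_map_reduced_top_form by metis

text \<open>Up to sign the top form is a multiple of the reduced one, which the algebra map already
  kills.\<close>

lemma edge_map_top_form:
  assumes "t < n" "t \<notin> A"
  shows "edge_map D ar A t (top_form b :: 'r::comm_ring_1 ext) = 0"
proof -
  obtain f where f: "Suc (left t) < b" "f (left t) = f (Suc (left t))"
    "\<And>\<omega>. edge_map D ar A t \<omega> = ext_map {..<b} f (\<omega> :: 'r ext)"
    using edge_map_braid[OF assms] by blast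
  have b: "0 < b" using f(1) by simp
  have "smul ((- 1) ^ (b - 1)) (ext_map {..<b} f (top_form b :: 'r ext)) =
      wedge (gen (f 0)) (ext_map {..<b} f (reduced_top_form b))"
    unfolding ext_map_smul[symmetric] wedge_gen_reduced_top_form[OF b, symmetric]
    by (rule ext_map_wedge_gen) (use b in auto)
  also have "\<dots> = 0" by (simp add: ext_map_reduced_top_form[OF f(1,2)])
  finally have "smul ((- 1) ^ (b - 1)) (smul ((- 1) ^ (b - 1)) (ext_map {..<b} f (top_form b :: 'r ext))) = 0"
    by simp
  then show ?thesis
    by (simp add: f(3) smul_smul power_add[symmetric] mult_2[symmetric])
qed

lemma diff_at_braid_resolution:
  assumes "\<And>t. t < n \<Longrightarrow> t \<notin> A \<Longrightarrow> edge_map D ar A t \<omega> = 0"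
  shows "diff D ar \<epsilon> (at_vertex A \<omega>) = 0"
proof
  fix \<beta>
  have "edge_map D ar (\<beta> - {x}) x (at_vertex A \<omega> (\<beta> - {x})) = 0" if "x \<in> \<beta>" "\<beta> \<subseteq> crossings D" for x
    using assms[of x] that by (auto simp: at_vertex_apply crossings_D)
  then show "diff D ar \<epsilon> (at_vertex A \<omega>) \<beta> = 0 \<beta>"
    unfolding diff_apply chain_apply by (auto intro!: sum.neutral)
qed

lemma diff_psi: "diff D ar \<epsilon> (psi b w) = 0"
  unfolding psi_eq by (rule diff_at_braid_resolution) (rule edge_map_top_form)

lemma diff_reduced_psi: "diff D ar \<epsilon> (reduced_psi b w) = 0"
  unfolding reduced_psi_eq by (rule diff_at_braid_resolution) (rule edge_map_reduced_top_form)

lemma card_braid_resolution: "int (card A) = n_minus D"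
  by (simp add: n_minus_def braid_resolution_def)

lemma braid_resolution_subset: "A \<subseteq> crossings D"
  by (auto simp: braid_resolution_def)

lemma at_vertex_nonzeroD: "at_vertex \<alpha> \<omega> \<beta> I \<noteq> 0 \<Longrightarrow> \<beta> = \<alpha> \<and> \<omega> I \<noteq> 0"
  by (simp add: at_vertex_apply fun_apply_rules split: if_splits)

lemma psi_graded: "(psi b w :: 'r::comm_ring_1 chain) \<in> graded_chains D 0 (self_linking b w)"
proof -
  have "(psi b w :: 'r chain) \<in> chains D"
    unfolding psi_eq chains_iff
    using top_form_in_ext_alg[of b] braid_resolution_subset by (simp add: at_vertex_apply circles_braid)
  moreover have "0 = int (card \<alpha>) - n_minus D \<and> self_linking b w =
      int (card (circles D \<alpha>)) - 2 * int (card I) + n_plus D - 2 * n_minus D + int (card \<alpha>)"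
    if "(psi b w :: 'r chain) \<alpha> I \<noteq> 0" for \<alpha> I
  proof -
    have "\<alpha> = A" "card I = b"
      using at_vertex_nonzeroD[OF that[unfolded psi_eq]] top_form_degree by blast+
    then show ?thesis by (simp add: circles_braid self_linking_def card_braid_resolution)
  qed
  ultimately show ?thesis unfolding graded_chains_def by blast
qed

lemma reduced_psi_graded:
  assumes "0 < b"
  shows "(reduced_psi b w :: 'r::comm_ring_1 chain) \<in> graded_reduced_chains D 0 (self_linking b w + 1)"
proof -
  have "(reduced_psi b w :: 'r chain) \<in> reduced_chains D"
    unfolding reduced_psi_eq reduced_chains_iff
    using reduced_top_form_in_reduced_ext[of b] braid_resolution_subset
    by (simp add: at_vertex_apply circles_braid reduced_ext_0)
  moreover have "\<alpha> = A \<and> card I = b - 1" if "(reduced_psi b w :: 'r chain) \<alpha> I \<noteq> 0" for \<alpha> I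
    using at_vertex_nonzeroD[OF that[unfolded reduced_psi_eq]] reduced_top_form_degree[OF assms] by blast
  moreover have "int (b - 1) = int b - 1" using assms by simp
  ultimately show ?thesis
    by (force simp: graded_reduced_chains_def circles_braid self_linking_def card_braid_resolution)
qed

lemma Phi_psi:
  assumes "splitting D z q S" and b: "0 < b"
  obtains c :: "'r::comm_ring_1 chain"
  where "c = psi b w \<or> c = - psi b w" "Phi D z q S c = (0, reduced_psi b w)"
proof -
  interpret sp: splitting D z q S by (rule assms(1))
  define s :: "'r \<Rightarrow> 'r chain" where "s r = at_vertex A (smul r (top_form b))" for r
  have in_chains: "s r \<in> chains D" for r
    using top_form_in_ext_alg braid_resolution_subset
    by (auto simp: s_def chains_iff at_vertex_apply circles_braid intro: ext_alg_smul)
  define g where "g = circle D A q"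
  have g: "g \<in> {..<b}" unfolding g_def circles_braid[symmetric] by (rule circle_in_circles[OF sp.q])
  \<comment> \<open>Every generator annihilates the top form, so this is the equation that makes the
    first component vanish.\<close>
  have top: "wedge (gen g) (contract {..<b} (top_form b)) = (top_form b :: 'r ext)"
    using g by (intro wedge_gen_contract) (auto simp: top_form_in_ext_alg wedge_gen_top_form)
  have "Phi D z q S (s r) =
      (0, at_vertex A (smul (of_int (sp.sign_snd A) * r * (- 1) ^ (b - 1)) (reduced_top_form b)))" for r
  proof -
    have "s r \<alpha> - wedge (vgen D \<alpha> q) (contract (circles D \<alpha>) (s r \<alpha>)) = 0" for \<alpha>
      by (simp add: s_def at_vertex_apply circles_braid vgen_def g_def[symmetric] contract_smul
          wedge_smul_right top)
    moreover have "contract (circles D \<alpha>) (s r \<alpha>) =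
        at_vertex A (smul (r * (- 1) ^ (b - 1)) (reduced_top_form b)) \<alpha>" for \<alpha>
      by (simp add: s_def at_vertex_apply circles_braid contract_smul contract_top_form[OF b] smul_smul)
    ultimately show ?thesis
      unfolding sp.Phi_eq[OF in_chains]
      by (auto simp: fun_eq_iff[where 'b = "'r ext"] chain_apply at_vertex_apply smul_smul mult.assoc)
  qed
  \<comment> \<open>Chosen to cancel the vertex sign and the sign from contracting the top form, so
    that the second component is \<open>reduced_psi b w\<close> itself.\<close>
  moreover define r where "r = (of_int (sp.sign_snd A) * (- 1) ^ (b - 1) :: 'r)"
  have sign: "of_int (sp.sign_snd A) = (1 :: 'r) \<or> of_int (sp.sign_snd A) = (- 1 :: 'r)"
    using sp.vertex_sign_snd unfolding vertex_sign_def by (metis of_int_1 of_int_minus)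
  then have r: "r = 1 \<or> r = - 1" by (auto simp: r_def uminus_power_if)
  have "of_int (sp.sign_snd A) * r * (- 1) ^ (b - 1) = 1"
    using sign by (auto simp: r_def power_add[symmetric] mult_2[symmetric])
  ultimately have "Phi D z q S (s r) = (0, reduced_psi b w)"
    by (simp add: reduced_psi_eq)
  moreover have "s r = psi b w \<or> s r = - psi b w"
    using r by (auto simp: s_def psi_eq smul_minus_1 fun_eq_iff[where 'b = "'r ext"] chain_apply at_vertex_apply)
  ultimately show thesis using that by blast
qed

end

lemma graded_chains_uminus: "c \<in> graded_chains D r Q \<Longrightarrow> - c \<in> graded_chains D r Q"
  using graded_chains_diff[OF graded_chains_0] by fastforce

theorem proposition3p13:
  fixes b z q :: nat and w :: "(nat \<times> bool) list" and D :: diagram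
    and ar :: "nat \<Rightarrow> bool" and \<epsilon> :: "nat set \<Rightarrow> nat \<Rightarrow> int" and S :: splitting_signs
    and \<psi> \<psi>_red :: "'r::comm_ring_1 chain"
  assumes ring: "bij (of_int :: int \<Rightarrow> 'r) \<or> (\<forall>x::'r. x \<noteq> 0 \<longrightarrow> x dvd 1)"
    and braid: "b \<ge> 1" "braid_word b w" "D = braid_closure b w"
    and signs: "sign_assignment D ar \<epsilon>"
    and points: "z \<notin> edges D" "q \<in> edges D"
    and splitting: "admissible_signs TYPE('r) D ar \<epsilon> z q S"
    and invariants: "\<psi> = psi b w" "\<psi>_red = reduced_psi b w"
  shows "reduced_Kh_class D ar \<epsilon> 0 (self_linking b w + 1) \<psi>_red
           \<in> reduced_Kh D ar \<epsilon> 0 (self_linking b w + 1)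
    \<and> Kh_class D ar \<epsilon> 0 (self_linking b w) \<psi> \<in> Kh D ar \<epsilon> 0 (self_linking b w)
    \<and> (\<forall>m s. inclusion D ar \<epsilon> z q S m s ` (reduced_Kh D ar \<epsilon> m (s + 1) :: 'r chain set set)
                 \<subseteq> Kh D ar \<epsilon> m s
             \<and> inj_on (inclusion D ar \<epsilon> z q S m s) (reduced_Kh D ar \<epsilon> m (s + 1) :: 'r chain set set))
    \<and> inclusion D ar \<epsilon> z q S 0 (self_linking b w)
             (reduced_Kh_class D ar \<epsilon> 0 (self_linking b w + 1) \<psi>_red)
           \<in> {Kh_class D ar \<epsilon> 0 (self_linking b w) \<psi>, Kh_class D ar \<epsilon> 0 (self_linking b w) (- \<psi>)}"
proof -
  interpret br: braid b w by unfold_locales (rule braid(2))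
  have sp: "splitting D z q S"
    using br.link_code_axioms points splitting
    by (simp add: splitting_def splitting_axioms_def admissible_signs_def Let_def braid(3))
  interpret sp: splitting D z q S by (rule sp)
  have b: "0 < b" using braid(1) by simp
  obtain c :: "'r chain" where c: "c = \<psi> \<or> c = - \<psi>" "Phi D z q S c = (0, \<psi>_red)"
    using br.Phi_psi[OF sp[unfolded braid(3)] b] unfolding invariants braid(3) .
  have \<psi>: "\<psi> \<in> graded_chains D 0 (self_linking b w)" "diff D ar \<epsilon> \<psi> = 0"
    unfolding invariants braid(3) by (rule br.psi_graded br.diff_psi)+
  have "c \<in> graded_chains D 0 (self_linking b w)" "diff D ar \<epsilon> c = 0"
    using c(1) \<psi> by (auto simp: graded_chains_uminus diff_uminus)
  then have "inclusion D ar \<epsilon> z q S 0 (self_linking b w)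
      (reduced_Kh_class D ar \<epsilon> 0 (self_linking b w + 1) \<psi>_red) = Kh_class D ar \<epsilon> 0 (self_linking b w) c"
    by (rule sp.inclusion_eqI[OF splitting _ _ c(2)])
  moreover have "reduced_Kh_class D ar \<epsilon> 0 (self_linking b w + 1) \<psi>_red
      \<in> reduced_Kh D ar \<epsilon> 0 (self_linking b w + 1)"
    unfolding invariants braid(3) by (intro reduced_Kh_memI br.reduced_psi_graded b br.diff_reduced_psi)
  moreover have "Kh_class D ar \<epsilon> 0 (self_linking b w) \<psi> \<in> Kh D ar \<epsilon> 0 (self_linking b w)"
    by (rule Kh_memI[OF \<psi>])
  ultimately show ?thesis
    using c(1) sp.inclusion_lift(1)[OF splitting] sp.inj_on_inclusion[OF splitting] by auto
qed

end
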